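(* For every even integer $\ell$, there is a ring isomorphism $$\mathcal D_{\mathcal O(\ell D_0)}(\widetilde X)\longrightarrow \mathcal D_{\mathcal O(\ell-2)}(Y).$$
   Context: Work over $\mathbb C$, $n\ge 2$. $\widetilde X$ is the smooth toric variety $\big((\mathbb A^n\smallsetminus\{0\})\times\mathbb A^1\big)/\mathbb C^\times$ for the action $u\cdot(Q_1,\dots,Q_{n+1})=(uQ_1,\dots,uQ_n,u^{-2}Q_{n+1})$, i.e. the total space of $\mathcal O(-2)$ over $\mathbb P^{n-1}$. Its Picard group is $\mathbb Z D_0$, where $D_0$ is the divisor $\{Q_1=0\}$; $\mathcal O(\ell D_0)$ is identified with the sheaf whose sections over an open $U$ are the regular functions $f$ on the preimage of $U$ with $f(u\cdot Q)=u^\ell f(Q)$. $Y=\mathbb P^n(1,\dots,1,2)=(\mathbb A^{n+1}\smallsetminus\{0\})/\mathbb C^\times$ is the weighted projective space for the action $u\cdot(Q_1,\dots,Q_{n+1})=(uQ_1,\dots,uQ_n,u^2Q_{n+1})$, i.e. $Y=\mathrm{Proj}\,S$ with $S=\mathbb C[Q_1,\dots,Q_{n+1}]$, $\deg Q_i=1$ for $i\le n$, $\deg Q_{n+1}=2$. For an integer $m$, $\mathcal O(m)$ on $Y$ is the sheaf associated to the shifted graded module $S[m]$; it is invertible exactly when $m$ is even. For an invertible sheaf $\mathcal L$ on a variety $Z$, $\mathcal D_{\mathcal L}(Z)$ denotes the ring of global sections of the sheaf of (Grothendieck) differential operators from $\mathcal L$ to itself. *)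

theory Defs
  imports "HOL-Analysis.Analysis" "HOL-Algebra.QuotRing"
begin

section \<open>Grothendieck differential operators on a sheaf of modules\<close>

text \<open>
  The points of a variety \<open>Z\<close> are taken to be subsets (later: orbits) of an ambient type \<open>'p\<close>, so
  that the preimage of \<open>U \<subseteq> Z\<close> in \<open>'p\<close> is \<open>\<Union>U\<close>.  A sheaf on \<open>Z\<close> is given by
  its sections over open sets \<open>U\<close>, each a set of complex functions on the preimage \<open>\<Union>U\<close>.
  A function on \<open>\<Union>U\<close> is represented by its extension by zero to \<open>'p\<close>; \<open>restr U\<close> is
  therefore the restriction map to \<open>U\<close>.  In what follows \<open>T\<close> is the topology of \<open>Z\<close>, \<open>A\<close>
  the structure sheaf and \<open>L\<close> a sheaf of \<open>A\<close>-modules, the module structure being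
  pointwise multiplication.
\<close>

type_synonym 'p sections = "'p set set \<Rightarrow> ('p \<Rightarrow> complex) set"

type_synonym 'p sheaf_map = "'p set set \<Rightarrow> ('p \<Rightarrow> complex) \<Rightarrow> ('p \<Rightarrow> complex)"

definition restr :: "'p set set \<Rightarrow> ('p \<Rightarrow> complex) \<Rightarrow> ('p \<Rightarrow> complex)" where
  "restr U f = (\<lambda>p. if p \<in> \<Union>U then f p else 0)"

text \<open>
  \<open>\<complex>\<close>-linear endomorphisms of the sheaf \<open>L|U\<close>.  The last clause fixes the values outside the
  domain of definition, so that equal endomorphisms are equal as HOL functions.
\<close>

definition sheaf_endos ::
  "'p set topology \<Rightarrow> 'p sections \<Rightarrow> 'p set set \<Rightarrow> 'p sheaf_map set" where
  "sheaf_endos T L U =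
    {P. (\<forall>V. openin T V \<and> V \<subseteq> U \<longrightarrow>
           (\<forall>f\<in>L V. P V f \<in> L V) \<and>
           (\<forall>f\<in>L V. \<forall>g\<in>L V. P V (\<lambda>p. f p + g p) = (\<lambda>p. P V f p + P V g p)) \<and>
           (\<forall>c. \<forall>f\<in>L V. P V (\<lambda>p. c * f p) = (\<lambda>p. c * P V f p))) \<and>
        (\<forall>V W. openin T V \<and> V \<subseteq> U \<and> openin T W \<and> W \<subseteq> V \<longrightarrow>
           (\<forall>f\<in>L V. P W (restr W f) = restr W (P V f))) \<and>
        (\<forall>V f. \<not> (openin T V \<and> V \<subseteq> U \<and> f \<in> L V) \<longrightarrow> P V f = (\<lambda>p. 0))}"

definition restr_op :: "'p set set \<Rightarrow> 'p sheaf_map \<Rightarrow> 'p sheaf_map" where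
  "restr_op V P = (\<lambda>W f. if W \<subseteq> V then P W f else (\<lambda>p. 0))"

text \<open>
  The commutator \<open>[P|V, a]\<close> for \<open>a \<in> A(V)\<close>.  A section \<open>f\<close> over \<open>W\<close> vanishes outside
  \<open>\<Union>W\<close>, so \<open>a * f\<close> is the product of \<open>f\<close> with the restriction of \<open>a\<close> to \<open>W\<close>.
\<close>

definition commutator ::
  "'p set topology \<Rightarrow> 'p sections \<Rightarrow> 'p set set \<Rightarrow> 'p sheaf_map \<Rightarrow> ('p \<Rightarrow> complex) \<Rightarrow> 'p sheaf_map"
  where
  "commutator T L V P a =
    (\<lambda>W f. if openin T W \<and> W \<subseteq> V \<and> f \<in> L W
            then (\<lambda>p. P W (\<lambda>q. a q * f q) p - a p * P W f p) else (\<lambda>p. 0))"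

text \<open>\<open>diff_ops T A L k U\<close>: the differential operators \<open>L|U \<rightarrow> L|U\<close> of order \<open>\<le> k\<close>.\<close>

primrec diff_ops ::
  "'p set topology \<Rightarrow> 'p sections \<Rightarrow> 'p sections \<Rightarrow> nat \<Rightarrow> 'p set set \<Rightarrow> 'p sheaf_map set" where
  "diff_ops T A L 0 = (\<lambda>U. {P \<in> sheaf_endos T L U.
     \<forall>V a. openin T V \<and> V \<subseteq> U \<and> a \<in> A V \<longrightarrow> commutator T L V P a = (\<lambda>W f p. 0)})"
| "diff_ops T A L (Suc k) = (\<lambda>U. {P \<in> sheaf_endos T L U.
     \<forall>V a. openin T V \<and> V \<subseteq> U \<and> a \<in> A V \<longrightarrow> commutator T L V P a \<in> diff_ops T A L k V})"

text \<open>
  Sections over \<open>U\<close> of the sheaf of differential operators, which is the union, as a sheaf, of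
  its subsheaves of operators of bounded order: the order is required to be bounded only locally.
\<close>

definition diff_op_sheaf ::
  "'p set topology \<Rightarrow> 'p sections \<Rightarrow> 'p sections \<Rightarrow> 'p set set \<Rightarrow> 'p sheaf_map set" where
  "diff_op_sheaf T A L U = {P \<in> sheaf_endos T L U.
     \<forall>z\<in>U. \<exists>V k. openin T V \<and> z \<in> V \<and> V \<subseteq> U \<and> restr_op V P \<in> diff_ops T A L k V}"

definition diff_op_ring ::
  "'p set topology \<Rightarrow> 'p sections \<Rightarrow> 'p sections \<Rightarrow> 'p sheaf_map ring" where
  "diff_op_ring T A L =
    \<lparr>carrier = diff_op_sheaf T A L (topspace T),
     mult = (\<lambda>P Q V f. P V (Q V f)),
     one = (\<lambda>V f. if openin T V \<and> f \<in> L V then f else (\<lambda>p. 0)),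
     zero = (\<lambda>V f p. 0),
     add = (\<lambda>P Q V f p. P V f p + Q V f p)\<rparr>"


section \<open>Polynomials and regular functions on affine space\<close>

text \<open>
  \<open>'n point\<close> is \<open>\<A>\<^bsup>n+1\<^esup>\<close> with \<open>n = CARD('n)\<close>; the first component of a point
  is \<open>(Q\<^sub>1, \<dots>, Q\<^sub>n)\<close> and the second one is \<open>Q\<^bsub>n+1\<^esub>\<close>.  Polynomials over
  \<open>\<complex>\<close> are identified with the functions they define.
\<close>

type_synonym 'n point = "(complex ^ 'n) \<times> complex"

definition monomial_fun :: "('n::finite \<Rightarrow> nat) \<times> nat \<Rightarrow> 'n point \<Rightarrow> complex" where
  "monomial_fun m Q = (\<Prod>i\<in>UNIV. fst Q $ i ^ fst m i) * snd Q ^ snd m"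

definition poly_span :: "(('n::finite \<Rightarrow> nat) \<times> nat) set \<Rightarrow> ('n point \<Rightarrow> complex) set" where
  "poly_span M = {f. \<exists>S c. finite S \<and> S \<subseteq> M \<and> f = (\<lambda>Q. \<Sum>m\<in>S. c m * monomial_fun m Q)}"

abbreviation polys :: "('n::finite point \<Rightarrow> complex) set" where
  "polys \<equiv> poly_span UNIV"

definition zariski :: "'n::finite point topology" where
  "zariski = topology_generated_by {{Q. f Q \<noteq> 0} | f. f \<in> polys}"

text \<open>Regular functions on a Zariski open subset \<open>W\<close>, extended by zero.\<close>

definition regular_funs :: "'n::finite point set \<Rightarrow> ('n point \<Rightarrow> complex) set" where
  "regular_funs W = {f. (\<forall>Q. Q \<notin> W \<longrightarrow> f Q = 0) \<and>
     (\<forall>Q\<in>W. \<exists>N a b. openin zariski N \<and> Q \<in> N \<and> N \<subseteq> W \<and> a \<in> polys \<and> b \<in> polys \<and>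
        (\<forall>R\<in>N. b R \<noteq> 0 \<and> f R = a R / b R))}"

definition act :: "int \<Rightarrow> complex \<Rightarrow> 'n::finite point \<Rightarrow> 'n point" where
  "act w u Q = (u *s fst Q, u powi w * snd Q)"

definition orbit :: "int \<Rightarrow> 'n::finite point \<Rightarrow> 'n point set" where
  "orbit w Q = {act w u Q | u. u \<noteq> 0}"


section \<open>The total space of \<open>\<O>(-2)\<close> over projective space\<close>

definition Xt_points :: "'n::finite point set set" where
  "Xt_points = {orbit (-2) Q | Q. fst Q \<noteq> 0}"

definition Xt_top :: "'n::finite point set topology" where
  "Xt_top = topology (\<lambda>U. U \<subseteq> Xt_points \<and> openin zariski (\<Union>U))"

lemma act_act: "u \<noteq> 0 \<Longrightarrow> act w v (act w u Q) = act w (v * u) Q"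
  by (simp add: act_def power_int_mult_distrib vector_smult_assoc)

lemma orbit_eq:
  assumes "R \<in> orbit w Q"
  shows "orbit w R = orbit w Q"
proof -
  obtain u where u: "u \<noteq> 0" "R = act w u Q"
    using assms by (auto simp: orbit_def)
  have "act w v Q \<in> orbit w R" if "v \<noteq> 0" for v
    using that u by (auto simp: orbit_def act_act intro!: exI[of _ "v / u"])
  moreover have "act w v R \<in> orbit w Q" if "v \<noteq> 0" for v
    using that u by (auto simp: orbit_def act_act intro!: exI[of _ "v * u"])
  ultimately show ?thesis
    by (auto simp: orbit_def)
qed

lemma Union_Int_orbits:
  assumes "U \<subseteq> range (orbit w)" "V \<subseteq> range (orbit w)"
  shows "\<Union>(U \<inter> V) = \<Union>U \<inter> \<Union>V"
proof -
  have "x = orbit w R" if "x \<in> U \<union> V" "R \<in> x" for x R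
    using assms that by (auto simp: orbit_eq)
  then have "x = y" if "x \<in> U" "y \<in> V" "R \<in> x" "R \<in> y" for x y R
    using that by (metis UnI1 UnI2)
  then show ?thesis by fastforce
qed

lemma istopology_Xt: "istopology (\<lambda>U. U \<subseteq> Xt_points \<and> openin zariski (\<Union>U))"
proof -
  have "Xt_points \<subseteq> range (orbit (-2))"
    by (auto simp: Xt_points_def)
  then have "\<Union>(U \<inter> V) = \<Union>U \<inter> \<Union>V" if "U \<subseteq> Xt_points" "V \<subseteq> Xt_points"
    for U V :: "'a point set set"
    using that by (intro Union_Int_orbits) auto
  moreover have "openin zariski (\<Union>(\<Union>\<K>))" if "\<forall>U\<in>\<K>. openin zariski (\<Union>U)"
    for \<K> :: "'a point set set set"
  proof -
    have "\<Union>(\<Union>\<K>) = \<Union>(Union ` \<K>)" by blast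
    then show ?thesis using that by (metis (no_types, lifting) imageE openin_Union)
  qed
  ultimately show ?thesis
    unfolding istopology_def by (metis (no_types, lifting) Sup_least le_infI1 openin_Int)
qed

lemma openin_Xt: "openin Xt_top U \<longleftrightarrow> U \<subseteq> Xt_points \<and> openin zariski (\<Union>U)"
  unfolding Xt_top_def by (subst topology_inverse'[OF istopology_Xt]) (rule refl)

text \<open>
  \<open>Xt_sheaf l\<close> is \<open>\<O>(l D\<^sub>0)\<close>; in particular \<open>Xt_sheaf 0\<close>, the sheaf of invariant regular
  functions, is the structure sheaf of the quotient.
\<close>

definition Xt_sheaf :: "int \<Rightarrow> 'n::finite point sections" where
  "Xt_sheaf l U = {f \<in> regular_funs (\<Union>U).
     \<forall>u Q. u \<noteq> 0 \<and> Q \<in> \<Union>U \<longrightarrow> f (act (-2) u Q) = u powi l * f Q}"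


section \<open>The weighted projective space with weights \<open>1, \<dots>, 1, 2\<close>\<close>

text \<open>
  The graded pieces of \<open>S = \<complex>[Q\<^sub>1, \<dots>, Q\<^bsub>n+1\<^esub>]\<close> with
  \<open>deg Q\<^sub>i = 1\<close> for \<open>i \<le> n\<close> and \<open>deg Q\<^bsub>n+1\<^esub> = 2\<close>.
\<close>

definition S_deg :: "int \<Rightarrow> ('n::finite point \<Rightarrow> complex) set" where
  "S_deg d = poly_span {m. int ((\<Sum>i\<in>UNIV. fst m i) + 2 * snd m) = d}"

definition Y_points :: "'n::finite point set set" where
  "Y_points = {orbit 2 Q | Q. Q \<noteq> 0}"

text \<open>The topology of \<open>Proj S\<close>, with base the sets \<open>D\<^sub>+(h)\<close> for homogeneous \<open>h\<close>.\<close>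

definition Y_top :: "'n::finite point set topology" where
  "Y_top = topology_generated_by {{z \<in> Y_points. \<forall>Q\<in>z. h Q \<noteq> 0} | h d. h \<in> S_deg d}"

text \<open>
  The sheaf associated to the graded module \<open>S[m]\<close>, where \<open>S[m]\<^sub>d = S\<^bsub>m+d\<^esub>\<close>: its
  sections are locally fractions \<open>a / b\<close> with \<open>a \<in> S[m]\<^sub>d\<close> and \<open>b \<in> S\<^sub>d\<close>,
  regarded as functions on the preimage.  The structure sheaf is \<open>Y_sheaf 0\<close>.
\<close>

definition Y_sheaf :: "int \<Rightarrow> 'n::finite point sections" where
  "Y_sheaf m U = {f. (\<forall>Q. Q \<notin> \<Union>U \<longrightarrow> f Q = 0) \<and>
     (\<forall>z\<in>U. \<exists>V d a b. openin Y_top V \<and> z \<in> V \<and> V \<subseteq> U \<and> a \<in> S_deg (m + d) \<and> b \<in> S_deg d \<and>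
        (\<forall>Q\<in>\<Union>V. b Q \<noteq> 0 \<and> f Q = a Q / b Q))}"

end

theory Submission
  imports Defs "HOL-Computational_Algebra.Fundamental_Theorem_Algebra"
begin

text \<open>
  Both varieties are quotients of open cones in affine space for an action with weights
  \<open>(1, \<dots>, 1, w)\<close>, with \<open>w = -2\<close> and \<open>w = 2\<close>, and contain the charts \<open>Q\<^sub>i \<noteq> 0\<close>
  for \<open>i \<le> n\<close>.  On the torus where no coordinate vanishes, a differential operator of
  bounded order multiplies the coefficient of a Laurent monomial \<open>\<mu>\<close> in each direction \<open>\<beta>\<close> by a
  polynomial in \<open>\<mu>\<close>, because iterated commutators with monomials become iterated differences.
  Extendability to the charts makes these polynomials vanish on certain hyperplanes, hence divisible
  by the corresponding linear forms, and this says exactly that the operator is a linear combination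
  of words of weight zero in the coordinates and the partial derivatives.  Since \<open>n \<ge> 2\<close>, the
  charts \<open>Q\<^sub>i \<noteq> 0\<close> see all the hyperplanes, so that neither the zero section of
  \<open>\<O>(-2)\<close> nor the singular point of the weighted projective space needs a chart of its own.

  The isomorphism is the Fourier transform in the last coordinate, which exchanges
  \<open>Q\<^bsub>n+1\<^esub>\<close> with \<open>\<partial>\<^bsub>n+1\<^esub>\<close> and \<open>\<partial>\<^bsub>n+1\<^esub>\<close> with \<open>-Q\<^bsub>n+1\<^esub>\<close>.  It replaces the
  exponent \<open>k\<close> of \<open>Q\<^bsub>n+1\<^esub>\<close> by \<open>-1-k\<close> and thereby the degree \<open>l\<close> by \<open>l - 2\<close>.  A combination
  of words acts as zero on one side if and only if its transform acts as zero on the other: for large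
  \<open>k\<close> the two actions are conjugate by the diagonal operator with eigenvalue \<open>(-1)\<^sup>k k!\<close>, and a
  polynomial is determined by its values for large \<open>k\<close>.
\<close>

section \<open>Differential operators between two sheaves of modules\<close>

text \<open>Four points shape the proof. A single letter changes the degree of a section, so even an
  endomorphism is composed of maps between different sheaves; the calculus of orders is therefore
  set up for operators from \<open>L\<close> to \<open>M\<close>. Exponents live on the lattice
  hyperplane of weighted degree \<open>l\<close>, where a polynomial function does not determine a
  polynomial. Polynomials are therefore handled through their values: interpolation from finitely
  many nodes replaces coefficients, and rays inside the hyperplane replace genericity. The order of
  a global operator is bounded only locally. A bound on one nonempty open subset of the torus is
  enough, because a section that vanishes on a nonempty open set is zero. Combinations of words are
  elements of a free algebra, on which the Fourier transform is a mere substitution. That it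
  respects the relations, among them the one by which the Euler operator acts as the scalar
  \<open>l\<close>, is what the comparison of zero operators establishes.\<close>

definition sheaf_homs ::
  "'p set topology \<Rightarrow> 'p sections \<Rightarrow> 'p sections \<Rightarrow> 'p set set \<Rightarrow> 'p sheaf_map set" where
  "sheaf_homs T L M U =
    {P. (\<forall>V. openin T V \<and> V \<subseteq> U \<longrightarrow>
           (\<forall>f\<in>L V. P V f \<in> M V) \<and>
           (\<forall>f\<in>L V. \<forall>g\<in>L V. P V (\<lambda>p. f p + g p) = (\<lambda>p. P V f p + P V g p)) \<and>
           (\<forall>c. \<forall>f\<in>L V. P V (\<lambda>p. c * f p) = (\<lambda>p. c * P V f p))) \<and>
        (\<forall>V W. openin T V \<and> V \<subseteq> U \<and> openin T W \<and> W \<subseteq> V \<longrightarrow>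
           (\<forall>f\<in>L V. P W (restr W f) = restr W (P V f))) \<and>
        (\<forall>V f. \<not> (openin T V \<and> V \<subseteq> U \<and> f \<in> L V) \<longrightarrow> P V f = (\<lambda>p. 0))}"

lemma sheaf_endos_eq: "sheaf_endos T L U = sheaf_homs T L L U"
  by (simp add: sheaf_endos_def sheaf_homs_def)

text \<open>
  The order is shifted by one with respect to \<^const>\<open>diff_ops\<close>: \<open>diff_homs T A L M (Suc k)\<close>
  are the differential operators of order \<open>\<le> k\<close>.
\<close>

primrec diff_homs ::
  "'p set topology \<Rightarrow> 'p sections \<Rightarrow> 'p sections \<Rightarrow> 'p sections \<Rightarrow> nat \<Rightarrow> 'p set set \<Rightarrow> 'p sheaf_map set"
  where
  "diff_homs T A L M 0 = (\<lambda>U. {\<lambda>W f p. 0})"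
| "diff_homs T A L M (Suc k) = (\<lambda>U. {P \<in> sheaf_homs T L M U.
     \<forall>V a. openin T V \<and> V \<subseteq> U \<and> a \<in> A V \<longrightarrow> commutator T L V P a \<in> diff_homs T A L M k V})"

lemma diff_ops_eq: "diff_ops T A L k U = diff_homs T A L L (Suc k) U"
  by (induction k arbitrary: U) (simp_all add: sheaf_endos_eq)

text \<open>The closure properties behind the calculus of commutators, in presheaf form; a factor
  \<open>a\<close> over \<open>U\<close> may multiply a section over a smaller \<open>W\<close>, as
  it does in \<open>commutator\<close>.\<close>

definition module_sheaf :: "'p set topology \<Rightarrow> 'p sections \<Rightarrow> 'p sections \<Rightarrow> bool" where
  "module_sheaf T A L \<longleftrightarrow>
    (\<forall>U. openin T U \<longrightarrow>
      (\<lambda>p. 0) \<in> L U \<and>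
      (\<forall>f\<in>L U. \<forall>g\<in>L U. (\<lambda>p. f p + g p) \<in> L U) \<and>
      (\<forall>c. \<forall>f\<in>L U. (\<lambda>p. c * f p) \<in> L U) \<and>
      (\<forall>f\<in>L U. \<forall>p. p \<notin> \<Union>U \<longrightarrow> f p = 0) \<and>
      (\<forall>W. openin T W \<and> W \<subseteq> U \<longrightarrow>
        (\<forall>f\<in>L U. restr W f \<in> L W) \<and> (\<forall>a\<in>A U. \<forall>f\<in>L W. (\<lambda>p. a p * f p) \<in> L W)))"

context
  fixes T :: "'p set topology" and A L :: "'p sections"
  assumes ms: "module_sheaf T A L"
begin

lemma ms_zero: "openin T U \<Longrightarrow> (\<lambda>p. 0) \<in> L U"
  and ms_add: "openin T U \<Longrightarrow> f \<in> L U \<Longrightarrow> g \<in> L U \<Longrightarrow> (\<lambda>p. f p + g p) \<in> L U"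
  and ms_scale: "openin T U \<Longrightarrow> f \<in> L U \<Longrightarrow> (\<lambda>p. c * f p) \<in> L U"
  and ms_restr: "openin T U \<Longrightarrow> openin T W \<Longrightarrow> W \<subseteq> U \<Longrightarrow> f \<in> L U \<Longrightarrow> restr W f \<in> L W"
  and ms_mult: "openin T U \<Longrightarrow> openin T W \<Longrightarrow> W \<subseteq> U \<Longrightarrow> a \<in> A U \<Longrightarrow> f \<in> L W \<Longrightarrow>
    (\<lambda>p. a p * f p) \<in> L W"
  using ms by (simp_all add: module_sheaf_def)

lemma ms_diff: "openin T U \<Longrightarrow> f \<in> L U \<Longrightarrow> g \<in> L U \<Longrightarrow> (\<lambda>p. f p - g p) \<in> L U"
  using ms_add[of U f "\<lambda>p. (-1) * g p"] ms_scale[of U g "-1"] by simp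

end

section \<open>Restriction maps and homomorphisms of sheaves\<close>

lemma restr_mult: "restr W (\<lambda>p. a p * f p) = (\<lambda>p. a p * restr W f p)"
  and restr_add: "restr W (\<lambda>p. g p + f p) = (\<lambda>p. restr W g p + restr W f p)"
  and restr_diff: "restr W (\<lambda>p. g p - f p) = (\<lambda>p. restr W g p - restr W f p)"
  and restr_zero: "restr W (\<lambda>p. 0) = (\<lambda>p. 0)"
  by (auto simp: restr_def)

lemma restr_restr: "W \<subseteq> U \<Longrightarrow> restr W (restr U f) = restr W f"
  by (force simp: restr_def)

lemma sheaf_homsD:
  assumes "P \<in> sheaf_homs T L M U"
  shows "openin T V \<Longrightarrow> V \<subseteq> U \<Longrightarrow> f \<in> L V \<Longrightarrow> P V f \<in> M V"
    and "openin T V \<Longrightarrow> V \<subseteq> U \<Longrightarrow> f \<in> L V \<Longrightarrow> g \<in> L V \<Longrightarrow>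
      P V (\<lambda>p. f p + g p) = (\<lambda>p. P V f p + P V g p)"
    and "openin T V \<Longrightarrow> V \<subseteq> U \<Longrightarrow> f \<in> L V \<Longrightarrow> P V (\<lambda>p. c * f p) = (\<lambda>p. c * P V f p)"
    and "openin T V \<Longrightarrow> V \<subseteq> U \<Longrightarrow> openin T W \<Longrightarrow> W \<subseteq> V \<Longrightarrow> f \<in> L V \<Longrightarrow>
      P W (restr W f) = restr W (P V f)"
    and "\<not> (openin T V \<and> V \<subseteq> U \<and> f \<in> L V) \<Longrightarrow> P V f = (\<lambda>p. 0)"
proof -
  note P = assms[unfolded sheaf_homs_def mem_Collect_eq]
  from P[THEN conjunct1]
  show "openin T V \<Longrightarrow> V \<subseteq> U \<Longrightarrow> f \<in> L V \<Longrightarrow> P V f \<in> M V"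
    and "openin T V \<Longrightarrow> V \<subseteq> U \<Longrightarrow> f \<in> L V \<Longrightarrow> g \<in> L V \<Longrightarrow>
      P V (\<lambda>p. f p + g p) = (\<lambda>p. P V f p + P V g p)"
    and "openin T V \<Longrightarrow> V \<subseteq> U \<Longrightarrow> f \<in> L V \<Longrightarrow> P V (\<lambda>p. c * f p) = (\<lambda>p. c * P V f p)"
    by simp_all
  from P[THEN conjunct2, THEN conjunct1, rule_format, of V W f]
  show "openin T V \<Longrightarrow> V \<subseteq> U \<Longrightarrow> openin T W \<Longrightarrow> W \<subseteq> V \<Longrightarrow> f \<in> L V \<Longrightarrow>
      P W (restr W f) = restr W (P V f)"
    by simp
  from P[THEN conjunct2, THEN conjunct2, rule_format, of V f]
  show "\<not> (openin T V \<and> V \<subseteq> U \<and> f \<in> L V) \<Longrightarrow> P V f = (\<lambda>p. 0)" .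
qed

lemma sheaf_homsI:
  assumes "\<And>V f. openin T V \<Longrightarrow> V \<subseteq> U \<Longrightarrow> f \<in> L V \<Longrightarrow> P V f \<in> M V"
    and "\<And>V f g. openin T V \<Longrightarrow> V \<subseteq> U \<Longrightarrow> f \<in> L V \<Longrightarrow> g \<in> L V \<Longrightarrow>
      P V (\<lambda>p. f p + g p) = (\<lambda>p. P V f p + P V g p)"
    and "\<And>V f c. openin T V \<Longrightarrow> V \<subseteq> U \<Longrightarrow> f \<in> L V \<Longrightarrow> P V (\<lambda>p. c * f p) = (\<lambda>p. c * P V f p)"
    and "\<And>V W f. openin T V \<Longrightarrow> V \<subseteq> U \<Longrightarrow> openin T W \<Longrightarrow> W \<subseteq> V \<Longrightarrow> f \<in> L V \<Longrightarrow>
      P W (restr W f) = restr W (P V f)"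
    and "\<And>V f. \<not> (openin T V \<and> V \<subseteq> U \<and> f \<in> L V) \<Longrightarrow> P V f = (\<lambda>p. 0)"
  shows "P \<in> sheaf_homs T L M U"
  unfolding sheaf_homs_def mem_Collect_eq
  using assms(1-3) assms(4) assms(5) by (intro conjI allI impI ballI) (elim conjE, assumption | simp)+

lemma sheaf_homs_zero_section:
  assumes "P \<in> sheaf_homs T L M U" "module_sheaf T A L"
  shows "P V (\<lambda>p. 0) = (\<lambda>p. 0)"
proof (cases "openin T V \<and> V \<subseteq> U")
  case True
  then show ?thesis
    using sheaf_homsD(3)[OF assms(1), of V "\<lambda>p. 0" 0] ms_zero[OF assms(2)] by simp
next
  case False
  then show ?thesis using sheaf_homsD(5)[OF assms(1), of V] by blast
qed

lemma sheaf_homs_diff: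
  assumes P: "P \<in> sheaf_homs T L M U" and L: "module_sheaf T A L"
    and V: "openin T V" "V \<subseteq> U" "f \<in> L V" "g \<in> L V"
  shows "P V (\<lambda>p. f p - g p) = (\<lambda>p. P V f p - P V g p)"
  using sheaf_homsD(2)[OF P V(1,2,3) ms_scale[OF L V(1,4), of "-1"]]
    sheaf_homsD(3)[OF P V(1,2,4), of "-1"] by simp

lemma sheaf_homs_sum:
  assumes P: "P \<in> sheaf_homs T L M U" and L: "module_sheaf T A L"
    and V: "openin T V" "V \<subseteq> U" and "finite S" "\<And>s. s \<in> S \<Longrightarrow> f s \<in> L V"
  shows "P V (\<lambda>p. \<Sum>s\<in>S. c s * f s p) = (\<lambda>p. \<Sum>s\<in>S. c s * P V (f s) p)
    \<and> (\<lambda>p. \<Sum>s\<in>S. c s * f s p) \<in> L V"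
  using assms(5,6)
proof (induction S rule: finite_induct)
  case empty
  then show ?case
    using ms_zero[OF L V(1)] sheaf_homs_zero_section[OF P L] by simp
next
  case (insert s S)
  have 1: "(\<lambda>p. c s * f s p) \<in> L V"
    using ms_scale[OF L V(1)] insert by auto
  show ?case
    using insert sheaf_homsD(2)[OF P V 1, of "\<lambda>p. \<Sum>s\<in>S. c s * f s p"]
      ms_add[OF L V(1) 1, of "\<lambda>p. \<Sum>s\<in>S. c s * f s p"]
      sheaf_homsD(3)[OF P V, of "f s" "c s"]
    by simp
qed

section \<open>Commutators and closure properties of differential operators\<close>

lemma commutator_sheaf_homs:
  assumes P: "P \<in> sheaf_homs T L M U" and L: "module_sheaf T A L" and M: "module_sheaf T A M"
    and V: "openin T V" "V \<subseteq> U" and a: "a \<in> A V"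
  shows "commutator T L V P a \<in> sheaf_homs T L M V"
proof (rule sheaf_homsI)
  fix W f assume W: "openin T W" "W \<subseteq> V" and f: "f \<in> L W"
  have af: "(\<lambda>p. a p * g p) \<in> L W" if "g \<in> L W" for g
    using ms_mult[OF L V(1) W a that] .
  have W': "W \<subseteq> U" using W V by auto
  note D = sheaf_homsD(1-4)[OF P W(1) W']
  show "commutator T L V P a W f \<in> M W"
    using W f af[OF f] D(1) ms_mult[OF M V(1) W a] ms_diff[OF M W(1)]
    by (simp add: commutator_def)
  show "commutator T L V P a W (\<lambda>p. f p + g p) =
      (\<lambda>p. commutator T L V P a W f p + commutator T L V P a W g p)" if g: "g \<in> L W" for g
    using W f g D(2)[OF f g] D(2)[OF af[OF f] af[OF g]] ms_add[OF L W(1) f g]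
    by (simp add: commutator_def ring_distribs fun_eq_iff)
  show "commutator T L V P a W (\<lambda>p. c * f p) = (\<lambda>p. c * commutator T L V P a W f p)" for c
    using W f af[OF f] D(3)[of f c] D(3)[of "\<lambda>p. a p * f p" c] ms_scale[OF L W(1), of f c]
    by (simp add: commutator_def algebra_simps)
  show "commutator T L V P a X (restr X f) = restr X (commutator T L V P a W f)"
    if X: "openin T X" "X \<subseteq> W" for X
  proof -
    have "restr X f \<in> L X" using ms_restr[OF L W(1) X f] .
    then show ?thesis
      using X W f subset_trans[OF X(2) W(2)] D(4)[OF X f] D(4)[OF X af[OF f]]
      by (simp add: commutator_def restr_mult restr_diff)
  qed
next
  fix W f assume "\<not> (openin T W \<and> W \<subseteq> V \<and> f \<in> L W)"
  then show "commutator T L V P a W f = (\<lambda>p. 0)"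
    by (auto simp: commutator_def)
qed

lemma zero_sheaf_homs: "module_sheaf T A M \<Longrightarrow> (\<lambda>W f p. 0) \<in> sheaf_homs T L M U"
  by (auto intro!: sheaf_homsI simp: restr_zero ms_zero)

lemma zero_diff_homs: "module_sheaf T A M \<Longrightarrow> (\<lambda>W f p. 0) \<in> diff_homs T A L M k U"
proof (induction k arbitrary: U)
  case (Suc k)
  have "commutator T L V (\<lambda>W f p. 0) a = (\<lambda>W f p. 0)" for V a
    by (auto simp: commutator_def fun_eq_iff)
  then show ?case
    using Suc zero_sheaf_homs[OF Suc.prems] by auto
qed simp

lemma diff_homs_sheaf_homs:
  "module_sheaf T A M \<Longrightarrow> P \<in> diff_homs T A L M k U \<Longrightarrow> P \<in> sheaf_homs T L M U"
  by (cases k) (auto simp: zero_sheaf_homs)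

lemma diff_homs_mono:
  assumes M: "module_sheaf T A M"
  shows "k \<le> k' \<Longrightarrow> P \<in> diff_homs T A L M k U \<Longrightarrow> P \<in> diff_homs T A L M k' U"
proof (induction k arbitrary: P U k')
  case 0
  then show ?case using zero_diff_homs[OF M] by simp
next
  case (Suc k)
  then obtain k'' where k'': "k' = Suc k''" "k \<le> k''"
    by (cases k') auto
  show ?case using Suc.prems(2) Suc.IH[OF k''(2)] by (simp add: k''(1))
qed

lemma sheaf_homs_add:
  assumes M: "module_sheaf T A M" and P: "P \<in> sheaf_homs T L M U" and Q: "Q \<in> sheaf_homs T L M U"
  shows "(\<lambda>W f p. P W f p + Q W f p) \<in> sheaf_homs T L M U"
proof (rule sheaf_homsI)
  fix V f assume V: "openin T V" "V \<subseteq> U" "f \<in> L V"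
  note DP = sheaf_homsD(1-4)[OF P V(1,2)] and DQ = sheaf_homsD(1-4)[OF Q V(1,2)]
  show "(\<lambda>p. P V f p + Q V f p) \<in> M V"
    using ms_add[OF M V(1) DP(1)[OF V(3)] DQ(1)[OF V(3)]] .
  show "(\<lambda>p. P V (\<lambda>p. f p + g p) p + Q V (\<lambda>p. f p + g p) p) =
      (\<lambda>p. P V f p + Q V f p + (P V g p + Q V g p))" if "g \<in> L V" for g
    using DP(2)[OF V(3) that] DQ(2)[OF V(3) that] by (simp add: fun_eq_iff)
  show "(\<lambda>p. P V (\<lambda>p. c * f p) p + Q V (\<lambda>p. c * f p) p) = (\<lambda>p. c * (P V f p + Q V f p))" for c
    using DP(3)[OF V(3)] DQ(3)[OF V(3)] by (simp add: algebra_simps)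
  show "(\<lambda>p. P W (restr W f) p + Q W (restr W f) p) = restr W (\<lambda>p. P V f p + Q V f p)"
    if "openin T W" "W \<subseteq> V" for W
    using DP(4)[OF that V(3)] DQ(4)[OF that V(3)] by (simp add: restr_add)
next
  fix V f assume "\<not> (openin T V \<and> V \<subseteq> U \<and> f \<in> L V)"
  then show "(\<lambda>p. P V f p + Q V f p) = (\<lambda>p. 0)"
    using sheaf_homsD(5)[OF P, of V f] sheaf_homsD(5)[OF Q, of V f] by simp
qed

lemma sheaf_homs_scale:
  assumes M: "module_sheaf T A M" and P: "P \<in> sheaf_homs T L M U"
  shows "(\<lambda>W f p. c * P W f p) \<in> sheaf_homs T L M U"
  using sheaf_homsD[OF P] ms_scale[OF M]
  by (intro sheaf_homsI) (simp_all add: restr_mult algebra_simps)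

lemma diff_homs_add:
  assumes M: "module_sheaf T A M"
  shows "P \<in> diff_homs T A L M k U \<Longrightarrow> Q \<in> diff_homs T A L M k U \<Longrightarrow>
    (\<lambda>W f p. P W f p + Q W f p) \<in> diff_homs T A L M k U"
proof (induction k arbitrary: P Q U)
  case (Suc k)
  have "commutator T L V (\<lambda>W f p. P W f p + Q W f p) a =
      (\<lambda>W f p. commutator T L V P a W f p + commutator T L V Q a W f p)" for V a
    by (auto simp: commutator_def fun_eq_iff algebra_simps)
  then show ?case using Suc sheaf_homs_add[OF M] by auto
qed auto

lemma diff_homs_scale:
  assumes M: "module_sheaf T A M"
  shows "P \<in> diff_homs T A L M k U \<Longrightarrow> (\<lambda>W f p. c * P W f p) \<in> diff_homs T A L M k U"
proof (induction k arbitrary: P U)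
  case (Suc k)
  have "commutator T L V (\<lambda>W f p. c * P W f p) a =
      (\<lambda>W f p. c * commutator T L V P a W f p)" for V a
    by (auto simp: commutator_def fun_eq_iff algebra_simps)
  then show ?case using Suc sheaf_homs_scale[OF M] by auto
qed auto

lemma sheaf_homs_restr_op:
  assumes L: "module_sheaf T A L" and P: "P \<in> sheaf_homs T L M U" and V: "V \<subseteq> U"
  shows "restr_op V P \<in> sheaf_homs T L M V"
  using sheaf_homsD[OF P] V
  by (intro sheaf_homsI) (auto simp: restr_op_def)

lemma commutator_restr_op: "V' \<subseteq> V \<Longrightarrow> commutator T L V' (restr_op V P) a = commutator T L V' P a"
  by (auto simp: commutator_def restr_op_def fun_eq_iff)

lemma diff_homs_restr_op:
  assumes L: "module_sheaf T A L" and M: "module_sheaf T A M"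
    and P: "P \<in> diff_homs T A L M k U" and V: "V \<subseteq> U"
  shows "restr_op V P \<in> diff_homs T A L M k V"
proof (cases k)
  case 0
  then show ?thesis using P by (auto simp: restr_op_def fun_eq_iff)
next
  case (Suc m)
  then show ?thesis
    using P V sheaf_homs_restr_op[OF L _ V] by (fastforce simp: commutator_restr_op)
qed

lemma restr_op_id:
  assumes "P \<in> sheaf_homs T L M U"
  shows "restr_op U P = P"
proof -
  have "\<not> W \<subseteq> U \<Longrightarrow> P W f = (\<lambda>p. 0)" for W f
    using sheaf_homsD(5)[OF assms, of W f] by auto
  then show ?thesis
    by (auto simp: restr_op_def fun_eq_iff)
qed

section \<open>Composition of differential operators\<close>

lemma sheaf_homs_comp:
  assumes L: "module_sheaf T A L" and M: "module_sheaf T A M"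
    and P: "P \<in> sheaf_homs T M N U" and Q: "Q \<in> sheaf_homs T L M U"
  shows "(\<lambda>W f. P W (Q W f)) \<in> sheaf_homs T L N U"
  using sheaf_homsD[OF P] sheaf_homsD[OF Q] sheaf_homs_zero_section[OF P M]
  by (intro sheaf_homsI) simp_all

text \<open>The commutator is a derivation, \<open>[P Q, a] = P [Q, a] + [P, a] Q\<close>, so the
  sum of the indices drops by one in each summand. Index 0 means the zero operator, which settles
  the case where either index is 0.\<close>

lemma diff_homs_comp:
  assumes L: "module_sheaf T A L" and M: "module_sheaf T A M" and N: "module_sheaf T A N"
  shows "P \<in> diff_homs T A M N k U \<Longrightarrow> Q \<in> diff_homs T A L M m U \<Longrightarrow>
    (\<lambda>W f. P W (Q W f)) \<in> diff_homs T A L N (k + m) U"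
proof (induction "k + m" arbitrary: k m P Q U)
  case 0
  then show ?case by (auto simp: fun_eq_iff)
next
  case (Suc r)
  note P = Suc.prems(1) and Q = Suc.prems(2)
  have Ph: "P \<in> sheaf_homs T M N U" and Qh: "Q \<in> sheaf_homs T L M U"
    using diff_homs_sheaf_homs M N P Q by blast+
  have zero: "P W (\<lambda>p. 0) = (\<lambda>p. 0)" for W
    using sheaf_homs_zero_section[OF Ph M] .
  show ?case
  proof (cases "k = 0 \<or> m = 0")
    case True
    then have "(\<lambda>W f. P W (Q W f)) = (\<lambda>W f p. 0)"
      using P Q zero by auto
    then show ?thesis using zero_diff_homs[OF N] by simp
  next
    case False
    then obtain k' m' where km: "k = Suc k'" "m = Suc m'" "r = k' + m" "r = k + m'"
      using Suc.hyps(2) by (cases k; cases m) auto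
    have "commutator T L V (\<lambda>W f. P W (Q W f)) a \<in> diff_homs T A L N r V"
      if V: "openin T V" "V \<subseteq> U" and a: "a \<in> A V" for V a
    proof -
      have Pa: "commutator T M V P a \<in> diff_homs T A M N k' V"
        using P V a by (simp add: km)
      have Qa: "commutator T L V Q a \<in> diff_homs T A L M m' V"
        using Q V a by (simp add: km)
      have PV: "restr_op V P \<in> diff_homs T A M N k V"
        and QV: "restr_op V Q \<in> diff_homs T A L M m V"
        using diff_homs_restr_op[OF M N P V(2)] diff_homs_restr_op[OF L M Q V(2)] .
      have 1: "(\<lambda>W f. restr_op V P W (commutator T L V Q a W f)) \<in> diff_homs T A L N r V"
        using Suc.hyps(1)[OF km(4) PV Qa] km by simp
      have 2: "(\<lambda>W f. commutator T M V P a W (restr_op V Q W f)) \<in> diff_homs T A L N r V"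
        using Suc.hyps(1)[OF km(3) Pa QV] km by simp
      have "commutator T L V (\<lambda>W f. P W (Q W f)) a W f p =
        restr_op V P W (commutator T L V Q a W f) p + commutator T M V P a W (restr_op V Q W f) p"
        for W f p
      proof (cases "openin T W \<and> W \<subseteq> V \<and> f \<in> L W")
        case True
        then have W: "openin T W" "W \<subseteq> V" "W \<subseteq> U" "f \<in> L W" using V by auto
        have 1: "Q W f \<in> M W" "Q W (\<lambda>q. a q * f q) \<in> M W"
          using sheaf_homsD(1)[OF Qh W(1,3)] W ms_mult[OF L V(1) W(1,2) a] by auto
        have 2: "(\<lambda>q. a q * Q W f q) \<in> M W"
          using ms_mult[OF M V(1) W(1,2) a 1(1)] .
        show ?thesis
          using True 1 2 sheaf_homs_diff[OF Ph M W(1,3) 1(2) 2]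
          by (simp add: commutator_def restr_op_def)
      next
        case False
        then have "restr_op V Q W f = (\<lambda>p. 0)"
          using sheaf_homsD(5)[OF sheaf_homs_restr_op[OF L Qh V(2)], of W f] by auto
        moreover have "restr_op V P W (\<lambda>p. 0) = (\<lambda>p. 0)"
          using zero by (auto simp: restr_op_def)
        moreover have "commutator T M V P a W (\<lambda>p. 0) = (\<lambda>p. 0)"
          using zero by (auto simp: commutator_def)
        moreover have "commutator T L V Q a W f = (\<lambda>p. 0)"
            "commutator T L V (\<lambda>W f. P W (Q W f)) a W f = (\<lambda>p. 0)"
          using False by (auto simp: commutator_def)
        ultimately show ?thesis by simp
      qed
      then show ?thesis
        using diff_homs_add[OF N 1 2] by presburger
    qed
    then show ?thesis
      using sheaf_homs_comp[OF L M Ph Qh] by (simp flip: Suc.hyps(2))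
  qed
qed

text \<open>Two descriptions of a sheaf need to agree over open sets only, since operators return 0
  everywhere else.\<close>

lemma diff_op_ring_cong:
  assumes A: "\<And>V. openin T V \<Longrightarrow> A V = A' V" and L: "\<And>V. openin T V \<Longrightarrow> L V = L' V"
  shows "diff_op_ring T A L = diff_op_ring T A' L'"
proof -
  have e: "sheaf_endos T L U = sheaf_endos T L' U" for U
    unfolding sheaf_endos_def
    by (intro Collect_cong conj_cong all_cong1) (simp_all add: L cong: conj_cong imp_cong)
  have c: "commutator T L = commutator T L'"
    by (auto simp: commutator_def L fun_eq_iff)
  have d: "diff_ops T A L k U = diff_ops T A' L' k U" for k U
    by (induction k arbitrary: U) (auto simp: e c A)
  show ?thesis
    unfolding diff_op_ring_def diff_op_sheaf_def e d
    by (auto simp: fun_eq_iff L)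
qed

section \<open>Coordinates, weights and polynomials\<close>

text \<open>Indexing by \<open>'n option\<close> puts the last coordinate, \<open>None\<close>, on
  the same footing as the others; only its weight and the Fourier transform single it out.\<close>

definition crd :: "'n::finite point \<Rightarrow> 'n option \<Rightarrow> complex" where
  "crd Q j = (case j of None \<Rightarrow> snd Q | Some i \<Rightarrow> fst Q $ i)"

definition pt :: "('n::finite option \<Rightarrow> complex) \<Rightarrow> 'n point" where
  "pt x = (\<chi> i. x (Some i), x None)"

lemma crd_pt [simp]: "crd (pt x) = x"
  by (auto simp: crd_def pt_def fun_eq_iff split: option.splits)

lemma pt_crd [simp]: "pt (crd Q) = Q"
  by (simp add: crd_def pt_def prod_eq_iff vec_eq_iff)

lemma prod_option: "(\<Prod>j\<in>(UNIV::'n::finite option set). f j) = f None * (\<Prod>i\<in>UNIV. f (Some i))"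
  by (simp add: UNIV_option_conv prod.reindex)

lemma sum_option: "(\<Sum>j\<in>(UNIV::'n::finite option set). f j) = f None + (\<Sum>i\<in>UNIV. f (Some i))"
  by (simp add: UNIV_option_conv sum.reindex)

definition wt :: "int \<Rightarrow> 'n option \<Rightarrow> int" where
  "wt w j = (case j of None \<Rightarrow> w | Some _ \<Rightarrow> 1)"

definition wdeg :: "int \<Rightarrow> ('n::finite option \<Rightarrow> int) \<Rightarrow> int" where
  "wdeg w \<mu> = (\<Sum>j\<in>UNIV. wt w j * \<mu> j)"

text \<open>Since \<open>0 powi k = 0\<close> for \<open>k < 0\<close>, this is the Laurent monomial only where it is defined.\<close>

definition lmon :: "('n::finite option \<Rightarrow> int) \<Rightarrow> 'n point \<Rightarrow> complex" where
  "lmon \<mu> Q = (\<Prod>j\<in>UNIV. crd Q j powi \<mu> j)"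

lemma wdeg_add: "wdeg w (\<lambda>j. \<mu> j + \<nu> j) = wdeg w \<mu> + wdeg w \<nu>"
  and wdeg_scale: "wdeg w (\<lambda>j. c * \<mu> j) = c * wdeg w \<mu>"
  and wdeg_zero: "wdeg w (\<lambda>j. 0) = 0"
  by (simp_all add: wdeg_def sum.distrib algebra_simps sum_distrib_left)

lemma wdeg_upd: "wdeg w (\<mu>(j := s)) = wdeg w \<mu> + wt w j * (s - \<mu> j)"
proof -
  have "wdeg w (\<mu>(j := s)) - wdeg w \<mu> = (\<Sum>k\<in>UNIV. if k = j then wt w j * (s - \<mu> j) else 0)"
    unfolding wdeg_def sum_subtractf[symmetric] by (intro sum.cong) (auto simp: algebra_simps)
  then show ?thesis by simp
qed

lemma mon_zero [simp]: "lmon (\<lambda>j. 0) Q = 1"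
  by (simp add: lmon_def)

lemma mon_add:
  assumes "\<And>j. crd Q j \<noteq> 0 \<or> (0 \<le> \<mu> j \<and> 0 \<le> \<nu> j)"
  shows "lmon (\<lambda>j. \<mu> j + \<nu> j) Q = lmon \<mu> Q * lmon \<nu> Q"
  unfolding lmon_def prod.distrib[symmetric]
proof (intro prod.cong refl)
  fix j
  show "crd Q j powi (\<mu> j + \<nu> j) = crd Q j powi \<mu> j * crd Q j powi \<nu> j"
  proof (cases "crd Q j = 0")
    case True
    then have "0 \<le> \<mu> j" "0 \<le> \<nu> j" using assms[of j] by auto
    then show ?thesis by (simp add: power_int_def nat_add_distrib power_add)
  qed (simp add: power_int_add)
qed

lemma mon_eq_0_iff: "lmon \<mu> Q = 0 \<longleftrightarrow> (\<exists>j. crd Q j = 0 \<and> \<mu> j \<noteq> 0)"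
  by (simp add: lmon_def)

lemma crd_act: "crd (act w u Q) j = u powi wt w j * crd Q j"
  by (auto simp: crd_def act_def wt_def split: option.splits)

lemma power_int_sum_exponent:
  "(u::complex) \<noteq> 0 \<Longrightarrow> u powi (\<Sum>j\<in>J. k j) = (\<Prod>j\<in>J. u powi k j)"
  by (induction J rule: infinite_finite_induct) (simp_all add: power_int_add)

lemma mon_act: "u \<noteq> 0 \<Longrightarrow> lmon \<mu> (act w u Q) = u powi wdeg w \<mu> * lmon \<mu> Q"
  unfolding lmon_def wdeg_def
  by (simp only: crd_act power_int_mult_distrib prod.distrib power_int_sum_exponent
    power_int_mult not_False_eq_True)

section \<open>Polynomials graded by weighted degree\<close>

definition exps :: "('n::finite \<Rightarrow> nat) \<times> nat \<Rightarrow> 'n option \<Rightarrow> int" where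
  "exps m j = (case j of None \<Rightarrow> int (snd m) | Some i \<Rightarrow> int (fst m i))"

lemma monomial_fun_eq: "monomial_fun m Q = lmon (exps m) Q"
  by (simp add: monomial_fun_def lmon_def prod_option exps_def crd_def)

lemma exps_nonneg [simp]: "0 \<le> exps m j"
  by (auto simp: exps_def split: option.splits)

lemma ex_exps: "(\<And>j. 0 \<le> \<mu> j) \<Longrightarrow> \<exists>m. exps m = \<mu>"
  by (rule exI[of _ "(\<lambda>i. nat (\<mu> (Some i)), nat (\<mu> None))"])
    (auto simp: exps_def fun_eq_iff split: option.splits)

definition hpoly :: "int \<Rightarrow> int \<Rightarrow> ('n::finite point \<Rightarrow> complex) set" where
  "hpoly w d = poly_span {m. wdeg w (exps m) = d}"

lemma wdeg_exps: "wdeg w (exps m) = (\<Sum>i\<in>UNIV. int (fst m i)) + w * int (snd m)"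
  by (simp add: wdeg_def sum_option exps_def wt_def)

lemma S_deg_eq: "S_deg d = hpoly 2 d"
  by (simp add: S_deg_def hpoly_def wdeg_exps)

lemma poly_span_0: "(\<lambda>Q. 0) \<in> poly_span M"
  unfolding poly_span_def by (force intro: exI[of _ "{}"])

lemma poly_span_add:
  assumes "f \<in> poly_span M" "g \<in> poly_span M"
  shows "(\<lambda>Q. f Q + g Q) \<in> poly_span M"
proof -
  obtain S c S' c' where S: "finite S" "S \<subseteq> M" "f = (\<lambda>Q. \<Sum>m\<in>S. c m * monomial_fun m Q)"
    and S': "finite S'" "S' \<subseteq> M" "g = (\<lambda>Q. \<Sum>m\<in>S'. c' m * monomial_fun m Q)"
    using assms unfolding poly_span_def by blast
  define d where "d m = (if m \<in> S then c m else 0) + (if m \<in> S' then c' m else 0)" for m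
  have "f Q + g Q = (\<Sum>m\<in>S \<union> S'. d m * monomial_fun m Q)" for Q
  proof -
    have "f Q = (\<Sum>m\<in>S \<union> S'. (if m \<in> S then c m else 0) * monomial_fun m Q)"
      unfolding S(3) by (rule sum.mono_neutral_cong_left) (use S S' in auto)
    moreover have "g Q = (\<Sum>m\<in>S \<union> S'. (if m \<in> S' then c' m else 0) * monomial_fun m Q)"
      unfolding S'(3) by (rule sum.mono_neutral_cong_left) (use S S' in auto)
    ultimately show ?thesis by (simp add: d_def algebra_simps sum.distrib)
  qed
  then show ?thesis
    unfolding poly_span_def using S S' by (intro CollectI exI[of _ "S \<union> S'"] exI[of _ d]) auto
qed

lemma poly_span_scale:
  assumes "f \<in> poly_span M"
  shows "(\<lambda>Q. c * f Q) \<in> poly_span M"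
proof -
  obtain S b where S: "finite S" "S \<subseteq> M" "f = (\<lambda>Q. \<Sum>m\<in>S. b m * monomial_fun m Q)"
    using assms unfolding poly_span_def by blast
  have "(\<lambda>Q. c * f Q) = (\<lambda>Q. \<Sum>m\<in>S. (c * b m) * monomial_fun m Q)"
    by (simp only: S(3) sum_distrib_left mult.assoc)
  with S(1,2) show ?thesis unfolding poly_span_def mem_Collect_eq by (intro exI conjI)
qed

lemma poly_span_mon: "m \<in> M \<Longrightarrow> lmon (exps m) \<in> poly_span M"
  unfolding poly_span_def mem_Collect_eq
  by (rule exI[of _ "{m}"], rule exI[of _ "\<lambda>_. 1"]) (simp add: monomial_fun_eq fun_eq_iff)

lemma poly_span_induct [consumes 1, case_names zero add]:
  assumes "f \<in> poly_span M" and "P (\<lambda>Q. 0)"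
    and step: "\<And>c m f. m \<in> M \<Longrightarrow> f \<in> poly_span M \<Longrightarrow> P f \<Longrightarrow> P (\<lambda>Q. c * lmon (exps m) Q + f Q)"
  shows "P f"
proof -
  obtain S c where S: "finite S" "S \<subseteq> M" "f = (\<lambda>Q. \<Sum>m\<in>S. c m * monomial_fun m Q)"
    using assms(1) unfolding poly_span_def by blast
  from S(1,2) have "P (\<lambda>Q. \<Sum>m\<in>S. c m * lmon (exps m) Q)
    \<and> (\<lambda>Q. \<Sum>m\<in>S. c m * lmon (exps m) Q) \<in> poly_span M"
  proof (induction S rule: finite_induct)
    case empty
    then show ?case using assms(2) poly_span_0 by simp
  next
    case (insert m S)
    then show ?case
      using step[of m "\<lambda>Q. \<Sum>m\<in>S. c m * lmon (exps m) Q" "c m"]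
        poly_span_add[OF poly_span_scale[OF poly_span_mon[of m M], of "c m"]] by simp
  qed
  then show ?thesis by (simp add: S(3) monomial_fun_eq)
qed

lemma poly_span_mono: "M \<subseteq> M' \<Longrightarrow> poly_span M \<subseteq> poly_span M'"
  unfolding poly_span_def by blast

lemma poly_span_mult:
  assumes "f \<in> poly_span M" "g \<in> poly_span M'"
    and "\<And>m m' k. m \<in> M \<Longrightarrow> m' \<in> M' \<Longrightarrow> exps k = (\<lambda>j. exps m j + exps m' j) \<Longrightarrow> k \<in> M''"
  shows "(\<lambda>Q. f Q * g Q) \<in> poly_span M''"
  using assms(1)
proof (induction rule: poly_span_induct)
  case zero
  then show ?case using poly_span_0 by simp
next
  case (add c m f)
  have "(\<lambda>Q. lmon (exps m) Q * g Q) \<in> poly_span M''"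
    using assms(2)
  proof (induction rule: poly_span_induct)
    case zero
    then show ?case using poly_span_0 by simp
  next
    case (add b m' g)
    obtain k where k: "exps k = (\<lambda>j. exps m j + exps m' j)"
      using ex_exps[of "\<lambda>j. exps m j + exps m' j"] by auto
    have "lmon (exps k) = (\<lambda>Q. lmon (exps m) Q * lmon (exps m') Q)"
      unfolding k by (rule ext, rule mon_add) auto
    then show ?case
      using poly_span_add[OF poly_span_scale[OF poly_span_mon[OF assms(3)[OF \<open>m \<in> M\<close> add(1) k]], of b] add(3)]
      by (simp add: algebra_simps)
  qed
  from poly_span_add[OF poly_span_scale[OF this, of c] add(3)] show ?case
    by (simp add: algebra_simps)
qed

lemmas hpoly_0 = poly_span_0[of "{m. wdeg w (exps m) = d}" for w d, folded hpoly_def]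
lemmas hpoly_add = poly_span_add[of _ "{m. wdeg w (exps m) = d}" for w d, folded hpoly_def]
lemmas hpoly_scale = poly_span_scale[of _ "{m. wdeg w (exps m) = d}" for w d, folded hpoly_def]

lemma hpoly_diff: "f \<in> hpoly w d \<Longrightarrow> g \<in> hpoly w d \<Longrightarrow> (\<lambda>Q. f Q - g Q) \<in> hpoly w d"
  using hpoly_add[of f w d "\<lambda>Q. (-1) * g Q"] hpoly_scale[of g w d "-1"] by simp

lemma hpoly_polys: "f \<in> hpoly w d \<Longrightarrow> f \<in> polys"
  using poly_span_mono[of _ UNIV] unfolding hpoly_def by auto

lemma hpoly_mult: "f \<in> hpoly w d \<Longrightarrow> g \<in> hpoly w e \<Longrightarrow> (\<lambda>Q. f Q * g Q) \<in> hpoly w (d + e)"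
  unfolding hpoly_def by (erule poly_span_mult) (auto simp: wdeg_add)

lemma polys_mult: "f \<in> polys \<Longrightarrow> g \<in> polys \<Longrightarrow> (\<lambda>Q. f Q * g Q) \<in> polys"
  by (erule poly_span_mult) auto

lemma polys_diff: "f \<in> polys \<Longrightarrow> g \<in> polys \<Longrightarrow> (\<lambda>Q. f Q - g Q) \<in> polys"
  using poly_span_add[of f UNIV "\<lambda>Q. (-1) * g Q"] poly_span_scale[of g UNIV "-1"] by simp

lemma hpoly_mon:
  assumes "\<And>j. 0 \<le> \<mu> j"
  shows "lmon \<mu> \<in> hpoly w (wdeg w \<mu>)"
proof -
  obtain m where "exps m = \<mu>" using ex_exps[of \<mu>] assms by blast
  then show ?thesis unfolding hpoly_def using poly_span_mon[of m] by auto
qed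

lemma hpoly_const: "(\<lambda>Q. c) \<in> hpoly w 0"
  using hpoly_scale[OF hpoly_mon[of "\<lambda>j. 0" w], of c] by (simp add: wdeg_zero)

lemma mon_single: "lmon ((\<lambda>j. 0)(k := 1)) Q = crd Q k"
proof -
  have "lmon ((\<lambda>j. 0)(k := 1)) Q = (\<Prod>j\<in>UNIV. if j = k then crd Q k else 1)"
    unfolding lmon_def by (intro prod.cong) auto
  then show ?thesis by simp
qed

lemma hpoly_crd: "(\<lambda>Q. crd Q j) \<in> hpoly w (wt w j)"
proof -
  have "wdeg w ((\<lambda>j. 0)(j := 1)) = wt w j"
    by (simp add: wdeg_upd wdeg_zero)
  then show ?thesis
    using hpoly_mon[of "(\<lambda>j. 0)(j := 1)" w] by (simp add: mon_single[abs_def])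
qed

text \<open>Limits and derivatives are taken along complex lines only, where polynomials become
  polynomials in one variable; this avoids analysis in several variables.\<close>

definition line :: "'n::finite point \<Rightarrow> complex \<Rightarrow> 'n point \<Rightarrow> 'n point" where
  "line Q t R = pt (\<lambda>j. crd Q j + t * crd R j)"

lemma line_0 [simp]: "line Q 0 R = Q"
  by (simp add: line_def)

lemma crd_line [simp]: "crd (line Q t R) j = crd Q j + t * crd R j"
  by (simp add: line_def)

lemma poly_line:
  assumes "f \<in> polys"
  shows "\<exists>p. \<forall>t. f (line Q t R) = poly p t"
  using assms
proof (induction rule: poly_span_induct)
  case zero
  then show ?case by (auto intro: exI[of _ 0])
next
  case (add c m f)
  then obtain p where p: "\<forall>t. f (line Q t R) = poly p t" by blast
  have "lmon (exps m) (line Q t R) = poly (\<Prod>j\<in>UNIV. [:crd Q j, crd R j:] ^ nat (exps m j)) t" for t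
    by (simp add: lmon_def poly_prod power_int_def)
  then show ?case
    using p by (intro exI[of _ "smult c (\<Prod>j\<in>UNIV. [:crd Q j, crd R j:] ^ nat (exps m j)) + p"]) simp
qed

section \<open>The Zariski topology and the irreducibility of affine space\<close>

lemma zariski_basis:
  assumes "openin zariski W" "Q \<in> W"
  shows "\<exists>h\<in>polys. h Q \<noteq> 0 \<and> {R. h R \<noteq> 0} \<subseteq> W"
proof -
  have "generate_topology_on {{Q. f Q \<noteq> 0} | f. f \<in> polys} W"
    using assms(1) by (simp add: zariski_def openin_topology_generated_by_iff)
  then have "\<forall>Q\<in>W. \<exists>h\<in>polys. h Q \<noteq> 0 \<and> {R. h R \<noteq> 0} \<subseteq> W"
  proof (induction rule: generate_topology_on.induct)
    case (Int a b)
    show ?case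
    proof
      fix Q assume "Q \<in> a \<inter> b"
      then obtain h k where "h \<in> polys" "h Q \<noteq> 0" "{R. h R \<noteq> 0} \<subseteq> a"
        and "k \<in> polys" "k Q \<noteq> 0" "{R. k R \<noteq> 0} \<subseteq> b"
        using Int by blast
      then show "\<exists>h\<in>polys. h Q \<noteq> 0 \<and> {R. h R \<noteq> 0} \<subseteq> a \<inter> b"
        using polys_mult by (intro bexI[of _ "\<lambda>Q. h Q * k Q"]) auto
    qed
  next
    case (UN K)
    then show ?case by (meson Union_iff Union_upper subset_trans)
  qed blast+
  then show ?thesis using assms(2) by blast
qed

lemma openin_zariski_nonzero: "h \<in> polys \<Longrightarrow> openin zariski {Q. h Q \<noteq> 0}"
  unfolding zariski_def by (intro topology_generated_by_Basis) blast

text \<open>Irreducibility reduced to one variable: on the line joining \<open>Q\<close> and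
  \<open>R\<close> neither polynomial vanishes identically, hence neither does their
  product.\<close>

lemma polys_common_nonzero:
  assumes "f \<in> polys" "g \<in> polys" "f Q \<noteq> 0" "g R \<noteq> 0"
  shows "\<exists>S. f S \<noteq> 0 \<and> g S \<noteq> 0"
proof -
  define D where "D = pt (\<lambda>j. crd R j - crd Q j)"
  have R: "line Q 1 D = R"
    by (simp add: line_def D_def)
  obtain p q where p: "\<forall>t. f (line Q t D) = poly p t" and q: "\<forall>t. g (line Q t D) = poly q t"
    using poly_line assms by meson
  have "poly p 0 \<noteq> 0" "poly q 1 \<noteq> 0"
    using p[rule_format, of 0] q[rule_format, of 1] assms R by auto
  then have "p * q \<noteq> 0" by auto
  then have "\<exists>t. poly (p * q) t \<noteq> 0"
    using poly_all_0_iff_0 by blast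
  then show ?thesis using p q by (metis mult_eq_0_iff poly_mult)
qed

lemma zariski_Int_nonempty:
  assumes "openin zariski U" "openin zariski V" "U \<noteq> {}" "V \<noteq> {}"
  shows "U \<inter> V \<noteq> {}"
proof -
  obtain Q R where "Q \<in> U" "R \<in> V" using assms by blast
  then obtain h k where "h \<in> polys" "k \<in> polys" "h Q \<noteq> 0" "k R \<noteq> 0"
    "{R. h R \<noteq> 0} \<subseteq> U" "{R. k R \<noteq> 0} \<subseteq> V"
    using zariski_basis[OF assms(1)] zariski_basis[OF assms(2)] by metis
  then show ?thesis using polys_common_nonzero[of h k Q R] by blast
qed

lemma polys_zero_on_open:
  assumes "f \<in> polys" "openin zariski U" "U \<noteq> {}" "\<And>Q. Q \<in> U \<Longrightarrow> f Q = 0"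
  shows "f Q = 0"
  using zariski_Int_nonempty[OF assms(2) openin_zariski_nonzero[OF assms(1)] assms(3)] assms(4)
  by blast

text \<open>The bridge between the two topologies: a Zariski neighbourhood of \<open>Q\<close>
  contains all points close to \<open>Q\<close> on any line through \<open>Q\<close>, so identities
  on Zariski open sets pass to limits and derivatives.\<close>

lemma eventually_line:
  assumes "openin zariski U" "Q \<in> U"
  shows "\<forall>\<^sub>F t in nhds 0. line Q t R \<in> U"
proof -
  obtain h where h: "h \<in> polys" "h Q \<noteq> 0" "{R. h R \<noteq> 0} \<subseteq> U"
    using zariski_basis[OF assms] by blast
  obtain p where p: "\<forall>t. h (line Q t R) = poly p t" using poly_line[OF h(1)] by blast
  have "poly p 0 \<noteq> 0" using p[rule_format, of 0] h by simp
  moreover have "isCont (poly p) 0" by simp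
  ultimately have "\<forall>\<^sub>F t in nhds 0. poly p t \<noteq> 0"
    using tendsto_imp_eventually_ne[of "poly p" "poly p 0" "nhds 0" 0]
    by (simp add: isCont_def tendsto_at_iff_tendsto_nhds)
  then show ?thesis
    by eventually_elim (use h p in auto)
qed

text \<open>The defining condition of \<open>Y_sheaf\<close> for an arbitrary weight
  \<open>w\<close>. For \<open>Xt_top\<close>, whose sections are defined as equivariant regular
  functions, agreement over open sets is \<open>Xt_sheaf_eq\<close>.\<close>

definition gsh :: "int \<Rightarrow> 'n::finite point set topology \<Rightarrow> int \<Rightarrow> 'n point sections" where
  "gsh w T m U = {f. (\<forall>Q. Q \<notin> \<Union>U \<longrightarrow> f Q = 0) \<and>
     (\<forall>z\<in>U. \<exists>V d a b. openin T V \<and> z \<in> V \<and> V \<subseteq> U \<and> a \<in> hpoly w (m + d) \<and> b \<in> hpoly w d \<and>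
        (\<forall>Q\<in>\<Union>V. b Q \<noteq> 0 \<and> f Q = a Q / b Q))}"

definition frac_on :: "int \<Rightarrow> int \<Rightarrow> ('n::finite point \<Rightarrow> complex) \<Rightarrow> 'n point set set \<Rightarrow> bool" where
  "frac_on w m f V \<longleftrightarrow> (\<exists>d a b. a \<in> hpoly w (m + d) \<and> b \<in> hpoly w d \<and>
     (\<forall>Q\<in>\<Union>V. b Q \<noteq> 0 \<and> f Q = a Q / b Q))"

lemma frac_onI:
  assumes "a \<in> hpoly w (m + d)" "b \<in> hpoly w d"
    and "\<And>Q. Q \<in> \<Union>V \<Longrightarrow> b Q \<noteq> 0" "\<And>Q. Q \<in> \<Union>V \<Longrightarrow> f Q = a Q / b Q"
  shows "frac_on w m f V"
  unfolding frac_on_def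
  by (rule exI[of _ d], rule exI[of _ a], rule exI[of _ b]) (intro conjI ballI assms)

lemma frac_onE:
  assumes "frac_on w m f V"
  obtains d a b where "a \<in> hpoly w (m + d)" "b \<in> hpoly w d"
    "\<And>Q. Q \<in> \<Union>V \<Longrightarrow> b Q \<noteq> 0" "\<And>Q. Q \<in> \<Union>V \<Longrightarrow> f Q = a Q / b Q"
  using assms unfolding frac_on_def by meson

lemma frac_on_subset: "frac_on w m f V \<Longrightarrow> W \<subseteq> V \<Longrightarrow> frac_on w m f W"
  by (erule frac_onE, erule (1) frac_onI) blast+

lemma frac_on_cong: "(\<And>Q. Q \<in> \<Union>V \<Longrightarrow> f Q = g Q) \<Longrightarrow> frac_on w m f V \<longleftrightarrow> frac_on w m g V"
  unfolding frac_on_def by simp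

lemma gsh_iff: "f \<in> gsh w T m U \<longleftrightarrow> (\<forall>Q. Q \<notin> \<Union>U \<longrightarrow> f Q = 0) \<and>
    (\<forall>z\<in>U. \<exists>V. openin T V \<and> z \<in> V \<and> V \<subseteq> U \<and> frac_on w m f V)"
  unfolding gsh_def frac_on_def mem_Collect_eq by (simp only: ex_simps)

lemma hpoly_act:
  assumes "h \<in> hpoly w d" "u \<noteq> 0"
  shows "h (act w u Q) = u powi d * h Q"
  using assms(1) unfolding hpoly_def
proof (induction rule: poly_span_induct)
  case (add c m f)
  then show ?case using assms(2) by (simp add: mon_act algebra_simps)
qed simp

section \<open>Homogeneous fractions and partial derivatives\<close>

text \<open>An analytic derivative along the coordinate line does not depend on how a section is
  written as a fraction; the quotient rule shows later that the result is a fraction again.\<close>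

definition has_pder :: "'n::finite option \<Rightarrow> ('n point \<Rightarrow> complex) \<Rightarrow> complex \<Rightarrow> 'n point \<Rightarrow> bool" where
  "has_pder j f D Q \<longleftrightarrow>
    ((\<lambda>t. f (line Q t (pt ((\<lambda>_. 0)(j := 1))))) has_field_derivative D) (at 0)"

definition pder :: "'n::finite option \<Rightarrow> ('n point \<Rightarrow> complex) \<Rightarrow> 'n point \<Rightarrow> complex" where
  "pder j f Q = deriv (\<lambda>t. f (line Q t (pt ((\<lambda>_. 0)(j := 1))))) 0"

lemma has_pder_imp_pder: "has_pder j f D Q \<Longrightarrow> pder j f Q = D"
  unfolding has_pder_def pder_def by (rule DERIV_imp_deriv)

lemma has_pder_cong:
  assumes "openin zariski N" "Q \<in> N" "\<And>R. R \<in> N \<Longrightarrow> f R = g R"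
  shows "has_pder j f D Q \<longleftrightarrow> has_pder j g D Q"
  unfolding has_pder_def
proof (rule DERIV_cong_ev[OF refl _ refl])
  show "\<forall>\<^sub>F t in nhds 0. f (line Q t (pt ((\<lambda>_. 0)(j := 1)))) = g (line Q t (pt ((\<lambda>_. 0)(j := 1))))"
    using eventually_line[OF assms(1,2)] by eventually_elim (rule assms(3))
qed

lemma pder_cong:
  assumes "openin zariski N" "Q \<in> N" "\<And>R. R \<in> N \<Longrightarrow> f R = g R"
  shows "pder j f Q = pder j g Q"
  unfolding pder_def
proof (rule deriv_cong_ev[OF _ refl])
  show "\<forall>\<^sub>F t in nhds 0. f (line Q t (pt ((\<lambda>_. 0)(j := 1)))) = g (line Q t (pt ((\<lambda>_. 0)(j := 1))))"
    using eventually_line[OF assms(1,2)] by eventually_elim (rule assms(3))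
qed

lemma has_pder_add: "has_pder j f D Q \<Longrightarrow> has_pder j g E Q \<Longrightarrow> has_pder j (\<lambda>Q. f Q + g Q) (D + E) Q"
  and has_pder_scale: "has_pder j f D Q \<Longrightarrow> has_pder j (\<lambda>Q. c * f Q) (c * D) Q"
  unfolding has_pder_def by (auto intro!: derivative_eq_intros)

lemma has_pder_mult:
  "has_pder j f D Q \<Longrightarrow> has_pder j g E Q \<Longrightarrow> has_pder j (\<lambda>Q. f Q * g Q) (f Q * E + D * g Q) Q"
  unfolding has_pder_def by (auto intro!: derivative_eq_intros)

lemma has_pder_divide:
  "has_pder j f D Q \<Longrightarrow> has_pder j g E Q \<Longrightarrow> g Q \<noteq> 0 \<Longrightarrow>
    has_pder j (\<lambda>Q. f Q / g Q) ((D * g Q - f Q * E) / (g Q * g Q)) Q"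
  unfolding has_pder_def by (auto intro!: derivative_eq_intros)

lemma DERIV_power_int_shift:
  assumes "c \<noteq> 0 \<or> 0 \<le> k"
  shows "((\<lambda>t::complex. (c + t) powi k) has_field_derivative of_int k * c powi (k - 1)) (at 0)"
proof (cases "c = 0")
  case False
  then show ?thesis by (auto intro!: derivative_eq_intros)
next
  case True
  then obtain n where n: "k = int n" using assms nonneg_eq_int by auto
  have "((\<lambda>t::complex. (c + t) ^ n) has_field_derivative of_nat n * c ^ (n - 1)) (at 0)"
    by (auto intro!: derivative_eq_intros)
  \<comment> \<open>For \<open>n = 0\<close> the exponents \<open>n - 1\<close> and
    \<open>k - 1\<close> disagree, but the factor in front of them is 0.\<close>
  moreover have "of_nat n * c ^ (n - 1) = of_int k * c powi (k - 1)"
    by (cases n) (simp_all add: n power_int_def)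
  ultimately show ?thesis by (simp only: n power_int_of_nat)
qed

lemma has_pder_mon:
  assumes "crd Q j \<noteq> 0 \<or> 0 \<le> \<mu> j"
  shows "has_pder j (lmon \<mu>) (of_int (\<mu> j) * lmon (\<mu>(j := \<mu> j - 1)) Q) Q"
proof -
  define K where "K = (\<Prod>k\<in>UNIV - {j}. crd Q k powi \<mu> k)"
  have 1: "lmon \<mu> (line Q t (pt ((\<lambda>_. 0)(j := 1)))) = (crd Q j + t) powi \<mu> j * K" for t
    unfolding lmon_def K_def by (subst prod.remove[of UNIV j]) (auto intro!: prod.cong)
  have 2: "lmon (\<mu>(j := \<mu> j - 1)) Q = crd Q j powi (\<mu> j - 1) * K"
    unfolding lmon_def K_def by (subst prod.remove[of UNIV j]) (auto intro!: prod.cong)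
  show ?thesis
    unfolding has_pder_def 1 2
    using DERIV_cmult_right[OF DERIV_power_int_shift[OF assms], of K] by (simp add: mult.assoc)
qed

lemma hpoly_pder:
  assumes "h \<in> hpoly w d"
  shows "pder j h \<in> hpoly w (d - wt w j) \<and> (\<forall>Q. has_pder j h (pder j h Q) Q)"
  using assms unfolding hpoly_def
proof (induction rule: poly_span_induct)
  case zero
  have "has_pder j (\<lambda>Q. 0) 0 Q" for Q
    by (simp add: has_pder_def)
  then show ?case
    using has_pder_imp_pder[of j "\<lambda>Q. 0" 0] poly_span_0 by (auto simp: pder_def)
next
  case (add c m f)
  let ?D = "\<lambda>Q. of_int (exps m j) * lmon ((exps m)(j := exps m j - 1)) Q"
  have 1: "has_pder j (\<lambda>Q. c * lmon (exps m) Q + f Q) (c * ?D Q + pder j f Q) Q" for Q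
    using add(3) by (intro has_pder_add has_pder_scale has_pder_mon disjI2 exps_nonneg) blast
  then have 2: "pder j (\<lambda>Q. c * lmon (exps m) Q + f Q) = (\<lambda>Q. c * ?D Q + pder j f Q)"
    using has_pder_imp_pder by blast
  have "?D \<in> hpoly w (d - wt w j)"
  \<comment> \<open>A vanishing exponent would become \<open>-1\<close> in the formula for the
    derivative, but its coefficient is then 0.\<close>
  proof (cases "exps m j = 0")
    case True
    then show ?thesis using hpoly_0 by simp
  next
    case False
    then have "0 < exps m j" using exps_nonneg[of m j] by linarith
    then have "lmon ((exps m)(j := exps m j - 1)) \<in> hpoly w (wdeg w ((exps m)(j := exps m j - 1)))"
      by (intro hpoly_mon) simp
    then show ?thesis
      using add(1) by (intro hpoly_scale) (simp add: wdeg_upd)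
  qed
  then have "(\<lambda>Q. c * ?D Q + pder j f Q) \<in> hpoly w (d - wt w j)"
    using add(3) by (intro hpoly_add hpoly_scale[of ?D]) (simp_all add: hpoly_def)
  then show ?case using 1 2 by (simp add: hpoly_def)
qed

section \<open>Quotients of cones\<close>

text \<open>What the two quotients share. One topology consists of all sets of orbits with Zariski
  open union, the other is generated by nonvanishing sets of homogeneous polynomials. The axioms
  bracket both: open sets have open preimage, and nonvanishing sets of homogeneous polynomials are
  open. \<open>chart\<close> places the charts \<open>Q_i \<noteq> 0\<close> in the variety.\<close>

locale cone_quotient =
  fixes w :: int and T :: "'n::finite point set topology"
  assumes topspace_orbits: "topspace T \<subseteq> range (orbit w)"
    and chart: "fst Q \<noteq> 0 \<Longrightarrow> orbit w Q \<in> topspace T"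
    and openin_zariski: "openin T U \<Longrightarrow> openin zariski (\<Union>U)"
    and openin_nonzero: "h \<in> hpoly w d \<Longrightarrow> openin T {z \<in> topspace T. \<forall>Q\<in>z. h Q \<noteq> 0}"
begin

abbreviation Sh :: "int \<Rightarrow> 'n point sections" where
  "Sh \<equiv> gsh w T"

lemma self_in_orbit: "Q \<in> orbit w Q"
  by (force simp: orbit_def act_def intro: exI[of _ 1])

lemma openin_orbits: "openin T U \<Longrightarrow> U \<subseteq> range (orbit w)"
  using topspace_orbits openin_subset by blast

lemma orbit_mem: "openin T U \<Longrightarrow> z \<in> U \<Longrightarrow> Q \<in> z \<Longrightarrow> z = orbit w Q"
  using openin_orbits orbit_eq by fast

lemma mem_Union_iff: "openin T U \<Longrightarrow> Q \<in> \<Union>U \<longleftrightarrow> orbit w Q \<in> U"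
  using orbit_mem self_in_orbit by blast

lemma ex_in_orbit: "openin T U \<Longrightarrow> z \<in> U \<Longrightarrow> \<exists>Q. Q \<in> z"
  using openin_orbits self_in_orbit by fast

lemma Union_nonempty: "openin T U \<Longrightarrow> U \<noteq> {} \<Longrightarrow> \<Union>U \<noteq> {}"
  using ex_in_orbit by blast

lemma Union_Int: "openin T U \<Longrightarrow> openin T V \<Longrightarrow> \<Union>(U \<inter> V) = \<Union>U \<inter> \<Union>V"
  using Union_Int_orbits openin_orbits by blast

lemma act_mem: 
  assumes "openin T U" "Q \<in> \<Union>U" "u \<noteq> 0"
  shows "act w u Q \<in> \<Union>U"
proof -
  have "orbit w Q \<in> U" "act w u Q \<in> orbit w Q"
    using assms mem_Union_iff by (auto simp: orbit_def)
  then show ?thesis by blast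
qed

lemma open_Int_nonempty:
  assumes "openin T U" "openin T V" "U \<noteq> {}" "V \<noteq> {}"
  shows "U \<inter> V \<noteq> {}"
proof -
  have "\<Union>U \<inter> \<Union>V \<noteq> {}"
    by (intro zariski_Int_nonempty openin_zariski Union_nonempty assms)
  then show ?thesis using Union_Int[OF assms(1,2)] by auto
qed

definition nz :: "('n point \<Rightarrow> complex) \<Rightarrow> 'n point set set" where
  "nz h = {z \<in> topspace T. \<forall>Q\<in>z. h Q \<noteq> 0}"

lemma openin_nz: "h \<in> hpoly w d \<Longrightarrow> openin T (nz h)"
  using openin_nonzero by (simp add: nz_def)

lemma Union_nz:
  assumes "h \<in> hpoly w d"
  shows "\<Union>(nz h) = {Q \<in> \<Union>(topspace T). h Q \<noteq> 0}"
proof -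
  have "h R \<noteq> 0" if "z \<in> topspace T" "Q \<in> z" "h Q \<noteq> 0" "R \<in> z" for z Q R
  proof -
    have "R \<in> orbit w Q" using orbit_mem[of "topspace T" z Q] that by auto
    then obtain u where "u \<noteq> 0" "R = act w u Q" by (auto simp: orbit_def)
    then show ?thesis using hpoly_act[OF assms] that by simp
  qed
  then show ?thesis unfolding nz_def by blast
qed

lemma crd_nonzero_mem:
  assumes "crd Q (Some i) \<noteq> 0"
  shows "Q \<in> \<Union>(topspace T)"
proof -
  have "fst Q \<noteq> 0" using assms by (auto simp: crd_def)
  then show ?thesis using chart mem_Union_iff[of "topspace T"] by auto
qed

section \<open>Local and global fractions, the identity theorem\<close>

lemma Sh_outside: "f \<in> Sh m U \<Longrightarrow> Q \<notin> \<Union>U \<Longrightarrow> f Q = 0"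
  unfolding gsh_iff by blast

lemma Sh_local_frac:
  assumes "openin T U" "f \<in> Sh m U" "Q \<in> \<Union>U"
  obtains V where "openin T V" "Q \<in> \<Union>V" "V \<subseteq> U" "frac_on w m f V"
proof -
  have "orbit w Q \<in> U" using assms mem_Union_iff by blast
  then obtain V where "openin T V" "orbit w Q \<in> V" "V \<subseteq> U" "frac_on w m f V"
    using assms(2) unfolding gsh_iff by blast
  then show ?thesis
    by (intro that[of V]) (simp_all only: mem_Union_iff)
qed

lemma Sh_local:
  assumes "openin T U" "f \<in> Sh m U" "Q \<in> \<Union>U"
  obtains V a d b where "openin T V" "Q \<in> \<Union>V" "V \<subseteq> U" "a \<in> hpoly w (m + d)" "b \<in> hpoly w d"
    "\<forall>R\<in>\<Union>V. b R \<noteq> 0 \<and> f R = a R / b R"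
  using Sh_local_frac[OF assms] unfolding frac_on_def by metis

lemma ShI:
  assumes U: "openin T U" and "\<And>Q. Q \<notin> \<Union>U \<Longrightarrow> f Q = 0"
    and loc: "\<And>Q. Q \<in> \<Union>U \<Longrightarrow> \<exists>V. openin T V \<and> Q \<in> \<Union>V \<and> V \<subseteq> U \<and> frac_on w m f V"
  shows "f \<in> Sh m U"
  unfolding gsh_iff
proof (intro conjI ballI)
  show "\<forall>Q. Q \<notin> \<Union>U \<longrightarrow> f Q = 0" using assms(2) by blast
  fix z assume z: "z \<in> U"
  then obtain Q where Q: "Q \<in> z" using ex_in_orbit[OF U] by blast
  then have "Q \<in> \<Union>U" using z by blast
  from loc[OF this] obtain V where V: "openin T V" "Q \<in> \<Union>V" "V \<subseteq> U" "frac_on w m f V"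
    by blast
  have "z \<in> V" using V(1,2) orbit_mem[OF U z Q] mem_Union_iff by simp
  with V show "\<exists>V. openin T V \<and> z \<in> V \<and> V \<subseteq> U \<and> frac_on w m f V"
    by blast
qed

lemma Sh_act:
  assumes "openin T U" "f \<in> Sh m U" "Q \<in> \<Union>U" "u \<noteq> 0"
  shows "f (act w u Q) = u powi m * f Q"
proof -
  obtain V a d b where V: "openin T V" "Q \<in> \<Union>V" "V \<subseteq> U" "a \<in> hpoly w (m + d)" "b \<in> hpoly w d"
    "\<forall>R\<in>\<Union>V. b R \<noteq> 0 \<and> f R = a R / b R"
    using Sh_local[OF assms(1-3)] .
  have "f (act w u Q) = (u powi (m + d) * a Q) / (u powi d * b Q)"
    using V(6)[rule_format, OF act_mem[OF V(1,2) assms(4)]] hpoly_act[OF V(4) assms(4)]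
      hpoly_act[OF V(5) assms(4)] by simp
  also have "\<dots> = u powi m * f Q"
    using V(6)[rule_format, OF V(2)] assms(4) by (simp add: power_int_add)
  finally show ?thesis .
qed

text \<open>The numerator of a local fraction vanishes on a nonempty open subset of affine space,
  hence identically.\<close>

lemma Sh_zero_on_open:
  assumes U: "openin T U" "f \<in> Sh m U" and N: "openin T N" "N \<noteq> {}"
    and zero: "\<And>Q. Q \<in> \<Union>N \<Longrightarrow> f Q = 0"
  shows "f = (\<lambda>Q. 0)"
proof
  fix Q
  show "f Q = 0"
  proof (cases "Q \<in> \<Union>U")
    case True
    obtain V a d b where V: "openin T V" "Q \<in> \<Union>V" "V \<subseteq> U" "a \<in> hpoly w (m + d)" "b \<in> hpoly w d"
      "\<forall>R\<in>\<Union>V. b R \<noteq> 0 \<and> f R = a R / b R"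
      using Sh_local[OF U True] .
    have "openin zariski (\<Union>V \<inter> \<Union>N)" "\<Union>V \<inter> \<Union>N \<noteq> {}"
      using zariski_Int_nonempty[of "\<Union>V" "\<Union>N"] openin_zariski V(1,2) N Union_nonempty[OF N]
      by auto
    moreover have "a R = 0" if "R \<in> \<Union>V \<inter> \<Union>N" for R
      using V(6)[rule_format, of R] zero[of R] that by auto
    ultimately have "a Q = 0"
      using polys_zero_on_open[OF hpoly_polys[OF V(4)]] by meson
    then show ?thesis using V(6)[rule_format, OF V(2)] by simp
  qed (use Sh_outside U in blast)
qed

text \<open>By irreducibility one local fraction describes the section throughout \<open>U\<close>
  after multiplication with the denominator. Where \<open>b\<close> vanishes this equation says
  nothing about \<open>f\<close>; there the continuity of \<open>Sh_isCont\<close> takes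
  over.\<close>

lemma Sh_global:
  assumes U: "openin T U" "f \<in> Sh m U" "U \<noteq> {}"
  obtains d a b Q0 where "a \<in> hpoly w (m + d)" "b \<in> hpoly w d" "Q0 \<in> \<Union>U" "b Q0 \<noteq> 0"
    "\<And>Q. Q \<in> \<Union>U \<Longrightarrow> f Q * b Q = a Q"
proof -
  obtain Q0 where Q0: "Q0 \<in> \<Union>U" using Union_nonempty[OF U(1,3)] by blast
  obtain V a d b where V: "openin T V" "Q0 \<in> \<Union>V" "V \<subseteq> U" "a \<in> hpoly w (m + d)" "b \<in> hpoly w d"
    "\<forall>R\<in>\<Union>V. b R \<noteq> 0 \<and> f R = a R / b R"
    using Sh_local[OF U(1,2) Q0] .
  have "f Q * b Q = a Q" if Q: "Q \<in> \<Union>U" for Q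
  proof -
    obtain V' a' d' b' where V': "openin T V'" "Q \<in> \<Union>V'" "V' \<subseteq> U" "a' \<in> hpoly w (m + d')"
      "b' \<in> hpoly w d'" "\<forall>R\<in>\<Union>V'. b' R \<noteq> 0 \<and> f R = a' R / b' R"
      using Sh_local[OF U(1,2) Q] .
    have "openin zariski (\<Union>V \<inter> \<Union>V')" "\<Union>V \<inter> \<Union>V' \<noteq> {}"
      using zariski_Int_nonempty[of "\<Union>V" "\<Union>V'"] openin_zariski V(1,2) V'(1,2) by auto
    moreover have "a' R * b R - a R * b' R = 0" if "R \<in> \<Union>V \<inter> \<Union>V'" for R
    proof -
      have "R \<in> \<Union>V" "R \<in> \<Union>V'" using that by blast+
      then show ?thesis using V(6)[rule_format, of R] V'(6)[rule_format, of R] by (simp add: field_simps)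
    qed
    moreover have "(\<lambda>R. a' R * b R - a R * b' R) \<in> polys"
      using V V' by (intro polys_diff polys_mult) (auto intro: hpoly_polys)
    ultimately have "a' Q * b Q - a Q * b' Q = 0"
      using polys_zero_on_open by meson
    then show ?thesis using V'(6)[rule_format, OF V'(2)] by (simp add: field_simps)
  qed
  then show ?thesis using that V Q0 by blast
qed

lemma Sh_isCont:
  assumes "openin T U" "f \<in> Sh m U" "Q \<in> \<Union>U"
  shows "isCont (\<lambda>t. f (line Q t R)) 0"
proof -
  obtain V a d b where V: "openin T V" "Q \<in> \<Union>V" "V \<subseteq> U" "a \<in> hpoly w (m + d)" "b \<in> hpoly w d"
    "\<forall>R\<in>\<Union>V. b R \<noteq> 0 \<and> f R = a R / b R"
    using Sh_local[OF assms(1-3)] .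
  obtain p q where p: "\<forall>t. a (line Q t R) = poly p t" and q: "\<forall>t. b (line Q t R) = poly q t"
    using poly_line hpoly_polys V(4,5) by meson
  have "poly q 0 \<noteq> 0" using q[rule_format, of 0] V(6)[rule_format, OF V(2)] by simp
  then have "isCont (\<lambda>t. poly p t / poly q t) 0" by (intro continuous_intros)
  moreover have "\<forall>\<^sub>F t in nhds 0. f (line Q t R) = poly p t / poly q t"
    using eventually_line[OF openin_zariski[OF V(1)] V(2), of R]
    by eventually_elim (use V(6) p q in auto)
  ultimately show ?thesis
    by (subst isCont_cong)
qed

section \<open>The module structure, polynomial and monomial sections\<close>

lemma Sh_restr:
  assumes "openin T U" "openin T W" "W \<subseteq> U" "f \<in> Sh m U"
  shows "restr W f \<in> Sh m W"
proof (rule ShI[OF assms(2)])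
  show "restr W f Q = 0" if "Q \<notin> \<Union>W" for Q
    using that by (auto simp: restr_def)
  fix Q assume Q: "Q \<in> \<Union>W"
  then have "Q \<in> \<Union>U" using assms(3) by blast
  from Sh_local_frac[OF assms(1,4) this]
  obtain V where V: "openin T V" "Q \<in> \<Union>V" "V \<subseteq> U" "frac_on w m f V" by blast
  show "\<exists>V. openin T V \<and> Q \<in> \<Union>V \<and> V \<subseteq> W \<and> frac_on w m (restr W f) V"
  proof (intro exI conjI)
    show "openin T (V \<inter> W)" using V assms by blast
    show "Q \<in> \<Union>(V \<inter> W)" using Union_Int[OF V(1) assms(2)] V(2) Q by blast
    have "restr W f R = f R" if "R \<in> \<Union>(V \<inter> W)" for R
      using that by (auto simp: restr_def)
    then show "frac_on w m (restr W f) (V \<inter> W)"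
      using frac_on_subset[OF V(4), of "V \<inter> W"] frac_on_cong[of "V \<inter> W" "restr W f" f] by simp
  qed auto
qed

lemma Sh_local2:
  assumes U: "openin T U" "f \<in> Sh m U" and W: "openin T W" "g \<in> Sh k W" and Q: "Q \<in> \<Union>U" "Q \<in> \<Union>W"
  obtains V where "openin T V" "Q \<in> \<Union>V" "V \<subseteq> U" "V \<subseteq> W"
    "frac_on w m f V" "frac_on w k g V"
proof -
  obtain V where V: "openin T V" "Q \<in> \<Union>V" "V \<subseteq> U" "frac_on w m f V"
    using Sh_local_frac[OF U Q(1)] by blast
  obtain V' where V': "openin T V'" "Q \<in> \<Union>V'" "V' \<subseteq> W" "frac_on w k g V'"
    using Sh_local_frac[OF W Q(2)] by blast
  show ?thesis
  proof (rule that[of "V \<inter> V'"])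
    show "Q \<in> \<Union>(V \<inter> V')" using Union_Int[OF V(1) V'(1)] V(2) V'(2) by blast
    show "frac_on w m f (V \<inter> V')" "frac_on w k g (V \<inter> V')"
      using frac_on_subset V(4) V'(4) by blast+
  qed (use V V' in blast)+
qed

lemma Sh_add:
  assumes U: "openin T U" "f \<in> Sh m U" "g \<in> Sh m U"
  shows "(\<lambda>Q. f Q + g Q) \<in> Sh m U"
proof (rule ShI[OF U(1)])
  show "f Q + g Q = 0" if "Q \<notin> \<Union>U" for Q
    using Sh_outside[OF U(2) that] Sh_outside[OF U(3) that] by simp
  fix Q assume Q: "Q \<in> \<Union>U"
  obtain V where V: "openin T V" "Q \<in> \<Union>V" "V \<subseteq> U" "frac_on w m f V" "frac_on w m g V"
    using Sh_local2[OF U(1,2) U(1,3) Q Q] .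
  obtain d a b where f: "a \<in> hpoly w (m + d)" "b \<in> hpoly w d"
      "\<And>Q. Q \<in> \<Union>V \<Longrightarrow> b Q \<noteq> 0" "\<And>Q. Q \<in> \<Union>V \<Longrightarrow> f Q = a Q / b Q"
    using frac_onE[OF V(4)] by metis
  obtain e a' b' where g: "a' \<in> hpoly w (m + e)" "b' \<in> hpoly w e"
      "\<And>Q. Q \<in> \<Union>V \<Longrightarrow> b' Q \<noteq> 0" "\<And>Q. Q \<in> \<Union>V \<Longrightarrow> g Q = a' Q / b' Q"
    using frac_onE[OF V(5)] by metis
  have "frac_on w m (\<lambda>Q. f Q + g Q) V"
  proof (rule frac_onI)
    show "(\<lambda>R. a R * b' R + a' R * b R) \<in> hpoly w (m + (d + e))"
      using hpoly_mult[OF f(1) g(2)] hpoly_mult[OF g(1) f(2)]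
      by (intro hpoly_add) (simp_all add: ac_simps)
    show "(\<lambda>R. b R * b' R) \<in> hpoly w (d + e)"
      using f g by (intro hpoly_mult)
    fix R assume R: "R \<in> \<Union>V"
    show "b R * b' R \<noteq> 0" "f R + g R = (a R * b' R + a' R * b R) / (b R * b' R)"
      using f(3,4)[OF R] g(3,4)[OF R] by (simp_all add: add_frac_eq)
  qed
  then show "\<exists>V. openin T V \<and> Q \<in> \<Union>V \<and> V \<subseteq> U \<and> frac_on w m (\<lambda>Q. f Q + g Q) V"
    using V(1-3) by blast
qed

lemma Sh_mult:
  assumes U: "openin T U" "a \<in> Sh k U" and W: "openin T W" "W \<subseteq> U" "f \<in> Sh m W"
  shows "(\<lambda>Q. a Q * f Q) \<in> Sh (k + m) W"
proof (rule ShI[OF W(1)])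
  show "a Q * f Q = 0" if "Q \<notin> \<Union>W" for Q
    using that Sh_outside W by simp
  fix Q assume Q: "Q \<in> \<Union>W"
  then have "Q \<in> \<Union>U" using W(2) by blast
  from Sh_local2[OF U(1,2) W(1,3) this Q]
  obtain V where V: "openin T V" "Q \<in> \<Union>V" "V \<subseteq> W" "frac_on w k a V" "frac_on w m f V"
    by metis
  obtain d p q where a: "p \<in> hpoly w (k + d)" "q \<in> hpoly w d"
      "\<And>Q. Q \<in> \<Union>V \<Longrightarrow> q Q \<noteq> 0" "\<And>Q. Q \<in> \<Union>V \<Longrightarrow> a Q = p Q / q Q"
    using frac_onE[OF V(4)] by metis
  obtain e p' q' where f: "p' \<in> hpoly w (m + e)" "q' \<in> hpoly w e"
      "\<And>Q. Q \<in> \<Union>V \<Longrightarrow> q' Q \<noteq> 0" "\<And>Q. Q \<in> \<Union>V \<Longrightarrow> f Q = p' Q / q' Q"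
    using frac_onE[OF V(5)] by metis
  have "frac_on w (k + m) (\<lambda>Q. a Q * f Q) V"
  proof (rule frac_onI)
    show "(\<lambda>R. p R * p' R) \<in> hpoly w (k + m + (d + e))"
      using hpoly_mult[OF a(1) f(1)] by (simp add: ac_simps)
    show "(\<lambda>R. q R * q' R) \<in> hpoly w (d + e)"
      using a f by (intro hpoly_mult)
    fix R assume R: "R \<in> \<Union>V"
    show "q R * q' R \<noteq> 0" "a R * f R = (p R * p' R) / (q R * q' R)"
      using f(3,4)[OF R] a(3,4)[OF R] by simp_all
  qed
  then show "\<exists>V. openin T V \<and> Q \<in> \<Union>V \<and> V \<subseteq> W \<and> frac_on w (k + m) (\<lambda>Q. a Q * f Q) V"
    using V(1-3) by blast
qed

lemma Sh_hpoly:
  assumes "openin T U" "h \<in> hpoly w m"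
  shows "restr U h \<in> Sh m U"
proof (rule ShI[OF assms(1)])
  fix Q assume Q: "Q \<in> \<Union>U"
  have "frac_on w m (restr U h) U"
  proof (rule frac_onI)
    show "h \<in> hpoly w (m + 0)" "(\<lambda>Q. 1) \<in> hpoly w 0"
      using assms hpoly_const by simp_all
  qed (simp_all add: restr_def)
  then show "\<exists>V. openin T V \<and> Q \<in> \<Union>V \<and> V \<subseteq> U \<and> frac_on w m (restr U h) V"
    using assms Q by blast
qed (auto simp: restr_def)

lemma Sh_scale:
  assumes "openin T U" "f \<in> Sh m U"
  shows "(\<lambda>Q. c * f Q) \<in> Sh m U"
proof -
  have "(\<lambda>Q. restr U (\<lambda>Q. c) Q * f Q) = (\<lambda>Q. c * f Q)"
    using Sh_outside[OF assms(2)] by (force simp: restr_def)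
  then show ?thesis
    using Sh_mult[OF assms(1) Sh_hpoly[OF assms(1) hpoly_const] assms(1) subset_refl assms(2), of c]
    by simp
qed

lemma Sh_zero: "openin T U \<Longrightarrow> (\<lambda>Q. 0) \<in> Sh m U"
  using Sh_hpoly[OF _ hpoly_0] by (simp add: restr_zero)

lemma module_sheaf_Sh: "module_sheaf T (Sh 0) (Sh m)"
  unfolding module_sheaf_def
  using Sh_zero Sh_add Sh_scale Sh_outside Sh_restr Sh_mult[where k = 0] by simp

lemma Sh_mon:
  assumes W: "openin T W" and nz: "\<And>Q j. Q \<in> \<Union>W \<Longrightarrow> \<mu> j < 0 \<Longrightarrow> crd Q j \<noteq> 0"
  shows "restr W (lmon \<mu>) \<in> Sh (wdeg w \<mu>) W"
proof (rule ShI[OF W])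
  fix Q assume Q: "Q \<in> \<Union>W"
  \<comment> \<open>Positive and negative part of the exponent:
    \<open>\<mu> = \<nu> - \<kappa>\<close>, so the Laurent monomial is the fraction
    \<open>lmon \<nu> / lmon \<kappa>\<close> of ordinary monomials.\<close>
  define \<nu> \<kappa> where "\<nu> j = max (\<mu> j) 0" and "\<kappa> j = max (- \<mu> j) 0" for j
  have e: "\<nu> = (\<lambda>j. \<mu> j + \<kappa> j)"
    by (auto simp: \<nu>_def \<kappa>_def)
  have "frac_on w (wdeg w \<mu>) (restr W (lmon \<mu>)) W"
  proof (rule frac_onI)
    show "lmon \<nu> \<in> hpoly w (wdeg w \<mu> + wdeg w \<kappa>)"
      using hpoly_mon[of \<nu>] unfolding wdeg_add[symmetric] e[symmetric] by (simp add: \<nu>_def)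
    show "lmon \<kappa> \<in> hpoly w (wdeg w \<kappa>)"
      by (rule hpoly_mon) (simp add: \<kappa>_def)
    fix R assume R: "R \<in> \<Union>W"
    show 1: "lmon \<kappa> R \<noteq> 0"
      using nz[OF R] by (auto simp: mon_eq_0_iff \<kappa>_def max_def split: if_splits)
    have "lmon \<nu> R = lmon \<mu> R * lmon \<kappa> R"
      unfolding e using nz[OF R] by (intro mon_add) (force simp: \<kappa>_def)
    then show "restr W (lmon \<mu>) R = lmon \<nu> R / lmon \<kappa> R"
      using 1 R by (simp add: restr_def del: Union_iff)
  qed
  then show "\<exists>V. openin T V \<and> Q \<in> \<Union>V \<and> V \<subseteq> W \<and> frac_on w (wdeg w \<mu>) (restr W (lmon \<mu>)) V"
    using W Q by blast
qed (auto simp: restr_def)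

section \<open>Partial derivatives of sections\<close>

lemma Sh_has_pder:
  assumes U: "openin T U" "f \<in> Sh m U" and Q: "Q \<in> \<Union>U"
  shows "has_pder j f (pder j f Q) Q"
    and "\<exists>V. openin T V \<and> Q \<in> \<Union>V \<and> V \<subseteq> U \<and> frac_on w (m - wt w j) (pder j f) V"
proof -
  obtain V a d b where V: "openin T V" "Q \<in> \<Union>V" "V \<subseteq> U" "a \<in> hpoly w (m + d)" "b \<in> hpoly w d"
    "\<forall>R\<in>\<Union>V. b R \<noteq> 0 \<and> f R = a R / b R"
    using Sh_local[OF assms(1-3)] .
  note a = hpoly_pder[OF V(4), of j] and b = hpoly_pder[OF V(5), of j]
  let ?n = "\<lambda>R. pder j a R * b R - a R * pder j b R"
  have D: "has_pder j f (?n R / (b R * b R)) R" if R: "R \<in> \<Union>V" for R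
  proof -
    have "has_pder j (\<lambda>R. a R / b R) (?n R / (b R * b R)) R"
      using a b V(6)[rule_format, OF R] by (intro has_pder_divide) blast+
    then show ?thesis
      using has_pder_cong[OF openin_zariski[OF V(1)] R, of f "\<lambda>R. a R / b R"] V(6) by blast
  qed
  then show "has_pder j f (pder j f Q) Q"
    using has_pder_imp_pder V(2) by metis
  have "frac_on w (m - wt w j) (pder j f) V"
  proof (rule frac_onI)
    show "?n \<in> hpoly w (m - wt w j + (d + d))"
      using hpoly_mult[OF conjunct1[OF a] V(5)] hpoly_mult[OF V(4) conjunct1[OF b]]
      by (intro hpoly_diff) (simp_all add: algebra_simps)
    show "(\<lambda>R. b R * b R) \<in> hpoly w (d + d)"
      using V by (intro hpoly_mult)
    fix R assume R: "R \<in> \<Union>V"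
    show "b R * b R \<noteq> 0" "pder j f R = ?n R / (b R * b R)"
      using has_pder_imp_pder[OF D[OF R]] V(6)[rule_format, OF R] by simp_all
  qed
  then show "\<exists>V. openin T V \<and> Q \<in> \<Union>V \<and> V \<subseteq> U \<and> frac_on w (m - wt w j) (pder j f) V"
    using V(1-3) by blast
qed

lemma Sh_pder:
  assumes U: "openin T U" "f \<in> Sh m U"
  shows "restr U (pder j f) \<in> Sh (m - wt w j) U"
proof (rule ShI[OF U(1)])
  fix Q assume "Q \<in> \<Union>U"
  from Sh_has_pder(2)[OF U this, of j]
  obtain V where V: "openin T V" "Q \<in> \<Union>V" "V \<subseteq> U" "frac_on w (m - wt w j) (pder j f) V"
    by blast
  have "restr U (pder j f) R = pder j f R" if "R \<in> \<Union>V" for R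
    using that V(3) by (auto simp: restr_def)
  then have "frac_on w (m - wt w j) (restr U (pder j f)) V"
    using V(4) frac_on_cong by metis
  with V(1-3) show "\<exists>V. openin T V \<and> Q \<in> \<Union>V \<and> V \<subseteq> U \<and> frac_on w (m - wt w j) (restr U (pder j f)) V"
    by blast
qed (auto simp: restr_def)

lemma restr_pder_restr:
  assumes "openin T W"
  shows "restr W (pder j (restr W f)) = restr W (pder j f)"
proof
  fix Q
  show "restr W (pder j (restr W f)) Q = restr W (pder j f) Q"
  proof (cases "Q \<in> \<Union>W")
    case True
    then have "pder j (restr W f) Q = pder j f Q"
      by (rule pder_cong[OF openin_zariski[OF assms]]) (simp add: restr_def del: Union_iff)
    then show ?thesis by (simp add: restr_def)
  qed (simp add: restr_def)
qed

end

section \<open>Interpolation in several variables\<close>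

text \<open>Coordinatewise interpolation in abstract form, to be used both for points of affine
  space (\<open>upd\<close>) and for exponents in a lattice (\<open>lat_upd\<close>):
  \<open>u j s\<close> replaces the coordinate \<open>j\<close> by the node \<open>s\<close>, and
  \<open>G j s\<close> is the weight of that node.\<close>

primrec iter_weight :: "('j \<Rightarrow> 's \<Rightarrow> 'q \<Rightarrow> complex) \<Rightarrow> 'j list \<Rightarrow> 's list \<Rightarrow> 'q \<Rightarrow> complex" where
  "iter_weight G [] ss Q = 1"
| "iter_weight G (j # js) ss Q = G j (hd ss) Q * iter_weight G js (tl ss) Q"

primrec iter_upd :: "('j \<Rightarrow> 's \<Rightarrow> 'q \<Rightarrow> 'q) \<Rightarrow> 'j list \<Rightarrow> 's list \<Rightarrow> 'q \<Rightarrow> 'q" where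
  "iter_upd u [] ss Q = Q"
| "iter_upd u (j # js) ss Q = iter_upd u js (tl ss) (u j (hd ss) Q)"

lemma iter_weight_cong:
  "(\<And>j s. j \<in> set js \<Longrightarrow> G j s Q = G j s R) \<Longrightarrow> iter_weight G js ss Q = iter_weight G js ss R"
  by (induction js arbitrary: ss) auto

text \<open>The one-variable formula is substituted into itself, one coordinate after another.
  Weights for \<open>j\<close> do not see updates of other coordinates, so all of them may be
  evaluated at the original \<open>Q\<close>.\<close>

lemma interpolation:
  assumes "distinct js" "Q \<in> D"
    and "\<And>Q j s. Q \<in> D \<Longrightarrow> j \<in> set js \<Longrightarrow> s \<in> X \<Longrightarrow> u j s Q \<in> D"
    and "\<And>Q j. Q \<in> D \<Longrightarrow> j \<in> set js \<Longrightarrow> F Q = (\<Sum>s\<in>X. G j s Q * F (u j s Q))"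
    and "\<And>Q j s k r. Q \<in> D \<Longrightarrow> j \<in> set js \<Longrightarrow> k \<in> set js \<Longrightarrow> j \<noteq> k \<Longrightarrow> G j s (u k r Q) = G j s Q"
  shows "F Q = (\<Sum>ss | set ss \<subseteq> X \<and> length ss = length js. iter_weight G js ss Q * F (iter_upd u js ss Q))"
  using assms
proof (induction js arbitrary: Q)
  case Nil
  have "{ss. set ss \<subseteq> X \<and> length ss = 0} = {[]}" by auto
  then show ?case by simp
next
  case (Cons j js)
  let ?L = "\<lambda>n. {ss. set ss \<subseteq> X \<and> length ss = n}"
  have IH: "F (u j s Q) =
      (\<Sum>ss\<in>?L (length js). iter_weight G js ss Q * F (iter_upd u js ss (u j s Q)))" if "s \<in> X" for s
  proof -
    have "F (u j s Q) =
        (\<Sum>ss\<in>?L (length js). iter_weight G js ss (u j s Q) * F (iter_upd u js ss (u j s Q)))"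
      using Cons.prems that by (intro Cons.IH) auto
    moreover have "iter_weight G js ss (u j s Q) = iter_weight G js ss Q" for ss
      using Cons.prems(1) by (intro iter_weight_cong Cons.prems(5)[OF Cons.prems(2)]) auto
    ultimately show ?thesis by simp
  qed
  have L: "?L (length (j # js)) = (\<lambda>(s, ss). s # ss) ` (X \<times> ?L (length js))"
    by (force simp: length_Suc_conv)
  have "F Q = (\<Sum>s\<in>X. G j s Q * F (u j s Q))"
    using Cons.prems by simp
  also have "\<dots> = (\<Sum>s\<in>X. \<Sum>ss\<in>?L (length js).
      iter_weight G (j # js) (s # ss) Q * F (iter_upd u (j # js) (s # ss) Q))"
    by (intro sum.cong refl) (simp add: IH sum_distrib_left mult.assoc)
  also have "\<dots> = (\<Sum>ss\<in>?L (length (j # js)). iter_weight G (j # js) ss Q * F (iter_upd u (j # js) ss Q))"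
    unfolding L sum.cartesian_product
    by (subst sum.reindex) (auto simp: inj_on_def case_prod_unfold)
  finally show ?case .
qed

section \<open>Lagrange interpolation in one variable\<close>

definition lagrange_poly :: "complex set \<Rightarrow> complex \<Rightarrow> complex poly" where
  "lagrange_poly X s = smult (1 / (\<Prod>r\<in>X - {s}. s - r)) (\<Prod>r\<in>X - {s}. [:- r, 1:])"

lemma degree_lagrange_poly:
  assumes "finite X" "s \<in> X"
  shows "degree (lagrange_poly X s) < card X"
proof -
  have "degree (\<Prod>r\<in>X - {s}. [:- r, 1:]) \<le> (\<Sum>r\<in>X - {s}. 1)"
    by (rule order_trans[OF degree_prod_sum_le]) (use assms in auto)
  also have "\<dots> < card X"
    using card_Diff1_less[OF assms] by simp
  finally show ?thesis
    unfolding lagrange_poly_def using degree_smult_le le_less_trans by blast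
qed

definition lagrange_interp :: "complex set \<Rightarrow> (complex \<Rightarrow> complex) \<Rightarrow> complex poly" where
  "lagrange_interp X h = (\<Sum>s\<in>X. smult (h s) (lagrange_poly X s))"

lemma poly_lagrange_interp:
  "poly (lagrange_interp X h) t = (\<Sum>s\<in>X. h s * poly (lagrange_poly X s) t)"
  by (simp add: lagrange_interp_def poly_sum)

lemma degree_lagrange_interp:
  assumes "finite X" "X \<noteq> {}"
  shows "degree (lagrange_interp X h) < card X"
  unfolding lagrange_interp_def using assms degree_lagrange_poly
  by (intro degree_sum_less) (auto intro: le_less_trans[OF degree_smult_le] simp: card_gt_0_iff)

lemma lagrange_interp_node:
  assumes X: "finite X" and r: "r \<in> X"
  shows "poly (lagrange_interp X h) r = h r"
proof -
  have "poly (lagrange_poly X s) r = (if s = r then 1 else 0)" if "s \<in> X" for s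
    using X r that unfolding lagrange_poly_def by (auto simp: poly_prod)
  then show ?thesis
    unfolding poly_lagrange_interp using X r by (simp add: if_distrib[of "(*) _"] cong: sum.cong if_cong)
qed

lemma lagrange_poly:
  assumes X: "finite X" and p: "degree p < card X"
  shows "poly p t = (\<Sum>s\<in>X. poly p s * poly (lagrange_poly X s) t)"
proof -
  have "X \<noteq> {}" using p by auto
  then have "p = lagrange_interp X (poly p)"
    using p X by (intro poly_eqI_degree[of X]) (simp_all add: lagrange_interp_node degree_lagrange_interp)
  then have "poly p t = poly (lagrange_interp X (poly p)) t" by simp
  then show ?thesis by (simp only: poly_lagrange_interp)
qed

section \<open>Regular functions on coordinate charts are Laurent polynomials\<close>

lemma no_root_const:
  fixes p :: "complex poly"
  assumes "\<And>t. poly p t \<noteq> 0"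
  obtains c where "c \<noteq> 0" "p = [:c:]"
proof -
  have "constant (poly p)"
    using fundamental_theorem_of_algebra assms by blast
  then have "degree p = 0" by (simp add: constant_degree)
  then obtain c where "p = [:c:]" by (metis degree_eq_zeroE)
  then show ?thesis using that[of c] assms by fastforce
qed

text \<open>Roots of the denominator are cancelled one at a time: at a root \<open>r\<close> of
  \<open>b\<close> also \<open>a\<close> vanishes, and the reduced equation extends to
  \<open>r\<close> by continuity. Once no root is left, except possibly 0 when \<open>e\<close>
  excludes that point, the denominator is a constant times a power of \<open>t\<close>. The bound
  \<open>2 * D\<close> does not depend on \<open>f\<close>, as interpolation with fixed nodes
  requires.\<close>

lemma continuous_fraction_poly:
  fixes f :: "complex \<Rightarrow> complex"
  assumes "b \<noteq> 0" "degree a \<le> D" "degree b \<le> D"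
    and "\<And>t. t \<noteq> 0 \<or> \<not> e \<Longrightarrow> isCont f t" "\<And>t. t \<noteq> 0 \<or> \<not> e \<Longrightarrow> f t * poly b t = poly a t"
  shows "\<exists>p. degree p \<le> 2 * D \<and> (\<forall>t. t \<noteq> 0 \<or> \<not> e \<longrightarrow> f t * t ^ (if e then D else 0) = poly p t)"
  using assms
proof (induction "degree b" arbitrary: a b rule: less_induct)
  case less
  show ?case
  proof (cases "\<exists>r. poly b r = 0 \<and> (r \<noteq> 0 \<or> \<not> e)")
    case True
    then obtain r where r: "poly b r = 0" "r \<noteq> 0 \<or> \<not> e" by blast
    then have "poly a r = 0" using less.prems(5)[of r] by simp
    then obtain a' b' where ab: "a = [:- r, 1:] * a'" "b = [:- r, 1:] * b'"
      using r(1) by (auto simp: poly_eq_0_iff_dvd elim!: dvdE)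
    have "b' \<noteq> 0" using less.prems(1) ab by auto
    then have db: "degree b = Suc (degree b')"
      unfolding ab by (subst degree_mult_eq) auto
    have da: "degree a' \<le> degree a"
    proof (cases "a' = 0")
      case False
      then show ?thesis unfolding ab by (subst degree_mult_eq) auto
    qed simp
    have off: "f t * poly b' t - poly a' t = 0" if "t \<noteq> r" "t \<noteq> 0 \<or> \<not> e" for t
    proof -
      have "(t - r) * (f t * poly b' t - poly a' t) = 0"
        using less.prems(5)[OF that(2)] by (simp add: ab algebra_simps)
      then show ?thesis using that(1) by simp
    qed
    have "f t * poly b' t = poly a' t" if t: "t \<noteq> 0 \<or> \<not> e" for t
    proof (cases "t = r")
      case True
      have "isCont (\<lambda>t. f t * poly b' t - poly a' t) r"
        using less.prems(4)[OF r(2)] by (intro continuous_intros)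
      then have 1: "((\<lambda>t. f t * poly b' t - poly a' t) \<longlongrightarrow> f r * poly b' r - poly a' r) (at r)"
        by (simp add: isCont_def)
      have "\<forall>\<^sub>F t in at r. t \<noteq> 0 \<or> \<not> e"
      proof (cases e)
        case True
        then have "r \<noteq> 0" using r(2) by simp
        then have "\<forall>\<^sub>F t in at r. t \<noteq> 0"
          using tendsto_imp_eventually_ne[OF tendsto_ident_at] by blast
        then show ?thesis by eventually_elim simp
      qed simp
      moreover have "\<forall>\<^sub>F t in at r. t \<noteq> r"
        by (simp add: eventually_at_filter)
      ultimately have "\<forall>\<^sub>F t in at r. f t * poly b' t - poly a' t = 0"
        by eventually_elim (rule off)
      then have 2: "((\<lambda>t. f t * poly b' t - poly a' t) \<longlongrightarrow> 0) (at r)"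
        by (rule tendsto_eventually)
      have "f r * poly b' r - poly a' r = 0"
        using tendsto_unique[OF _ 1 2] by simp
      then show ?thesis using True by simp
    qed (use off t in simp)
    then show ?thesis
      using less.hyps[of b' a'] less.prems(2,3,4) db da \<open>b' \<noteq> 0\<close> by auto
  next
    case False
    show ?thesis
    proof (cases e)
      case e: False
      then obtain c where c: "c \<noteq> 0" "b = [:c:]"
        using no_root_const[of b] False by metis
      have "f t = poly (smult (1 / c) a) t" for t
        using less.prems(5)[of t] c e by (simp add: field_simps)
      then show ?thesis
        using e less.prems(2) c(1) by (intro exI[of _ "smult (1 / c) a"]) auto
    next
      case e: True
      \<comment> \<open>All roots of \<open>b\<close> other than 0 are already gone, so splitting
        off the full power of \<open>t\<close> leaves a polynomial without roots.\<close>
      obtain q where q: "b = [:- 0, 1:] ^ Polynomial.order 0 b * q" "\<not> [:- 0, 1:] dvd q"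
        using order_decomp[OF less.prems(1)] by blast
      have "poly q 0 \<noteq> 0" using q(2) by (simp add: poly_eq_0_iff_dvd)
      moreover have "poly q t \<noteq> 0" if "t \<noteq> 0" for t
      proof
        assume "poly q t = 0"
        then have "poly b t = 0" by (subst q(1)) simp
        then show False using False that by blast
      qed
      ultimately obtain c where c: "c \<noteq> 0" "q = [:c:]"
        using no_root_const[of q] by metis
      define k where "k = Polynomial.order 0 b"
      have k: "k \<le> D"
        using order_degree[OF less.prems(1), of 0] less.prems(3) by (simp add: k_def)
      have b: "poly b t = t ^ k * c" for t
        by (subst q(1)) (simp add: c k_def)
      have "f t * t ^ D = poly (smult (1 / c) (a * [:0, 1:] ^ (D - k))) t" if "t \<noteq> 0" for t
      proof -
        have "t ^ D = t ^ k * t ^ (D - k)" using k by (simp flip: power_add)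
        then show ?thesis
          using less.prems(5)[of t] that c by (simp add: b field_simps)
      qed
      moreover have "degree (smult (1 / c) (a * [:0, 1:] ^ (D - k))) \<le> 2 * D"
      proof -
        have "degree (a * [:0, 1:] ^ (D - k)) \<le> degree a + degree ([:0, 1:] ^ (D - k) :: complex poly)"
          by (rule degree_mult_le)
        also have "degree ([:0, 1:] ^ (D - k) :: complex poly) \<le> D - k"
          using degree_power_le[of "[:0, 1::complex:]" "D - k"] by simp
        finally show ?thesis
          using less.prems(2) degree_smult_le[of "1 / c" "a * [:0, 1:] ^ (D - k)"] by linarith
      qed
      ultimately show ?thesis
        using e by (intro exI[of _ "smult (1 / c) (a * [:0, 1:] ^ (D - k))"] conjI allI impI) (auto simp only: if_True)
    qed
  qed
qed

text \<open>The bound is uniform in the line, so that one set of nodes serves all lines.\<close>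

lemma poly_line_degree:
  assumes "f \<in> polys"
  shows "\<exists>D. \<forall>Q R. \<exists>p. degree p \<le> D \<and> (\<forall>t. f (line Q t R) = poly p t)"
  using assms
proof (induction rule: poly_span_induct)
  case zero
  then show ?case by (auto intro!: exI[of _ 0])
next
  case (add c m f)
  then obtain D where D: "\<And>Q R. \<exists>p. degree p \<le> D \<and> (\<forall>t. f (line Q t R) = poly p t)" by blast
  let ?N = "\<Sum>j\<in>UNIV. nat (exps m j)"
  have "\<exists>p. degree p \<le> max ?N D \<and> (\<forall>t. c * lmon (exps m) (line Q t R) + f (line Q t R) = poly p t)" for Q R
  proof -
    obtain p where p: "degree p \<le> D" "\<forall>t. f (line Q t R) = poly p t" using D by blast
    let ?q = "\<Prod>j\<in>UNIV. [:crd Q j, crd R j:] ^ nat (exps m j)"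
    have 1: "lmon (exps m) (line Q t R) = poly ?q t" for t
      by (simp add: lmon_def poly_prod power_int_def)
    have "degree ([:crd Q j, crd R j:] ^ nat (exps m j)) \<le> nat (exps m j)" for j
    proof -
      have "degree ([:crd Q j, crd R j:] ^ nat (exps m j)) \<le> degree [:crd Q j, crd R j:] * nat (exps m j)"
        by (rule degree_power_le)
      also have "\<dots> \<le> 1 * nat (exps m j)" by (intro mult_right_mono) auto
      finally show ?thesis by simp
    qed
    then have "degree ?q \<le> ?N"
      by (intro order_trans[OF degree_prod_sum_le]) (auto intro: sum_mono)
    then have "degree (smult c ?q + p) \<le> max ?N D"
      using p(1) by (intro degree_add_le) (auto intro: order_trans[OF degree_smult_le])
    then show ?thesis
      using p(2) 1 by (intro exI[of _ "smult c ?q + p"]) simp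
  qed
  then show ?case by blast
qed

section \<open>Laurent polynomials on coordinate charts\<close>

definition chart_dom :: "'n::finite option set \<Rightarrow> 'n point set" where
  "chart_dom E = {Q. \<forall>j\<in>E. crd Q j \<noteq> 0}"

lemma openin_chart_dom: "openin zariski (chart_dom E)"
proof -
  have "chart_dom E = {Q. lmon (\<lambda>j. if j \<in> E then 1 else 0) Q \<noteq> 0}"
    by (auto simp: chart_dom_def mon_eq_0_iff)
  moreover have "lmon (\<lambda>j. if j \<in> E then 1 else 0) \<in> polys"
    by (intro hpoly_polys[OF hpoly_mon]) auto
  ultimately show ?thesis using openin_zariski_nonzero by metis
qed

definition laurent :: "'n::finite option set \<Rightarrow> ('n point \<Rightarrow> complex) \<Rightarrow> bool" where
  "laurent E G \<longleftrightarrow> (\<exists>S c. finite S \<and> (\<forall>\<nu>\<in>S. \<forall>j. j \<notin> E \<longrightarrow> 0 \<le> \<nu> j) \<and>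
     (\<forall>Q\<in>chart_dom E. G Q = (\<Sum>\<nu>\<in>S. c \<nu> * lmon \<nu> Q)))"

lemma laurentI:
  "finite S \<Longrightarrow> (\<And>\<nu> j. \<nu> \<in> S \<Longrightarrow> j \<notin> E \<Longrightarrow> 0 \<le> \<nu> j) \<Longrightarrow>
    (\<And>Q. Q \<in> chart_dom E \<Longrightarrow> G Q = (\<Sum>\<nu>\<in>S. c \<nu> * lmon \<nu> Q)) \<Longrightarrow> laurent E G"
  unfolding laurent_def by (intro exI[of _ S] exI[of _ c] conjI ballI allI impI)

lemma laurentE:
  assumes "laurent E G"
  obtains S c where "finite S" "\<forall>\<nu>\<in>S. \<forall>j. j \<notin> E \<longrightarrow> 0 \<le> \<nu> j"
    "\<forall>Q\<in>chart_dom E. G Q = (\<Sum>\<nu>\<in>S. c \<nu> * lmon \<nu> Q)"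
  using assms unfolding laurent_def by (elim exE conjE)

lemma laurent_cong: "laurent E G \<Longrightarrow> (\<And>Q. Q \<in> chart_dom E \<Longrightarrow> H Q = G Q) \<Longrightarrow> laurent E H"
  unfolding laurent_def by (elim ex_forward) simp

lemma laurent_mon: "(\<And>j. j \<notin> E \<Longrightarrow> 0 \<le> \<nu> j) \<Longrightarrow> laurent E (lmon \<nu>)"
  unfolding laurent_def by (intro exI[of _ "{\<nu>}"] exI[of _ "\<lambda>_. 1"]) auto

lemma laurent_scale: "laurent E G \<Longrightarrow> laurent E (\<lambda>Q. a * G Q)"
proof (elim laurentE)
  fix S c assume S: "finite S" "\<forall>\<nu>\<in>S. \<forall>j. j \<notin> E \<longrightarrow> 0 \<le> \<nu> j"
    "\<forall>Q\<in>chart_dom E. G Q = (\<Sum>\<nu>\<in>S. c \<nu> * lmon \<nu> Q)"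
  then show ?thesis
    by (intro laurentI[of S E _ "\<lambda>\<nu>. a * c \<nu>"]) (simp_all add: sum_distrib_left mult.assoc)
qed

lemma laurent_0: "laurent E (\<lambda>Q. 0)"
  unfolding laurent_def by (intro exI[of _ "{}"]) auto

lemma laurent_add:
  assumes "laurent E G" "laurent E H"
  shows "laurent E (\<lambda>Q. G Q + H Q)"
proof -
  obtain S c where S: "finite S" "\<forall>\<nu>\<in>S. \<forall>j. j \<notin> E \<longrightarrow> 0 \<le> \<nu> j"
      "\<forall>Q\<in>chart_dom E. G Q = (\<Sum>\<nu>\<in>S. c \<nu> * lmon \<nu> Q)"
    using laurentE[OF assms(1)] .
  obtain S' c' where S': "finite S'" "\<forall>\<nu>\<in>S'. \<forall>j. j \<notin> E \<longrightarrow> 0 \<le> \<nu> j"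
      "\<forall>Q\<in>chart_dom E. H Q = (\<Sum>\<nu>\<in>S'. c' \<nu> * lmon \<nu> Q)"
    using laurentE[OF assms(2)] .
  define d where "d m = (if m \<in> S then c m else 0) + (if m \<in> S' then c' m else 0)" for m
  have "G Q + H Q = (\<Sum>m\<in>S \<union> S'. d m * lmon m Q)" if Q: "Q \<in> chart_dom E" for Q
  proof -
    have "G Q = (\<Sum>m\<in>S \<union> S'. (if m \<in> S then c m else 0) * lmon m Q)"
      unfolding S(3)[rule_format, OF Q] by (rule sum.mono_neutral_cong_left) (use S S' in auto)
    moreover have "H Q = (\<Sum>m\<in>S \<union> S'. (if m \<in> S' then c' m else 0) * lmon m Q)"
      unfolding S'(3)[rule_format, OF Q] by (rule sum.mono_neutral_cong_left) (use S S' in auto)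
    ultimately show ?thesis by (simp add: d_def ring_distribs sum.distrib)
  qed
  then show ?thesis
    using S(1,2) S'(1,2) by (intro laurentI[of "S \<union> S'" E _ d]) auto
qed

lemma laurent_sum: "(\<And>i. i \<in> I \<Longrightarrow> laurent E (G i)) \<Longrightarrow> laurent E (\<lambda>Q. \<Sum>i\<in>I. G i Q)"
  by (induction I rule: infinite_finite_induct) (auto intro: laurent_0 laurent_add)

lemma laurent_mult:
  assumes "laurent E G" "laurent E H"
  shows "laurent E (\<lambda>Q. G Q * H Q)"
proof -
  obtain S c where S: "finite S" "\<forall>\<nu>\<in>S. \<forall>j. j \<notin> E \<longrightarrow> 0 \<le> \<nu> j"
      "\<forall>Q\<in>chart_dom E. G Q = (\<Sum>\<nu>\<in>S. c \<nu> * lmon \<nu> Q)"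
    using laurentE[OF assms(1)] .
  obtain S' c' where S': "finite S'" "\<forall>\<nu>\<in>S'. \<forall>j. j \<notin> E \<longrightarrow> 0 \<le> \<nu> j"
      "\<forall>Q\<in>chart_dom E. H Q = (\<Sum>\<nu>\<in>S'. c' \<nu> * lmon \<nu> Q)"
    using laurentE[OF assms(2)] .
  have "laurent E (\<lambda>Q. \<Sum>\<nu>\<in>S. \<Sum>\<kappa>\<in>S'. (c \<nu> * c' \<kappa>) * lmon (\<lambda>j. \<nu> j + \<kappa> j) Q)"
    using S(2) S'(2) by (intro laurent_sum laurent_scale laurent_mon) (meson add_nonneg_nonneg)
  then show ?thesis
  proof (rule laurent_cong)
    fix Q :: "'a point" assume Q: "Q \<in> chart_dom E"
    have "lmon (\<lambda>j. \<nu> j + \<kappa> j) Q = lmon \<nu> Q * lmon \<kappa> Q" if "\<nu> \<in> S" "\<kappa> \<in> S'" for \<nu> \<kappa>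
      using S(2) S'(2) that Q by (intro mon_add) (auto simp: chart_dom_def)
    then show "G Q * H Q = (\<Sum>\<nu>\<in>S. \<Sum>\<kappa>\<in>S'. (c \<nu> * c' \<kappa>) * lmon (\<lambda>j. \<nu> j + \<kappa> j) Q)"
      unfolding S(3)[rule_format, OF Q] S'(3)[rule_format, OF Q] sum_product
      by (intro sum.cong refl) (simp add: ac_simps)
  qed
qed

lemma laurent_const: "laurent E (\<lambda>Q. a)"
  using laurent_scale[OF laurent_mon[of E "\<lambda>j. 0"], of a] by simp

lemma laurent_poly_crd: "laurent E (\<lambda>Q. poly p (crd Q j))"
proof (induction p)
  case (pCons a p)
  have "laurent E (\<lambda>Q. crd Q j)"
    using laurent_mon[of E "(\<lambda>_. 0)(j := 1)"] by (simp add: mon_single[abs_def])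
  then show ?case
    using pCons by (auto intro!: laurent_add laurent_const laurent_mult)
qed (simp add: laurent_0)

definition upd :: "'n::finite option \<Rightarrow> complex \<Rightarrow> 'n point \<Rightarrow> 'n point" where
  "upd j s Q = pt ((crd Q)(j := s))"

lemma crd_upd [simp]: "crd (upd j s Q) = (crd Q)(j := s)"
  by (simp add: upd_def)

lemma upd_self [simp]: "upd j (crd Q j) Q = Q"
  by (simp add: upd_def)

lemma line_upd: "line (upd j s Q) t (upd j 0 R) = upd j s (line Q t R)"
  by (auto simp: line_def upd_def intro!: arg_cong[where f = pt])

lemma upd_eq_line: "upd j (s + t) Q = line (upd j s Q) t (pt ((\<lambda>_. 0)(j := 1)))"
  by (simp add: line_def upd_def fun_upd_def if_distrib cong: if_cong)

lemma iter_upd_agree: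
  "(\<And>k. k \<notin> set js \<Longrightarrow> crd Q k = crd R k) \<Longrightarrow> iter_upd upd js ss Q = iter_upd upd js ss R"
proof (induction js arbitrary: Q R ss)
  case Nil
  then have "crd Q = crd R" by auto
  then show ?case by (metis iter_upd.simps(1) pt_crd)
next
  case (Cons j js)
  show ?case
    using Cons.prems by (auto intro!: Cons.IH)
qed

text \<open>Interpolation takes the place of unique factorization. Along each coordinate line
  \<open>F\<close> is a Laurent polynomial with bounded exponents, hence a combination of its values
  at fixed nodes with Laurent weights. Once this is done in every coordinate, only constants remain
  besides the weights.\<close>

lemma regular_on_chart_laurent:
  assumes ab: "a \<in> polys" "b \<in> polys" "b Q0 \<noteq> 0"
    and F: "\<And>Q. Q \<in> chart_dom E \<Longrightarrow> F Q * b Q = a Q"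
    and cont: "\<And>Q R. Q \<in> chart_dom E \<Longrightarrow> isCont (\<lambda>t. F (line Q t R)) 0"
  shows "laurent E F"
proof -
  obtain D1 D2 where D1: "\<forall>Q R. \<exists>p. degree p \<le> D1 \<and> (\<forall>t. a (line Q t R) = poly p t)"
    and D2: "\<forall>Q R. \<exists>p. degree p \<le> D2 \<and> (\<forall>t. b (line Q t R) = poly p t)"
    using poly_line_degree ab(1,2) by meson
  define D where "D = max D1 D2"
  have Da: "\<exists>p. degree p \<le> D \<and> (\<forall>t. a (line Q t R) = poly p t)" for Q R
    using D1 by (metis D_def max.coboundedI1)
  have Db: "\<exists>p. degree p \<le> D \<and> (\<forall>t. b (line Q t R) = poly p t)" for Q R
    using D2 by (metis D_def max.coboundedI2)
  \<comment> \<open>The number of nodes exceeds the degree \<open>2 * D\<close> from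
    \<open>continuous_fraction_poly\<close>. The nodes avoid 0, so substituting one of them stays in
    the chart.\<close>
  define X :: "complex set" where "X = of_nat ` {1..2 * D + 1}"
  have X: "finite X" "card X = 2 * D + 1" "0 \<notin> X"
    by (auto simp: X_def card_image inj_on_def)
  \<comment> \<open>The power of the coordinate that clears a possible pole; poles can occur only
    along coordinates in \<open>E\<close>.\<close>
  define \<delta> where "\<delta> j = (if j \<in> E then D else 0)" for j
  define G where "G j s Q = s ^ \<delta> j * poly (lagrange_poly X s) (crd Q j) / crd Q j ^ \<delta> j" for j s Q
  have upd_dom: "upd j s Q \<in> chart_dom E" if "Q \<in> chart_dom E" "s \<noteq> 0 \<or> j \<notin> E" for Q j s
    using that by (auto simp: chart_dom_def)
  have crd_\<delta>: "crd Q j ^ \<delta> j \<noteq> 0" if "Q \<in> chart_dom E" for Q j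
    using that by (auto simp: \<delta>_def chart_dom_def)
  have generic: "F Q = (\<Sum>s\<in>X. G j s Q * F (upd j s Q))"
    if Q: "Q \<in> chart_dom E" and b: "b Q \<noteq> 0" for Q j
  proof -
    let ?e = "pt ((\<lambda>_. 0)(j := 1))"
    obtain p q where p: "degree p \<le> D" "\<And>t. a (line (upd j 0 Q) t ?e) = poly p t"
      and q: "degree q \<le> D" "\<And>t. b (line (upd j 0 Q) t ?e) = poly q t"
      using Da Db by metis
    have p': "a (upd j t Q) = poly p t" and q': "b (upd j t Q) = poly q t" for t
      using p(2)[of t] q(2)[of t] upd_eq_line[of j 0 t Q] by simp_all
    have "q \<noteq> 0" using q'[of "crd Q j"] b by auto
    moreover have "isCont (\<lambda>t. F (upd j t Q)) t" if "t \<noteq> 0 \<or> \<not> j \<in> E" for t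
      using cont[OF upd_dom[OF Q that], of ?e]
      unfolding isCont_iff[where f = "\<lambda>t. F (upd j t Q)"] isCont_def upd_eq_line[symmetric] by simp
    moreover have "F (upd j t Q) * poly q t = poly p t" if "t \<noteq> 0 \<or> \<not> j \<in> E" for t
      using F[OF upd_dom[OF Q that]] by (simp add: p' q')
    ultimately obtain r where r: "degree r \<le> 2 * D"
      "\<forall>t. t \<noteq> 0 \<or> \<not> j \<in> E \<longrightarrow> F (upd j t Q) * t ^ (if j \<in> E then D else 0) = poly r t"
      using continuous_fraction_poly[of q p D "j \<in> E" "\<lambda>t. F (upd j t Q)"] p(1) q(1) by blast
    have "F Q * crd Q j ^ \<delta> j = poly r (crd Q j)"
      using r(2)[rule_format, of "crd Q j"] Q unfolding \<delta>_def chart_dom_def by auto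
    also have "\<dots> = (\<Sum>s\<in>X. poly r s * poly (lagrange_poly X s) (crd Q j))"
      using r(1) X by (intro lagrange_poly) auto
    also have "\<dots> = (\<Sum>s\<in>X. (F (upd j s Q) * s ^ \<delta> j) * poly (lagrange_poly X s) (crd Q j))"
    proof (intro sum.cong refl)
      fix s assume "s \<in> X"
      then have "s \<noteq> 0" using X(3) by auto
      then show "poly r s * poly (lagrange_poly X s) (crd Q j) =
          (F (upd j s Q) * s ^ \<delta> j) * poly (lagrange_poly X s) (crd Q j)"
        using r(2) by (simp add: \<delta>_def)
    qed
    finally have "F Q = (\<Sum>s\<in>X. (F (upd j s Q) * s ^ \<delta> j) * poly (lagrange_poly X s) (crd Q j)) / crd Q j ^ \<delta> j"
      using crd_\<delta>[OF Q, of j] by (simp add: field_simps)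
    then show ?thesis
      by (simp add: G_def sum_divide_distrib algebra_simps)
  qed
  \<comment> \<open>If \<open>b Q = 0\<close>, then \<open>b\<close> may vanish on a whole
    coordinate line through \<open>Q\<close>. On the line from \<open>Q\<close> to \<open>Q0\<close>
    it has finitely many zeros, and both sides of the formula are continuous at
    \<open>Q\<close>.\<close>
  have all: "F Q = (\<Sum>s\<in>X. G j s Q * F (upd j s Q))" if Q: "Q \<in> chart_dom E" for Q j
  proof -
    define R where "R = pt (\<lambda>j. crd Q0 j - crd Q j)"
    have R: "line Q 1 R = Q0" by (simp add: line_def R_def)
    obtain q where q: "\<And>t. b (line Q t R) = poly q t" using Db by metis
    have "q \<noteq> 0" using q[of 1] R ab(3) by auto
    have ev1: "\<forall>\<^sub>F t in at 0. poly q t \<noteq> 0"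
      using islimpt_finite[OF poly_roots_finite[OF \<open>q \<noteq> 0\<close>], of 0]
      by (simp add: islimpt_iff_eventually)
    have ev2: "\<forall>\<^sub>F t in at 0. line Q t R \<in> chart_dom E"
      unfolding eventually_at_filter
      using eventually_line[OF openin_chart_dom Q, of R] by (rule eventually_mono) simp
    let ?H = "\<lambda>t. F (line Q t R) - (\<Sum>s\<in>X. G j s (line Q t R) * F (upd j s (line Q t R)))"
    have "isCont ?H 0"
    proof (intro continuous_intros cont[OF Q])
      fix s assume s: "s \<in> X"
      show "isCont (\<lambda>t. G j s (line Q t R)) 0"
        unfolding G_def using crd_\<delta>[OF Q, of j] by (auto intro!: continuous_intros)
      have "upd j s Q \<in> chart_dom E" using upd_dom[OF Q] s X(3) by metis
      from cont[OF this, of "upd j 0 R"] show "isCont (\<lambda>t. F (upd j s (line Q t R))) 0"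
        by (simp add: line_upd)
    qed
    then have 1: "(?H \<longlongrightarrow> ?H 0) (at 0)" by (simp add: isCont_def)
    have "\<forall>\<^sub>F t in at 0. ?H t = 0"
      using ev1 ev2 by eventually_elim (use generic q in auto)
    then have 2: "(?H \<longlongrightarrow> 0) (at 0)" by (rule tendsto_eventually)
    show ?thesis using tendsto_unique[OF _ 1 2] by simp
  qed
  obtain js where js: "set js = (UNIV :: 'a option set)" "distinct js"
    using finite_distinct_list[of "UNIV :: 'a option set"] by auto
  have G_laurent: "laurent E (G j s)" for j s
  proof -
    have "laurent E (\<lambda>Q. s ^ \<delta> j * poly (lagrange_poly X s) (crd Q j) *
        lmon ((\<lambda>_. 0)(j := - int (\<delta> j))) Q)"
      by (intro laurent_mult laurent_scale laurent_poly_crd laurent_mon) (auto simp: \<delta>_def)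
    then show ?thesis
    proof (rule laurent_cong)
      fix Q :: "'a point"
      have "lmon ((\<lambda>_. 0)(j := - int (\<delta> j))) Q = (\<Prod>k\<in>UNIV. if k = j then crd Q j powi (- int (\<delta> j)) else 1)"
        unfolding lmon_def by (intro prod.cong) auto
      then show "G j s Q = s ^ \<delta> j * poly (lagrange_poly X s) (crd Q j) *
          lmon ((\<lambda>_. 0)(j := - int (\<delta> j))) Q"
        by (simp add: G_def power_int_minus divide_inverse)
    qed
  qed
  have weight: "laurent E (iter_weight G ks ss)" for ks ss
  proof (induction ks arbitrary: ss)
    case Nil
    have "iter_weight G [] ss = (\<lambda>Q. 1)" by (rule ext) simp
    then show ?case by (simp only: laurent_const)
  next
    case (Cons k ks)
    have "iter_weight G (k # ks) ss = (\<lambda>Q. G k (hd ss) Q * iter_weight G ks (tl ss) Q)"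
      by (rule ext) simp
    then show ?case using laurent_mult[OF G_laurent Cons.IH] by (simp only:)
  qed
  have "laurent E (\<lambda>Q. \<Sum>ss | set ss \<subseteq> X \<and> length ss = length js.
      iter_weight G js ss Q * F (iter_upd upd js ss Q0))"
    by (intro laurent_sum laurent_mult weight laurent_const)
  then show ?thesis
  proof (rule laurent_cong)
    fix Q assume Q: "Q \<in> chart_dom E"
    \<comment> \<open>Every coordinate gets overwritten, so the starting point is irrelevant and the
      values of \<open>F\<close> in the sum are constants.\<close>
    have "iter_upd upd js ss Q0 = iter_upd upd js ss Q" for ss
      using js(1) by (intro iter_upd_agree) auto
    moreover have "F Q = (\<Sum>ss | set ss \<subseteq> X \<and> length ss = length js.
        iter_weight G js ss Q * F (iter_upd upd js ss Q))"
    proof (rule interpolation[OF js(2) Q])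
      fix Q' j s assume Q': "Q' \<in> chart_dom E" and s: "s \<in> X"
      show "upd j s Q' \<in> chart_dom E" using upd_dom[OF Q'] s X(3) by metis
    next
      fix Q' and j k :: "'a option" and s r assume "j \<noteq> k"
      then show "G j s (upd k r Q') = G j s Q'" by (simp add: G_def)
    qed (rule all)
    ultimately show "F Q = (\<Sum>ss | set ss \<subseteq> X \<and> length ss = length js.
        iter_weight G js ss Q * F (iter_upd upd js ss Q0))" by simp
  qed
qed

section \<open>Linear independence of characters\<close>

text \<open>Artin's argument: the relation translated by \<open>h\<close>, minus
  \<open>ch t h\<close> times the relation itself, no longer involves \<open>t\<close>; an
  \<open>h\<close> that separates \<open>s\<close> from \<open>t\<close> shows that the coefficient
  of \<open>s\<close> vanishes.\<close>

lemma dedekind_independence: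
  fixes ch :: "'s \<Rightarrow> 'g \<Rightarrow> complex"
  assumes "finite S"
    and "\<And>g h. g \<in> G \<Longrightarrow> h \<in> G \<Longrightarrow> m g h \<in> G"
    and "\<And>s g h. g \<in> G \<Longrightarrow> h \<in> G \<Longrightarrow> ch s (m g h) = ch s g * ch s h"
    and "\<And>s t. s \<noteq> t \<Longrightarrow> \<exists>g\<in>G. ch s g \<noteq> ch t g"
    and "e \<in> G" "\<And>s. ch s e \<noteq> 0"
    and "\<And>g. g \<in> G \<Longrightarrow> (\<Sum>s\<in>S. c s * ch s g) = 0"
  shows "\<forall>s\<in>S. c s = 0"
  using assms(1,7)
proof (induction S arbitrary: c rule: finite_induct)
  case (insert t S)
  have rel: "c t * ch t g + (\<Sum>s\<in>S. c s * ch s g) = 0" if "g \<in> G" for g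
    using insert(1,2) insert.prems[OF that] by simp
  have *: "\<forall>s\<in>S. c s * (ch s h - ch t h) = 0" if h: "h \<in> G" for h
  proof (rule insert.IH)
    fix g assume g: "g \<in> G"
    have r: "(\<Sum>s\<in>S. c s * ch s k) = - c t * ch t k" if "k \<in> G" for k
      using rel[OF that] by (metis add_eq_0_iff mult_minus_left)
    have "(\<Sum>s\<in>S. c s * (ch s h - ch t h) * ch s g) =
        (\<Sum>s\<in>S. c s * ch s (m g h)) - ch t h * (\<Sum>s\<in>S. c s * ch s g)"
      by (simp add: assms(3)[OF g h] sum_distrib_left sum_subtractf[symmetric] algebra_simps)
    also have "\<dots> = - c t * ch t (m g h) - ch t h * (- c t * ch t g)"
      unfolding r[OF g] r[OF assms(2)[OF g h]] ..
    also have "\<dots> = 0" by (simp add: assms(3)[OF g h])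
    finally show "(\<Sum>s\<in>S. c s * (ch s h - ch t h) * ch s g) = 0" .
  qed
  have S: "c s = 0" if s: "s \<in> S" for s
  proof -
    have "s \<noteq> t" using s insert(2) by auto
    then obtain h where "h \<in> G" "ch s h \<noteq> ch t h" using assms(4) by blast
    then show ?thesis using * s by force
  qed
  then have "c t * ch t e = 0" using rel[OF assms(5)] by simp
  then show ?case using S assms(6) by simp
qed simp

lemma powi_2_inject: "(2::complex) powi d = 2 powi e \<longleftrightarrow> d = e"
proof
  assume "(2::complex) powi d = 2 powi e"
  then have "norm ((2::complex) powi d) = norm ((2::complex) powi e)" by simp
  then have "(2::real) powi d = 2 powi e" by (simp add: norm_power_int)
  then show "d = e"
    using power_int_strict_increasing[of _ _ "2::real"]
    by (metis less_irrefl linorder_neqE one_less_numeral_iff semiring_norm(76))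
qed simp

lemma lmon_independent:
  assumes "finite S" and "\<And>Q. Q \<in> chart_dom UNIV \<Longrightarrow> (\<Sum>\<nu>\<in>S. c \<nu> * lmon \<nu> Q) = 0"
  shows "\<forall>\<nu>\<in>S. c \<nu> = 0"
proof (rule dedekind_independence[where G = "chart_dom UNIV" and ch = lmon
      and m = "\<lambda>Q R. pt (\<lambda>j. crd Q j * crd R j)" and e = "pt (\<lambda>_. 1)"])
  fix \<nu> \<kappa> :: "'a option \<Rightarrow> int" assume "\<nu> \<noteq> \<kappa>"
  then obtain j where j: "\<nu> j \<noteq> \<kappa> j" by auto
  let ?Q = "pt ((\<lambda>_. 1)(j := 2))"
  have e: "lmon \<mu> ?Q = 2 powi \<mu> j" for \<mu>
  proof -
    have "lmon \<mu> ?Q = (\<Prod>k\<in>UNIV. if k = j then 2 powi \<mu> j else 1)"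
      unfolding lmon_def by (intro prod.cong) auto
    then show ?thesis by simp
  qed
  show "\<exists>g\<in>chart_dom UNIV. lmon \<nu> g \<noteq> lmon \<kappa> g"
    using e j by (intro bexI[of _ ?Q]) (auto simp: chart_dom_def powi_2_inject)
qed (use assms in \<open>auto simp: chart_dom_def lmon_def power_int_mult_distrib prod.distrib\<close>)

section \<open>Functions on a lattice with vanishing iterated differences\<close>

primrec dvanish1 :: "nat \<Rightarrow> (int \<Rightarrow> complex) \<Rightarrow> bool" where
  "dvanish1 0 h \<longleftrightarrow> (\<forall>t. h t = 0)"
| "dvanish1 (Suc n) h \<longleftrightarrow> dvanish1 n (\<lambda>t. h (t + 1) - h t)"

lemma dvanish1_diff: "dvanish1 n g \<Longrightarrow> dvanish1 n h \<Longrightarrow> dvanish1 n (\<lambda>t. g t - h t)"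
proof (induction n arbitrary: g h)
  case (Suc n)
  show ?case
    using Suc.IH[of "\<lambda>t. g (t + 1) - g t" "\<lambda>t. h (t + 1) - h t"] Suc.prems
    by (simp add: algebra_simps)
qed simp

text \<open>The first difference has zeros at one node fewer and vanishes by induction, so
  \<open>h\<close> is constant, with the value 0 at 0.\<close>

lemma dvanish1_zero: "dvanish1 n h \<Longrightarrow> (\<And>s. s < n \<Longrightarrow> h (int s) = 0) \<Longrightarrow> h t = 0"
proof (induction n arbitrary: h t)
  case (Suc n)
  have step: "h (t + 1) = h t" for t
  proof -
    have "h (t + 1) - h t = 0"
    proof (rule Suc.IH[of "\<lambda>t. h (t + 1) - h t"])
      fix s assume "s < n"
      then show "h (int s + 1) - h (int s) = 0"
        using Suc.prems(2)[of s] Suc.prems(2)[of "Suc s"] by (simp add: add.commute)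
    qed (use Suc.prems(1) in simp)
    then show ?thesis by simp
  qed
  have "h 0 = 0" using Suc.prems(2)[of 0] by simp
  then show ?case
  proof (induction t rule: int_induct[where k = 0])
    case (step2 i)
    then show ?case using step[of "i - 1"] by simp
  qed (use step in simp_all)
qed simp

text \<open>Translation preserves degree and leading coefficient, so each difference lowers the
  degree.\<close>

lemma dvanish1_poly: "degree p < n \<Longrightarrow> dvanish1 n (\<lambda>t. poly p (of_int t))"
proof (induction n arbitrary: p)
  case (Suc n)
  define q where "q = pcompose p [:1, 1:] - p"
  have e: "poly p (of_int (t + 1)) - poly p (of_int t) = poly q (of_int t)" for t :: int
    by (simp add: q_def poly_pcompose add.commute)
  show ?case
  proof (cases "degree p")
    case 0
    then obtain c where "p = [:c:]" by (metis degree_eq_zeroE)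
    moreover have "dvanish1 n (\<lambda>t. 0)" by (induction n) auto
    ultimately show ?thesis by simp
  next
    case (Suc k)
    have d: "degree (pcompose p [:1, 1:]) = degree p" by (simp add: degree_pcompose)
    have "coeff q i = 0" if "k < i" for i
    proof (cases "i = Suc k")
      case True
      have "lead_coeff (pcompose p [:1, 1:]) = lead_coeff p * lead_coeff [:1, 1:] ^ degree p"
        by (rule lead_coeff_comp) simp
      then show ?thesis using True Suc d by (simp add: q_def)
    next
      case False
      then show ?thesis using that Suc d by (simp add: q_def coeff_eq_0)
    qed
    then have "degree q \<le> k" by (intro degree_le) auto
    then have "degree q < n" using Suc Suc.prems by simp
    then show ?thesis using Suc.IH[of q] e by simp
  qed
qed simp

lemma dvanish1_interpolation:
  assumes "dvanish1 n h"
  shows "h t = (\<Sum>s\<in>{0..<int n}.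
    poly (lagrange_poly (of_int ` {0..<int n}) (of_int s)) (of_int t) * h s)"
proof (cases "n = 0")
  case True
  then show ?thesis using assms by simp
next
  case False
  define X :: "complex set" where "X = of_int ` {0..<int n}"
  have X: "finite X" "X \<noteq> {}" "card X = n"
    using False by (auto simp: X_def card_image inj_on_def)
  \<comment> \<open>The nodes are complex numbers; \<open>\<lfloor>Re s\<rfloor>\<close> recovers
    the integer behind a node.\<close>
  let ?p = "lagrange_interp X (\<lambda>s. h (\<lfloor>Re s\<rfloor>))"
  have "dvanish1 n (\<lambda>t. h t - poly ?p (of_int t))"
    using degree_lagrange_interp[OF X(1,2)] X(3) by (intro dvanish1_diff assms dvanish1_poly) simp
  moreover have "h (int s) - poly ?p (of_int (int s)) = 0" if "s < n" for s
  proof -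
    have "of_int (int s) \<in> X" unfolding X_def using that by (intro imageI) simp
    then show ?thesis using lagrange_interp_node[OF X(1)] by simp
  qed
  ultimately have "h t - poly ?p (of_int t) = 0" by (rule dvanish1_zero)
  then have "h t = (\<Sum>s\<in>X. h (\<lfloor>Re s\<rfloor>) * poly (lagrange_poly X s) (of_int t))"
    by (simp add: poly_lagrange_interp)
  also have "\<dots> = (\<Sum>s\<in>{0..<int n}. h s * poly (lagrange_poly X (of_int s)) (of_int t))"
    unfolding X_def by (subst sum.reindex) (auto simp: inj_on_def)
  finally show ?thesis by (simp add: X_def mult.commute)
qed

text \<open>Only directions of weight 0 stay on the hyperplane of degree \<open>l\<close>, and these
  are the differences that commutators with invariant monomials produce. Values of \<open>f\<close>
  off the hyperplane are never tested.\<close>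

primrec dvanish :: "int \<Rightarrow> int \<Rightarrow> nat \<Rightarrow> (('n::finite option \<Rightarrow> int) \<Rightarrow> complex) \<Rightarrow> bool" where
  "dvanish w l 0 f \<longleftrightarrow> (\<forall>\<mu>. wdeg w \<mu> = l \<longrightarrow> f \<mu> = 0)"
| "dvanish w l (Suc n) f \<longleftrightarrow>
    (\<forall>\<gamma>. wdeg w \<gamma> = 0 \<longrightarrow> dvanish w l n (\<lambda>\<mu>. f (\<lambda>j. \<mu> j + \<gamma> j) - f \<mu>))"

lemma dvanish_dvanish1:
  "dvanish w l n f \<Longrightarrow> wdeg w \<gamma> = 0 \<Longrightarrow> wdeg w \<mu> = l \<Longrightarrow> dvanish1 n (\<lambda>t. f (\<lambda>j. \<mu> j + t * \<gamma> j))"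
proof (induction n arbitrary: f)
  case 0
  then show ?case by (simp add: wdeg_add wdeg_scale)
next
  case (Suc n)
  have "(\<lambda>j. \<mu> j + t * \<gamma> j + \<gamma> j) = (\<lambda>j. \<mu> j + (t + 1) * \<gamma> j)" for t
    by (simp add: algebra_simps)
  with Suc.IH[of "\<lambda>\<mu>. f (\<lambda>j. \<mu> j + \<gamma> j) - f \<mu>"] Suc.prems
  show ?case by simp
qed

text \<open>Polynomial functions instead of polynomials, since on the hyperplane the expression is
  not determined by the values. Divisibility and the realization by words are both proved along this
  generation.\<close>

inductive_set ipoly :: "(('j \<Rightarrow> int) \<Rightarrow> complex) set" where
  const: "(\<lambda>\<mu>. c) \<in> ipoly"
| coord: "(\<lambda>\<mu>. of_int (\<mu> j)) \<in> ipoly"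
| add: "p \<in> ipoly \<Longrightarrow> q \<in> ipoly \<Longrightarrow> (\<lambda>\<mu>. p \<mu> + q \<mu>) \<in> ipoly"
| mult: "p \<in> ipoly \<Longrightarrow> q \<in> ipoly \<Longrightarrow> (\<lambda>\<mu>. p \<mu> * q \<mu>) \<in> ipoly"

lemma ipoly_sum: "(\<And>i. i \<in> I \<Longrightarrow> p i \<in> ipoly) \<Longrightarrow> (\<lambda>\<mu>. \<Sum>i\<in>I. p i \<mu>) \<in> ipoly"
  by (induction I rule: infinite_finite_induct) (auto intro: ipoly.intros)

lemma ipoly_poly: "(\<lambda>\<mu>. poly p (of_int (\<mu> j))) \<in> ipoly"
  by (induction p) (auto intro!: ipoly.intros)

lemma ipoly_line:
  assumes "p \<in> ipoly"
  shows "\<exists>q. \<forall>t. p (\<lambda>j. \<mu> j + t * v j) = poly q (of_int t)"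
  using assms
proof induction
  case (const c)
  then show ?case by (auto intro: exI[of _ "[:c:]"])
next
  case (coord j)
  then show ?case by (auto intro!: exI[of _ "[:of_int (\<mu> j), of_int (v j):]"])
next
  case (add p q)
  then show ?case by (metis poly_add)
next
  case (mult p q)
  then show ?case by (metis poly_mult)
qed

text \<open>A one-variable polynomial with infinitely many zeros. It carries information from the
  far end of a ray, where inequalities between exponents can be arranged, back to an arbitrary
  starting point.\<close>

lemma ipoly_zero_ray:
  assumes "p \<in> ipoly" and "\<And>t. t \<ge> N \<Longrightarrow> p (\<lambda>j. \<mu> j + t * v j) = 0"
  shows "p \<mu> = 0"
proof -
  obtain q where q: "\<And>t. p (\<lambda>j. \<mu> j + t * v j) = poly q (of_int t)"
    using ipoly_line[OF assms(1)] by blast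
  have "infinite (of_int ` {N..} :: complex set)"
    by (simp add: finite_image_iff inj_on_def infinite_Ici)
  moreover have "of_int ` {N..} \<subseteq> {t. poly q t = 0}"
    using assms(2) q by auto
  ultimately have "q = 0"
    using poly_roots_finite finite_subset by blast
  then show ?thesis using q[of 0] by simp
qed

text \<open>
  The substitution \<open>\<mu> j := s\<close> on the lattice of vectors of given weighted degree, compensated in a
  coordinate \<open>i\<close> of weight \<open>1\<close>.
\<close>

definition lat_upd :: "int \<Rightarrow> 'n::finite option \<Rightarrow> 'n option \<Rightarrow> int \<Rightarrow> ('n option \<Rightarrow> int) \<Rightarrow> 'n option \<Rightarrow> int" where
  "lat_upd w i j s \<mu> = (\<mu>(j := s))(i := \<mu> i - wt w j * (s - \<mu> j))"

lemma wt_Some [simp]: "wt w (Some i) = 1"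
  by (simp add: wt_def)

lemma wdeg_lat_upd: "j \<noteq> Some i \<Longrightarrow> wdeg w (lat_upd w (Some i) j s \<mu>) = wdeg w \<mu>"
  by (simp add: lat_upd_def wdeg_upd)

lemma iter_lat_upd_agree:
  assumes "Some i \<notin> set js" "wdeg w \<mu> = wdeg w \<nu>"
    and "\<And>k. k \<notin> set js \<Longrightarrow> k \<noteq> Some i \<Longrightarrow> \<mu> k = \<nu> k"
  shows "iter_upd (lat_upd w (Some i)) js ss \<mu> = iter_upd (lat_upd w (Some i)) js ss \<nu>"
  using assms
proof (induction js arbitrary: \<mu> \<nu> ss)
  case Nil
  then have "\<nu> = \<mu>(Some i := \<nu> (Some i))" by auto
  then have "wdeg w \<nu> = wdeg w \<mu> + (\<nu> (Some i) - \<mu> (Some i))"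
    by (metis mult_1 wdeg_upd wt_Some)
  then have "\<mu> (Some i) = \<nu> (Some i)" using Nil by simp
  then have "\<mu> = \<nu>" using Nil by (metis ext list.set(1) empty_iff)
  then show ?case by simp
next
  case (Cons j js)
  have "lat_upd w (Some i) j s \<mu> k = lat_upd w (Some i) j s \<nu> k"
    if "k \<notin> set js" "k \<noteq> Some i" for s k
    using Cons.prems(3)[of k] that by (simp add: lat_upd_def)
  then show ?case
    using Cons.prems by (auto intro!: Cons.IH simp: wdeg_lat_upd)
qed

text \<open>Nodes and weights are chosen before \<open>f\<close>. Applied to the coefficients of an
  operator in all directions at once, this makes the set of directions that occur finite.\<close>

lemma dvanish_interpolation:
  fixes w l :: int
  obtains I :: "int list set" and H :: "int list \<Rightarrow> ('n::finite option \<Rightarrow> int) \<Rightarrow> complex" and e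
  where "finite I" "\<And>x. x \<in> I \<Longrightarrow> H x \<in> ipoly" "\<And>x. x \<in> I \<Longrightarrow> wdeg w (e x) = l"
    "\<And>f \<mu>. dvanish w l n f \<Longrightarrow> wdeg w \<mu> = l \<Longrightarrow> f \<mu> = (\<Sum>x\<in>I. H x \<mu> * f (e x))"
proof -
  \<comment> \<open>A coordinate of weight 1 can be solved for in \<open>wdeg w \<mu> = l\<close>;
    the others are then free parameters of the hyperplane.\<close>
  fix i :: 'n
  obtain js where js: "set js = UNIV - {Some i}" "distinct js"
    using finite_distinct_list[of "UNIV - {Some i}"] by auto
  define X where "X = {0..<int n}"
  define u where "u = lat_upd w (Some i)"
  define G where "G j s \<mu> = poly (lagrange_poly (of_int ` X) (of_int s)) (of_int (\<mu> j))"
    for j s and \<mu> :: "'n option \<Rightarrow> int"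
  define \<mu>0 where "\<mu>0 = (\<lambda>_. 0)(Some i := l)"
  have \<mu>0: "wdeg w \<mu>0 = l" by (simp add: \<mu>0_def wdeg_upd wdeg_zero)
  define I where "I = {ss. set ss \<subseteq> X \<and> length ss = length js}"
  have "finite I" unfolding I_def X_def by (intro finite_lists_length_eq) simp
  moreover have "iter_weight G ks ss \<in> ipoly" for ks ss
  proof (induction ks arbitrary: ss)
    case Nil
    have "iter_weight G [] ss = (\<lambda>\<mu>. 1)" by (rule ext) simp
    then show ?case by (simp only: ipoly.const)
  next
    case (Cons k ks)
    have "iter_weight G (k # ks) ss = (\<lambda>Q. G k (hd ss) Q * iter_weight G ks (tl ss) Q)"
      by (rule ext) simp
    moreover have "G k (hd ss) \<in> ipoly" unfolding G_def by (rule ipoly_poly)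
    ultimately show ?case using ipoly.mult Cons.IH by metis
  qed
  moreover have "wdeg w (iter_upd u ks ss \<mu>) = wdeg w \<mu>" if "Some i \<notin> set ks" for ks ss \<mu>
    using that by (induction ks arbitrary: ss \<mu>) (auto simp: u_def wdeg_lat_upd)
  then have "wdeg w (iter_upd u js ss \<mu>0) = l" for ss
    using js(1) \<mu>0 by simp
  moreover have "f \<mu> = (\<Sum>ss\<in>I. iter_weight G js ss \<mu> * f (iter_upd u js ss \<mu>0))"
    if f: "dvanish w l n f" and \<mu>: "wdeg w \<mu> = l" for f \<mu>
  proof -
    have "f \<mu> = (\<Sum>ss | set ss \<subseteq> X \<and> length ss = length js.
        iter_weight G js ss \<mu> * f (iter_upd u js ss \<mu>))"
    proof (rule interpolation[OF js(2), where D = "{\<mu>. wdeg w \<mu> = l}"])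
      fix \<mu> :: "'n option \<Rightarrow> int" and j s assume "\<mu> \<in> {\<mu>. wdeg w \<mu> = l}" "j \<in> set js"
      then show "u j s \<mu> \<in> {\<mu>. wdeg w \<mu> = l}"
        using js(1) by (auto simp: u_def wdeg_lat_upd)
    next
      fix \<mu> :: "'n option \<Rightarrow> int" and j assume \<mu>: "\<mu> \<in> {\<mu>. wdeg w \<mu> = l}" and j: "j \<in> set js"
      then have "j \<noteq> Some i" using js(1) by auto
      \<comment> \<open>The direction in which \<open>lat_upd\<close> moves as the new value of the
        coordinate \<open>j\<close> runs through the integers.\<close>
      define \<gamma> where "\<gamma> = ((\<lambda>_. 0)(j := 1))(Some i := - wt w j)"
      have \<gamma>: "wdeg w \<gamma> = 0"
        using \<open>j \<noteq> Some i\<close> by (simp add: \<gamma>_def wdeg_upd wdeg_zero)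
      have h: "(\<lambda>k. u j 0 \<mu> k + t * \<gamma> k) = u j t \<mu>" for t
        using \<open>j \<noteq> Some i\<close> by (auto simp: fun_eq_iff u_def lat_upd_def \<gamma>_def algebra_simps)
      have "wdeg w (u j 0 \<mu>) = l"
        using \<mu> \<open>j \<noteq> Some i\<close> by (simp add: u_def wdeg_lat_upd)
      from dvanish1_interpolation[OF dvanish_dvanish1[OF f \<gamma> this], of "\<mu> j"]
      have "f (u j (\<mu> j) \<mu>) = (\<Sum>s\<in>X. G j s \<mu> * f (u j s \<mu>))"
        by (simp add: h X_def G_def)
      moreover have "u j (\<mu> j) \<mu> = \<mu>" by (simp add: u_def lat_upd_def)
      ultimately show "f \<mu> = (\<Sum>s\<in>X. G j s \<mu> * f (u j s \<mu>))" by simp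
    next
      fix \<mu> :: "'n option \<Rightarrow> int" and j s k r assume "j \<in> set js" "j \<noteq> k"
      then show "G j s (u k r \<mu>) = G j s \<mu>"
        using js(1) by (auto simp: G_def u_def lat_upd_def)
    qed (use \<mu> in simp)
    moreover have "iter_upd u js ss \<mu> = iter_upd u js ss \<mu>0" for ss
      unfolding u_def using js(1) \<mu> \<mu>0 by (intro iter_lat_upd_agree) auto
    ultimately show ?thesis by (simp add: I_def)
  qed
  ultimately show ?thesis
    by (intro that[of I "iter_weight G js" "\<lambda>ss. iter_upd u js ss \<mu>0"]) auto
qed

text \<open>A divided difference in the coordinate \<open>j\<close>, by induction on the polynomial.
  For products it is the Leibniz rule, in which the first factor after substitution has to be
  rewritten as a polynomial in \<open>\<mu>\<close>.\<close>

lemma ipoly_divide: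
  assumes "p \<in> ipoly" "j \<noteq> i"
  shows "\<exists>q\<in>ipoly. \<forall>\<mu>. p \<mu> - p (lat_upd w i j s \<mu>) = of_int (\<mu> j - s) * q \<mu>"
  using assms(1)
proof induction
  case (const c)
  then show ?case using ipoly.const[of 0] by (intro bexI[of _ "\<lambda>\<mu>. 0"]) auto
next
  case (coord k)
  have "of_int (\<mu> k) - of_int (lat_upd w i j s \<mu> k) =
      of_int (\<mu> j - s) * (if k = i then - of_int (wt w j) else if k = j then 1 else 0 :: complex)" for \<mu>
    using assms(2) by (auto simp: lat_upd_def algebra_simps)
  then show ?case
    using ipoly.const[of "if k = i then - of_int (wt w j) else if k = j then 1 else 0 :: complex"]
    by (intro bexI[of _ "\<lambda>_. if k = i then - of_int (wt w j) else if k = j then 1 else 0 :: complex"]) simp_all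
next
  case (add p q)
  then obtain p' q' where "p' \<in> ipoly" "q' \<in> ipoly"
    and "\<forall>\<mu>. p \<mu> - p (lat_upd w i j s \<mu>) = of_int (\<mu> j - s) * p' \<mu>"
      "\<forall>\<mu>. q \<mu> - q (lat_upd w i j s \<mu>) = of_int (\<mu> j - s) * q' \<mu>" by blast
  then show ?case
    by (intro bexI[OF _ ipoly.add[of p' q']] allI) (simp_all only: add_diff_add distrib_left)
next
  case (mult p q)
  then obtain p' q' where p': "p' \<in> ipoly" "\<And>\<mu>. p \<mu> - p (lat_upd w i j s \<mu>) = of_int (\<mu> j - s) * p' \<mu>"
    and q': "q' \<in> ipoly" "\<And>\<mu>. q \<mu> - q (lat_upd w i j s \<mu>) = of_int (\<mu> j - s) * q' \<mu>" by blast
  let ?r = "\<lambda>\<mu>. p' \<mu> * q \<mu> + (p \<mu> + (of_int (\<mu> j) + of_int (- s)) * ((-1) * p' \<mu>)) * q' \<mu>"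
  have "?r \<in> ipoly"
    by (intro ipoly.intros p' q' mult)
  moreover have "p \<mu> * q \<mu> - p (lat_upd w i j s \<mu>) * q (lat_upd w i j s \<mu>) = of_int (\<mu> j - s) * ?r \<mu>" for \<mu>
  proof -
    have e: "p (lat_upd w i j s \<mu>) = p \<mu> - of_int (\<mu> j - s) * p' \<mu>"
      "q (lat_upd w i j s \<mu>) = q \<mu> - of_int (\<mu> j - s) * q' \<mu>"
      using p'(2)[of \<mu>] q'(2)[of \<mu>] by (simp_all add: algebra_simps)
    show ?thesis unfolding e by (simp add: algebra_simps)
  qed
  ultimately show ?case by (intro bexI[of _ ?r] allI)
qed

section \<open>Divisibility by several linear forms\<close>

lemma ex_other:
  fixes j :: "'n::finite option"
  assumes "CARD('n) \<ge> 2"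
  shows "\<exists>i. Some i \<noteq> j"
proof -
  obtain a b :: 'n where "a \<noteq> b"
    using assms card_le_Suc0_iff_eq[of "UNIV :: 'n set"] by fastforce
  then have "\<exists>i. i \<noteq> c" for c :: 'n by metis
  then show ?thesis by (cases j) auto
qed

lemma ex_other2:
  fixes j :: "'n::finite option"
  assumes "CARD('n) \<ge> 2"
  shows "\<exists>i k. Some i \<noteq> j \<and> k \<noteq> j \<and> k \<noteq> Some i"
proof -
  obtain a b :: 'n where "a \<noteq> b"
    using assms card_le_Suc0_iff_eq[of "UNIV :: 'n set"] by fastforce
  then show ?thesis by (cases j) (metis option.distinct(1) option.inject)+
qed

text \<open>A direction that stays in a hyperplane \<open>\<mu> j = s\<close> and eventually leaves
  all hyperplanes belonging to other coordinates.\<close>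

lemma ex_transversal:
  fixes j :: "'n::finite option"
  assumes "CARD('n) \<ge> 2" "w \<noteq> 0"
  shows "\<exists>v. wdeg w v = 0 \<and> v j = 0 \<and> (\<forall>k. k \<noteq> j \<longrightarrow> v k \<noteq> 0)"
proof -
  obtain i k where ik: "Some i \<noteq> j" "k \<noteq> j" "k \<noteq> Some i"
    using ex_other2[OF assms(1)] by blast
  define v0 where "v0 c = (((\<lambda>_. 1)(j := 0))(Some i := 0))(k := c)" for c :: int
  have "wdeg w (v0 2) = wdeg w (v0 1) + wt w k"
    unfolding v0_def by (simp only: wdeg_upd[of w _ k]) (simp add: algebra_simps)
  moreover have "wt w k \<noteq> 0" using assms(2) by (auto simp: wt_def split: option.splits)
  ultimately obtain c where c: "c \<noteq> 0" "wdeg w (v0 c) \<noteq> 0"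
    by (metis add_0 one_neq_zero zero_neq_numeral)
  define v where "v = (v0 c)(Some i := - wdeg w (v0 c))"
  have "wdeg w v = 0" unfolding v_def wdeg_upd using ik by (simp add: v0_def)
  moreover have "v j = 0" "\<forall>k. k \<noteq> j \<longrightarrow> v k \<noteq> 0"
    using ik c by (auto simp: v_def v0_def)
  ultimately show ?thesis by blast
qed

text \<open>The linear forms are divided out one by one. Along a transversal ray inside the next
  hyperplane those already divided out are eventually nonzero, so the quotient vanishes far out on
  the ray and hence at its start.\<close>

lemma ipoly_factor:
  fixes p :: "('n::finite option \<Rightarrow> int) \<Rightarrow> complex"
  assumes n: "CARD('n) \<ge> 2" and w: "w \<noteq> 0" and "finite Z" and p: "p \<in> ipoly"
    and "\<And>j s \<mu>. (j, s) \<in> Z \<Longrightarrow> wdeg w \<mu> = l \<Longrightarrow> \<mu> j = s \<Longrightarrow> p \<mu> = 0"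
  shows "\<exists>q\<in>ipoly. \<forall>\<mu>. wdeg w \<mu> = l \<longrightarrow> p \<mu> = (\<Prod>(j, s)\<in>Z. of_int (\<mu> j - s)) * q \<mu>"
  using assms(3,5)
proof (induction Z rule: finite_induct)
  case empty
  then show ?case using p by auto
next
  case (insert z Z)
  obtain j s where z: "z = (j, s)" by (cases z)
  have "\<exists>q\<in>ipoly. \<forall>\<mu>. wdeg w \<mu> = l \<longrightarrow> p \<mu> = (\<Prod>(j, s)\<in>Z. of_int (\<mu> j - s)) * q \<mu>"
    by (rule insert.IH) (rule insert.prems, rule insertI2)
  then obtain q where q: "q \<in> ipoly"
    "\<And>\<mu>. wdeg w \<mu> = l \<Longrightarrow> p \<mu> = (\<Prod>(j, s)\<in>Z. of_int (\<mu> j - s)) * q \<mu>"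
    by blast
  obtain i where i: "Some i \<noteq> j" using ex_other[OF n] by blast
  obtain q' where q': "q' \<in> ipoly"
    "\<And>\<mu>. q \<mu> - q (lat_upd w (Some i) j s \<mu>) = of_int (\<mu> j - s) * q' \<mu>"
    using ipoly_divide[OF q(1), of j "Some i"] i by blast
  have van: "q \<mu> = 0" if \<mu>: "wdeg w \<mu> = l" "\<mu> j = s" for \<mu>
  proof -
    obtain v where v: "wdeg w v = 0" "v j = 0" "\<And>k. k \<noteq> j \<Longrightarrow> v k \<noteq> 0"
      using ex_transversal[OF n w] by blast
    \<comment> \<open>Beyond \<open>N\<close> the displacement \<open>t * v k\<close> outweighs
      every \<open>\<mu> k - r\<close>. Hyperplanes parallel to the given one are avoided along the
      whole ray.\<close>
    define N where "N = Max (insert 0 ((\<lambda>(k, r). \<bar>\<mu> k - r\<bar> + 1) ` Z))"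
    have N: "\<bar>\<mu> k - r\<bar> < N" if "(k, r) \<in> Z" for k r
    proof -
      have "\<bar>\<mu> k - r\<bar> + 1 \<le> N"
        unfolding N_def using that insert(1) by (intro Max_ge) (auto intro: rev_image_eqI)
      then show ?thesis by simp
    qed
    show ?thesis
    proof (rule ipoly_zero_ray[OF q(1), of N \<mu> v])
      fix t assume t: "N \<le> t"
      let ?\<mu> = "\<lambda>j. \<mu> j + t * v j"
      have d: "wdeg w ?\<mu> = l" by (simp add: wdeg_add wdeg_scale v \<mu>)
      have "p ?\<mu> = 0" using insert.prems[of j s ?\<mu>] d v \<mu> z by simp
      moreover have "?\<mu> k - r \<noteq> 0" if kr: "(k, r) \<in> Z" for k r
      proof (cases "k = j")
        case True
        then have "r \<noteq> s" using kr insert(2) z by auto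
        then show ?thesis using True v \<mu> by simp
      next
        case False
        then have "\<bar>v k\<bar> \<ge> 1" using v(3)[of k] by simp
        moreover have "t \<ge> 0" using t N[OF kr] by linarith
        ultimately have "\<bar>t * v k\<bar> \<ge> t" by (simp add: abs_mult mult_le_cancel_left1)
        then show ?thesis using N[OF kr] t by linarith
      qed
      then have "(\<Prod>(k, r)\<in>Z. of_int (?\<mu> k - r) :: complex) \<noteq> 0"
        using insert(1) by (force simp del: of_int_diff of_int_add of_int_mult)
      ultimately show "q ?\<mu> = 0" using q(2)[OF d] by simp
    qed
  qed
  have "p \<mu> = (\<Prod>(j, s)\<in>insert z Z. of_int (\<mu> j - s)) * q' \<mu>" if \<mu>: "wdeg w \<mu> = l" for \<mu>
  proof -
    have "q (lat_upd w (Some i) j s \<mu>) = 0"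
      using \<mu> i by (intro van) (simp_all add: wdeg_lat_upd, simp add: lat_upd_def)
    then have "q \<mu> = of_int (\<mu> j - s) * q' \<mu>" using q'(2)[of \<mu>] by simp
    then show ?thesis using q(2)[OF \<mu>] insert(1,2) z by (simp add: ac_simps)
  qed
  then show ?case using q'(1) by blast
qed

section \<open>Words in the generators of the Weyl algebra\<close>

text \<open>
  A word acts on functions by multiplication with coordinates and by partial derivatives, the last
  letter first.  It maps \<open>lmon \<mu>\<close> to \<open>word_coeff x \<mu>\<close> times \<open>lmon (\<mu> + word_shift x)\<close>.
\<close>

datatype 'n letter = Mul "'n option" | Der "'n option"

primrec letter_shift :: "'n letter \<Rightarrow> 'n option \<Rightarrow> int" where
  "letter_shift (Mul j) = (\<lambda>_. 0)(j := 1)"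
| "letter_shift (Der j) = (\<lambda>_. 0)(j := - 1)"

primrec word_shift :: "'n letter list \<Rightarrow> 'n option \<Rightarrow> int" where
  "word_shift [] = (\<lambda>_. 0)"
| "word_shift (a # x) = (\<lambda>j. letter_shift a j + word_shift x j)"

primrec letter_coeff :: "'n letter \<Rightarrow> ('n option \<Rightarrow> int) \<Rightarrow> complex" where
  "letter_coeff (Mul j) \<mu> = 1"
| "letter_coeff (Der j) \<mu> = of_int (\<mu> j)"

primrec word_coeff :: "'n letter list \<Rightarrow> ('n option \<Rightarrow> int) \<Rightarrow> complex" where
  "word_coeff [] \<mu> = 1"
| "word_coeff (a # x) \<mu> = letter_coeff a (\<lambda>j. \<mu> j + word_shift x j) * word_coeff x \<mu>"

lemma word_shift_append: "word_shift (x @ y) = (\<lambda>j. word_shift x j + word_shift y j)"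
  by (induction x) (auto simp: fun_eq_iff)

lemma word_coeff_append:
  "word_coeff (x @ y) \<mu> = word_coeff x (\<lambda>j. \<mu> j + word_shift y j) * word_coeff y \<mu>"
  by (induction x) (simp_all add: word_shift_append algebra_simps)

lemma word_coeff_ipoly:
  fixes x :: "'n letter list"
  shows "word_coeff x \<in> ipoly"
proof (induction x)
  case Nil
  have "word_coeff ([] :: 'n letter list) = (\<lambda>\<mu>. 1)" by (rule ext) simp
  then show ?case by (simp only: ipoly.const)
next
  case (Cons a x)
  have "(\<lambda>\<mu>. letter_coeff a (\<lambda>j. \<mu> j + word_shift x j)) \<in> ipoly"
    by (cases a) (auto intro!: ipoly.intros)
  moreover have "word_coeff (a # x) = (\<lambda>\<mu>. letter_coeff a (\<lambda>j. \<mu> j + word_shift x j) * word_coeff x \<mu>)"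
    by (rule ext) simp
  ultimately show ?case using ipoly.mult Cons by metis
qed

section \<open>Formal linear combinations of words\<close>

definition comb_coeff :: "(complex \<times> 'n letter list) list \<Rightarrow> ('n option \<Rightarrow> int) \<Rightarrow> complex" where
  "comb_coeff cs \<mu> = (\<Sum>(c, x)\<leftarrow>cs. c * word_coeff x \<mu>)"

definition comb_mult :: "(complex \<times> 'n letter list) list \<Rightarrow> (complex \<times> 'n letter list) list \<Rightarrow>
    (complex \<times> 'n letter list) list" where
  "comb_mult cs ds = concat (map (\<lambda>(c, x). map (\<lambda>(d, y). (c * d, x @ y)) ds) cs)"

text \<open>The right factor acts first, so the left one is evaluated at exponents already moved by
  the common shift of \<open>ds\<close>.\<close>

lemma comb_coeff_mult:
  assumes "\<And>d y. (d, y) \<in> set ds \<Longrightarrow> word_shift y = \<beta>"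
  shows "comb_coeff (comb_mult cs ds) \<mu> = comb_coeff cs (\<lambda>j. \<mu> j + \<beta> j) * comb_coeff ds \<mu>"
proof -
  have 1: "comb_coeff (map (\<lambda>(d, y). (c * d, x @ y)) ds) \<mu> =
      c * word_coeff x (\<lambda>j. \<mu> j + \<beta> j) * comb_coeff ds \<mu>" for c x
    using assms
  proof (induction ds)
    case (Cons a ds)
    obtain d y where a: "a = (d, y)" by (cases a)
    have "word_shift y = \<beta>" by (rule Cons.prems[of d]) (simp add: a)
    moreover have "comb_coeff (map (\<lambda>(d, y). (c * d, x @ y)) ds) \<mu> =
        c * word_coeff x (\<lambda>j. \<mu> j + \<beta> j) * comb_coeff ds \<mu>"
      by (rule Cons.IH) (use Cons.prems in auto)
    ultimately show ?case
      by (simp add: a comb_coeff_def word_coeff_append algebra_simps)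
  qed (simp add: comb_coeff_def)
  show ?thesis
  proof (induction cs)
    case (Cons a cs)
    obtain c x where a: "a = (c, x)" by (cases a)
    have "comb_coeff (comb_mult (a # cs) ds) \<mu> =
        comb_coeff (map (\<lambda>(d, y). (c * d, x @ y)) ds) \<mu> + comb_coeff (comb_mult cs ds) \<mu>"
      by (simp add: a comb_mult_def comb_coeff_def)
    also have "\<dots> = comb_coeff (a # cs) (\<lambda>j. \<mu> j + \<beta> j) * comb_coeff ds \<mu>"
      unfolding Cons.IH 1 by (simp add: a comb_coeff_def algebra_simps)
    finally show ?case .
  qed (simp add: comb_mult_def comb_coeff_def)
qed

lemma set_comb_mult:
  "(e, z) \<in> set (comb_mult cs ds) \<Longrightarrow> \<exists>c x d y. (c, x) \<in> set cs \<and> (d, y) \<in> set ds \<and> z = x @ y"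
  by (auto simp: comb_mult_def)

text \<open>The Euler operator \<open>Q_j \<partial>_j\<close> has eigenvalue \<open>\<mu> j\<close>
  on monomials, and sums and products of such operators have shift 0.\<close>

lemma ipoly_comb:
  assumes "p \<in> ipoly"
  shows "\<exists>cs. (\<forall>(c, x)\<in>set cs. word_shift x = (\<lambda>_. 0)) \<and> (\<forall>\<mu>. p \<mu> = comb_coeff cs \<mu>)"
  using assms
proof induction
  case (const c)
  then show ?case by (intro exI[of _ "[(c, [])]"]) (simp add: comb_coeff_def)
next
  case (coord j)
  then show ?case
    by (intro exI[of _ "[(1, [Mul j, Der j])]"]) (auto simp: comb_coeff_def fun_eq_iff)
next
  case (add p q)
  then obtain cs ds where "\<forall>(c, x)\<in>set cs. word_shift x = (\<lambda>_. 0)" "\<forall>\<mu>. p \<mu> = comb_coeff cs \<mu>"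
    "\<forall>(c, x)\<in>set ds. word_shift x = (\<lambda>_. 0)" "\<forall>\<mu>. q \<mu> = comb_coeff ds \<mu>" by blast
  then show ?case by (intro exI[of _ "cs @ ds"]) (auto simp: comb_coeff_def)
next
  case (mult p q)
  then obtain cs ds where cs: "\<forall>(c, x)\<in>set cs. word_shift x = (\<lambda>_. 0)" "\<forall>\<mu>. p \<mu> = comb_coeff cs \<mu>"
    and ds: "\<forall>(c, x)\<in>set ds. word_shift x = (\<lambda>_. 0)" "\<forall>\<mu>. q \<mu> = comb_coeff ds \<mu>" by blast
  have "word_shift y = (\<lambda>_. 0)" if "(d, y) \<in> set ds" for d y
    using ds(1) that by auto
  from comb_coeff_mult[OF this]
  have "p \<mu> * q \<mu> = comb_coeff (comb_mult cs ds) \<mu>" for \<mu>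
    using cs(2) ds(2) by simp
  moreover have "\<forall>(c, x)\<in>set (comb_mult cs ds). word_shift x = (\<lambda>_. 0)"
    using cs(1) ds(1) by (fastforce dest: set_comb_mult simp: word_shift_append)
  ultimately show ?case by blast
qed

text \<open>The shortest word of shift \<open>\<beta>\<close>: a power of \<open>Q_j\<close> or of
  \<open>\<partial>_j\<close> in each coordinate. Its coefficient is a product of falling
  factorials, with exactly the zeros that the charts force.\<close>

definition monomial_word :: "('n option \<Rightarrow> int) \<Rightarrow> 'n option list \<Rightarrow> 'n letter list" where
  "monomial_word \<beta> js = concat (map (\<lambda>j. replicate (nat (\<beta> j)) (Mul j) @ replicate (nat (- \<beta> j)) (Der j)) js)"

lemma replicate_Mul: "word_shift (replicate m (Mul j)) = (\<lambda>_. 0)(j := int m)"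
    "word_coeff (replicate m (Mul j)) \<mu> = 1"
  by (induction m) (auto simp: fun_eq_iff)

lemma replicate_Der: "word_shift (replicate m (Der j)) = (\<lambda>_. 0)(j := - int m)"
    "word_coeff (replicate m (Der j)) \<mu> = (\<Prod>s<m. of_int (\<mu> j - int s))"
  by (induction m) (auto simp: fun_eq_iff)

lemma monomial_word_shift:
  "distinct js \<Longrightarrow> word_shift (monomial_word \<beta> js) k = (if k \<in> set js then \<beta> k else 0)"
  by (induction js) (auto simp: monomial_word_def word_shift_append replicate_Mul replicate_Der)

lemma monomial_word_coeff:
  "distinct js \<Longrightarrow>
    word_coeff (monomial_word \<beta> js) \<mu> = (\<Prod>j\<in>set js. \<Prod>s<nat (- \<beta> j). of_int (\<mu> j - int s))"
proof (induction js)
  case (Cons j js)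
  have "monomial_word \<beta> (j # js) =
      replicate (nat (\<beta> j)) (Mul j) @ replicate (nat (- \<beta> j)) (Der j) @ monomial_word \<beta> js"
    by (simp add: monomial_word_def)
  then show ?case
    using Cons by (simp add: word_coeff_append replicate_Mul replicate_Der monomial_word_shift)
qed (simp add: monomial_word_def)

text \<open>The hypothesis \<open>chart\<close> expresses that an operator defined over
  \<open>Q_i \<noteq> 0\<close> creates no pole along another coordinate. It speaks of exponents
  nonnegative off \<open>i\<close> only, but rays extend the zeros to the full hyperplanes
  \<open>\<mu> j = s\<close> with \<open>0 \<le> s < - \<beta> j\<close>. Their product is the
  coefficient of \<open>monomial_word\<close>, and Euler operators realize the cofactor.\<close>

lemma dvanish_comb:
  fixes f :: "('n::finite option \<Rightarrow> int) \<Rightarrow> complex"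
  assumes n: "CARD('n) \<ge> 2" and w: "w \<noteq> 0" and f: "dvanish w l n f" and \<beta>: "wdeg w \<beta> = 0"
    and chart: "\<And>i j \<mu>. wdeg w \<mu> = l \<Longrightarrow> (\<And>k. k \<noteq> Some i \<Longrightarrow> 0 \<le> \<mu> k) \<Longrightarrow>
      j \<noteq> Some i \<Longrightarrow> \<mu> j + \<beta> j < 0 \<Longrightarrow> f \<mu> = 0"
  shows "\<exists>cs. (\<forall>(c, x)\<in>set cs. word_shift x = \<beta>) \<and> (\<forall>\<mu>. wdeg w \<mu> = l \<longrightarrow> f \<mu> = comb_coeff cs \<mu>)"
proof -
  obtain I :: "int list set" and H e where I: "\<And>x. x \<in> I \<Longrightarrow> H x \<in> ipoly"
    "\<And>f \<mu> :: 'n option \<Rightarrow> int. dvanish w l n f \<Longrightarrow> wdeg w \<mu> = l \<Longrightarrow> f \<mu> = (\<Sum>x\<in>I. H x \<mu> * f (e x))"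
    using dvanish_interpolation[of w l n] by metis
  define p where "p \<mu> = (\<Sum>x\<in>I. H x \<mu> * f (e x))" for \<mu>
  have p: "p \<in> ipoly"
    unfolding p_def by (intro ipoly_sum ipoly.intros I)
  have fp: "f \<mu> = p \<mu>" if "wdeg w \<mu> = l" for \<mu>
    using I(2)[OF f that] by (simp add: p_def)
  define Z where "Z = (SIGMA j:UNIV. int ` {..<nat (- \<beta> j)})"
  have "finite Z" unfolding Z_def by simp
  moreover have "p \<mu> = 0" if js: "(j, s) \<in> Z" and \<mu>: "wdeg w \<mu> = l" "\<mu> j = s" for j s \<mu>
  proof -
    have s: "0 \<le> s" "s + \<beta> j < 0" using js by (auto simp: Z_def)
    obtain i where i: "Some i \<noteq> j" using ex_other[OF n] by blast
    \<comment> \<open>A direction of weight 0 that keeps \<open>\<mu> j\<close>, raises all other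
      exponents off \<open>i\<close>, and lets the one at \<open>i\<close> absorb the weight: the
      ray ends in the region where \<open>chart\<close> applies.\<close>
    define v0 where "v0 = (((\<lambda>_. 1)(j := 0))(Some i := 0) :: 'n option \<Rightarrow> int)"
    define v where "v = v0(Some i := - wdeg w v0)"
    have v: "wdeg w v = 0" "v j = 0" "\<And>k. k \<noteq> j \<Longrightarrow> k \<noteq> Some i \<Longrightarrow> v k = 1"
      using i by (simp_all add: v_def wdeg_upd) (simp_all add: v0_def)
    define N where "N = Max (range (\<lambda>k. \<bar>\<mu> k\<bar>))"
    have N: "\<bar>\<mu> k\<bar> \<le> N" for k
      unfolding N_def by (intro Max_ge) auto
    show ?thesis
    proof (rule ipoly_zero_ray[OF p, of N \<mu> v])
      fix t assume t: "N \<le> t"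
      let ?\<mu> = "\<lambda>j. \<mu> j + t * v j"
      have d: "wdeg w ?\<mu> = l" by (simp add: wdeg_add wdeg_scale v \<mu>)
      have "f ?\<mu> = 0"
      proof (rule chart[OF d, of i j])
        fix k assume k: "k \<noteq> Some i"
        show "0 \<le> ?\<mu> k"
        proof (cases "k = j")
          case False
          then show ?thesis using v(3)[OF False k] N[of k] t by simp
        qed (use v \<mu> s in simp)
      qed (use i v \<mu> s in auto)
      then show "p ?\<mu> = 0" using fp[OF d] by simp
    qed
  qed
  ultimately obtain q where q: "q \<in> ipoly"
    "\<And>\<mu>. wdeg w \<mu> = l \<Longrightarrow> p \<mu> = (\<Prod>(j, s)\<in>Z. of_int (\<mu> j - s)) * q \<mu>"
    using ipoly_factor[OF n w _ p, of Z l] by blast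
  obtain cs where cs: "\<And>c x. (c, x) \<in> set cs \<Longrightarrow> word_shift x = (\<lambda>_. 0)" "\<And>\<mu>. q \<mu> = comb_coeff cs \<mu>"
    using ipoly_comb[OF q(1)] by blast
  obtain js where js: "set js = (UNIV :: 'n option set)" "distinct js"
    using finite_distinct_list[of "UNIV :: 'n option set"] by auto
  define ds where "ds = comb_mult [(1, monomial_word \<beta> js)] cs"
  have shift: "word_shift (monomial_word \<beta> js) = \<beta>"
    using monomial_word_shift[OF js(2)] js(1) by (auto simp: fun_eq_iff)
  have "word_shift z = \<beta>" if az: "(a, z) \<in> set ds" for a z
  proof -
    obtain d y where "(d, y) \<in> set cs" "z = monomial_word \<beta> js @ y"
      using set_comb_mult[OF az[unfolded ds_def]] by auto
    then show ?thesis using shift cs(1)[of d y] by (simp add: word_shift_append)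
  qed
  moreover have "f \<mu> = comb_coeff ds \<mu>" if \<mu>: "wdeg w \<mu> = l" for \<mu>
  proof -
    have "(\<Prod>(j, s)\<in>Z. of_int (\<mu> j - s) :: complex) =
        (\<Prod>j\<in>UNIV. \<Prod>s\<in>int ` {..<nat (- \<beta> j)}. of_int (\<mu> j - s))"
      unfolding Z_def by (subst prod.Sigma) auto
    also have "\<dots> = word_coeff (monomial_word \<beta> js) \<mu>"
      unfolding monomial_word_coeff[OF js(2)] js(1) by (subst prod.reindex) (auto simp: inj_on_def)
    finally show ?thesis
      using fp[OF \<mu>] q(2)[OF \<mu>] cs comb_coeff_mult[of cs "\<lambda>_. 0" "[(1, monomial_word \<beta> js)]" \<mu>]
      by (simp add: ds_def comb_coeff_def)
  qed
  ultimately show ?thesis by blast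
qed

lemma dvanish_cong:
  "(\<And>\<mu>. wdeg w \<mu> = l \<Longrightarrow> f \<mu> = g \<mu>) \<Longrightarrow> dvanish w l n f \<longleftrightarrow> dvanish w l n g"
proof (induction n arbitrary: f g)
  case (Suc n)
  have "dvanish w l n (\<lambda>\<mu>. f (\<lambda>j. \<mu> j + \<gamma> j) - f \<mu>) \<longleftrightarrow>
      dvanish w l n (\<lambda>\<mu>. g (\<lambda>j. \<mu> j + \<gamma> j) - g \<mu>)" if "wdeg w \<gamma> = 0" for \<gamma>
    by (rule Suc.IH) (simp add: Suc.prems wdeg_add that)
  then show ?case by simp
qed simp

section \<open>Coefficients of Laurent polynomials\<close>

definition is_lc :: "('n::finite point \<Rightarrow> complex) \<Rightarrow> (('n option \<Rightarrow> int) \<Rightarrow> complex) \<Rightarrow> bool" where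
  "is_lc f C \<longleftrightarrow> finite {\<nu>. C \<nu> \<noteq> 0} \<and>
     (\<forall>Q\<in>chart_dom UNIV. f Q = (\<Sum>\<nu> | C \<nu> \<noteq> 0. C \<nu> * lmon \<nu> Q))"

definition lc :: "('n::finite point \<Rightarrow> complex) \<Rightarrow> ('n option \<Rightarrow> int) \<Rightarrow> complex" where
  "lc f = (THE C. is_lc f C)"

lemma is_lc_finite_support: "is_lc f C \<Longrightarrow> finite {\<nu>. C \<nu> \<noteq> 0}"
  by (simp add: is_lc_def)

lemma is_lc_eval:
  "is_lc f C \<Longrightarrow> Q \<in> chart_dom UNIV \<Longrightarrow> f Q = (\<Sum>\<nu> | C \<nu> \<noteq> 0. C \<nu> * lmon \<nu> Q)"
  unfolding is_lc_def by blast

lemma is_lc_eval_superset: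
  assumes "is_lc f C" "Q \<in> chart_dom UNIV" "finite S" "{\<nu>. C \<nu> \<noteq> 0} \<subseteq> S"
  shows "f Q = (\<Sum>\<nu>\<in>S. C \<nu> * lmon \<nu> Q)"
  unfolding is_lc_eval[OF assms(1,2)] using assms(3,4) by (intro sum.mono_neutral_left) auto

lemma is_lcI:
  assumes S: "finite S" "\<And>\<nu>. \<nu> \<notin> S \<Longrightarrow> C \<nu> = 0"
    and f: "\<And>Q. Q \<in> chart_dom UNIV \<Longrightarrow> f Q = (\<Sum>\<nu>\<in>S. C \<nu> * lmon \<nu> Q)"
  shows "is_lc f C"
  unfolding is_lc_def
proof (intro conjI ballI)
  have "{\<nu>. C \<nu> \<noteq> 0} \<subseteq> S" using S(2) by blast
  then show "finite {\<nu>. C \<nu> \<noteq> 0}" using S(1) finite_subset by blast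
  fix Q :: "'a point" assume "Q \<in> chart_dom UNIV"
  from f[OF this] show "f Q = (\<Sum>\<nu> | C \<nu> \<noteq> 0. C \<nu> * lmon \<nu> Q)"
    using S by (simp, intro sum.mono_neutral_right) auto
qed

lemma is_lc_unique:
  assumes C: "is_lc f C" and D: "is_lc f D"
  shows "C = D"
proof
  fix \<nu>
  let ?S = "{\<nu>. C \<nu> \<noteq> 0} \<union> {\<nu>. D \<nu> \<noteq> 0}"
  have fin: "finite ?S" using C D by (intro finite_UnI is_lc_finite_support)
  have all: "\<forall>\<nu>\<in>?S. C \<nu> - D \<nu> = 0"
  proof (rule lmon_independent[OF fin])
    fix Q :: "'a point" assume Q: "Q \<in> chart_dom UNIV"
    show "(\<Sum>\<nu>\<in>?S. (C \<nu> - D \<nu>) * lmon \<nu> Q) = 0"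
      using is_lc_eval_superset[OF C Q fin] is_lc_eval_superset[OF D Q fin]
      by (simp add: left_diff_distrib sum_subtractf)
  qed
  show "C \<nu> = D \<nu>"
  proof (cases "\<nu> \<in> ?S")
    case True
    with all have "C \<nu> - D \<nu> = 0" by (rule bspec)
    then show ?thesis by simp
  qed simp
qed

lemma is_lc_lc: "is_lc f C \<Longrightarrow> lc f = C"
  unfolding lc_def using is_lc_unique by blast

lemma is_lc_cong: "is_lc f C \<Longrightarrow> (\<And>Q. Q \<in> chart_dom UNIV \<Longrightarrow> g Q = f Q) \<Longrightarrow> is_lc g C"
  unfolding is_lc_def by simp

lemma is_lc_lcomb:
  assumes C: "is_lc f C" and D: "is_lc g D"
  shows "is_lc (\<lambda>Q. a * f Q + b * g Q) (\<lambda>\<nu>. a * C \<nu> + b * D \<nu>)"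
proof -
  let ?S = "{\<nu>. C \<nu> \<noteq> 0} \<union> {\<nu>. D \<nu> \<noteq> 0}"
  have fin: "finite ?S" using C D by (intro finite_UnI is_lc_finite_support)
  show ?thesis
  proof (rule is_lcI[OF fin])
    fix Q :: "'a point" assume Q: "Q \<in> chart_dom UNIV"
    show "a * f Q + b * g Q = (\<Sum>\<nu>\<in>?S. (a * C \<nu> + b * D \<nu>) * lmon \<nu> Q)"
      using is_lc_eval_superset[OF C Q fin] is_lc_eval_superset[OF D Q fin]
      by (simp add: distrib_right sum.distrib sum_distrib_left mult.assoc)
  qed auto
qed

lemma is_lc_zero: "is_lc (\<lambda>Q. 0) (\<lambda>\<nu>. 0)"
  by (rule is_lcI[of "{}"]) auto

lemma is_lc_mon: "is_lc (lmon \<mu>) (\<lambda>\<nu>. if \<nu> = \<mu> then 1 else 0)"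
  by (rule is_lcI[of "{\<mu>}"]) auto

lemma is_lc_mon_mult:
  assumes C: "is_lc f C"
  shows "is_lc (\<lambda>Q. lmon \<gamma> Q * f Q) (\<lambda>\<nu>. C (\<lambda>j. \<nu> j - \<gamma> j))"
proof -
  let ?S = "{\<nu>. C \<nu> \<noteq> 0}" and ?t = "\<lambda>\<nu> j. \<nu> j + \<gamma> j"
  show ?thesis
  proof (rule is_lcI[of "?t ` ?S"])
    show "finite (?t ` ?S)" using is_lc_finite_support[OF C] by simp
    fix \<nu> assume "\<nu> \<notin> ?t ` ?S"
    then show "C (\<lambda>j. \<nu> j - \<gamma> j) = 0"
      using imageI[of "\<lambda>j. \<nu> j - \<gamma> j" ?S ?t] by auto
  next
    fix Q :: "'a point" assume Q: "Q \<in> chart_dom UNIV"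
    have "lmon \<gamma> Q * f Q = (\<Sum>\<nu>\<in>?S. C \<nu> * lmon (?t \<nu>) Q)"
      using Q by (simp add: is_lc_eval[OF C Q] sum_distrib_left mon_add chart_dom_def ac_simps)
    also have "\<dots> = (\<Sum>\<nu>\<in>?t ` ?S. C (\<lambda>j. \<nu> j - \<gamma> j) * lmon \<nu> Q)"
      by (subst sum.reindex) (auto simp: inj_on_def fun_eq_iff)
    finally show "lmon \<gamma> Q * f Q = (\<Sum>\<nu>\<in>?t ` ?S. C (\<lambda>j. \<nu> j - \<gamma> j) * lmon \<nu> Q)" .
  qed
qed

lemma laurent_is_lc:
  assumes "laurent E f"
  shows "\<exists>C. is_lc f C \<and> (\<forall>\<nu> j. C \<nu> \<noteq> 0 \<longrightarrow> j \<notin> E \<longrightarrow> 0 \<le> \<nu> j)"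
proof -
  obtain S c where S: "finite S" "\<forall>\<nu>\<in>S. \<forall>j. j \<notin> E \<longrightarrow> 0 \<le> \<nu> j"
    "\<forall>Q\<in>chart_dom E. f Q = (\<Sum>\<nu>\<in>S. c \<nu> * lmon \<nu> Q)"
    using laurentE[OF assms] .
  have "is_lc f (\<lambda>\<nu>. if \<nu> \<in> S then c \<nu> else 0)"
  proof (rule is_lcI[OF S(1)])
    fix Q :: "'a point" assume "Q \<in> chart_dom UNIV"
    then have "Q \<in> chart_dom E" by (simp add: chart_dom_def)
    then show "f Q = (\<Sum>\<nu>\<in>S. (if \<nu> \<in> S then c \<nu> else 0) * lmon \<nu> Q)"
      using S(3) by simp
  qed simp
  then show ?thesis using S(2) by (intro exI[of _ "\<lambda>\<nu>. if \<nu> \<in> S then c \<nu> else 0"]) auto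
qed

lemma is_lc_eq: "is_lc f C \<Longrightarrow> is_lc g C \<Longrightarrow> Q \<in> chart_dom UNIV \<Longrightarrow> f Q = g Q"
  by (simp add: is_lc_eval)

definition comb_part :: "('n option \<Rightarrow> int) \<Rightarrow> (complex \<times> 'n letter list) list \<Rightarrow> (complex \<times> 'n letter list) list"
  where "comb_part \<beta> cs = filter (\<lambda>(c, x). word_shift x = \<beta>) cs"

lemma comb_part_concat:
  assumes "distinct bs" "\<And>b c x. b \<in> set bs \<Longrightarrow> (c, x) \<in> set (g b) \<Longrightarrow> word_shift x = b"
  shows "comb_part \<beta> (concat (map g bs)) = (if \<beta> \<in> set bs then g \<beta> else [])"
  using assms
proof (induction bs)
  case (Cons b bs)
  have "comb_part \<beta> (g b) = (if \<beta> = b then g b else [])"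
    using Cons.prems(2)[of b] unfolding comb_part_def
    by (auto simp: filter_id_conv filter_empty_conv)
  moreover have "comb_part \<beta> (concat (map g bs)) = (if \<beta> \<in> set bs then g \<beta> else [])"
    using Cons by (intro Cons.IH) auto
  ultimately show ?case
    using Cons.prems(1) by (auto simp: comb_part_def)
qed (simp add: comb_part_def)

section \<open>Differential operators given by words\<close>

primrec letter_op :: "'n::finite letter \<Rightarrow> ('n point \<Rightarrow> complex) \<Rightarrow> 'n point \<Rightarrow> complex" where
  "letter_op (Mul j) f = (\<lambda>Q. crd Q j * f Q)"
| "letter_op (Der j) f = pder j f"

lemma wdeg_single [simp]: "wdeg w ((\<lambda>_. 0)(j := c)) = wt w j * c"
  by (simp add: wdeg_upd wdeg_zero)

context cone_quotient
begin

definition letter_hom :: "'n letter \<Rightarrow> int \<Rightarrow> 'n point sheaf_map" where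
  "letter_hom a l = (\<lambda>W f. if openin T W \<and> f \<in> Sh l W then restr W (letter_op a f) else (\<lambda>Q. 0))"

text \<open>Each letter needs the degree of the section it acts on, which is \<open>l\<close> plus
  the weight accumulated by the letters to its right.\<close>

primrec word_hom :: "'n letter list \<Rightarrow> int \<Rightarrow> 'n point sheaf_map" where
  "word_hom [] l = (\<lambda>W f. if openin T W \<and> f \<in> Sh l W then f else (\<lambda>Q. 0))"
| "word_hom (a # x) l = (\<lambda>W f. letter_hom a (l + wdeg w (word_shift x)) W (word_hom x l W f))"

definition comb_hom :: "int \<Rightarrow> (complex \<times> 'n letter list) list \<Rightarrow> 'n point sheaf_map" where
  "comb_hom l cs = (\<lambda>W f Q. \<Sum>(c, x)\<leftarrow>cs. c * word_hom x l W f Q)"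

definition homog_comb :: "(complex \<times> 'n letter list) list \<Rightarrow> bool" where
  "homog_comb cs \<longleftrightarrow> (\<forall>(c, x)\<in>set cs. wdeg w (word_shift x) = 0)"

lemma Sh_Mul:
  assumes "openin T W" "f \<in> Sh l W"
  shows "restr W (\<lambda>Q. crd Q j * f Q) \<in> Sh (l + wt w j) W"
proof -
  have "restr W (\<lambda>Q. crd Q j * f Q) = (\<lambda>Q. restr W (\<lambda>Q. crd Q j) Q * f Q)"
    by (auto simp: restr_def)
  then show ?thesis
    using Sh_mult[OF assms(1) Sh_hpoly[OF assms(1) hpoly_crd] assms(1) subset_refl assms(2)]
    by (simp add: add.commute)
qed

lemma Sh_letter:
  assumes "openin T W" "f \<in> Sh l W"
  shows "restr W (letter_op a f) \<in> Sh (l + wdeg w (letter_shift a)) W"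
  using Sh_Mul[OF assms] Sh_pder[OF assms] by (cases a) simp_all

lemma letter_hom_mem: "openin T W \<Longrightarrow> letter_hom a l W f \<in> Sh (l + wdeg w (letter_shift a)) W"
  unfolding letter_hom_def using Sh_letter Sh_zero by simp

text \<open>Order 0 is index \<open>Suc 0\<close>. Besides multiplications this covers the identity
  and the commutators of a derivative.\<close>

lemma mult_hom_diff:
  assumes V: "openin T V" and g: "g \<in> Sh k V"
  shows "(\<lambda>W f. if openin T W \<and> W \<subseteq> V \<and> f \<in> Sh l W then (\<lambda>Q. g Q * f Q) else (\<lambda>Q. 0))
    \<in> diff_homs T (Sh 0) (Sh l) (Sh (l + k)) (Suc 0) V" (is "?P \<in> _")
proof -
  have "?P \<in> sheaf_homs T (Sh l) (Sh (l + k)) V"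
  proof (rule sheaf_homsI)
    fix W f assume W: "openin T W" "W \<subseteq> V" "f \<in> Sh l W"
    show "?P W f \<in> Sh (l + k) W"
      using W Sh_mult[OF V g W] by (simp add: add.commute)
    show "?P W (\<lambda>p. f p + h p) = (\<lambda>p. ?P W f p + ?P W h p)" if "h \<in> Sh l W" for h
      using W that Sh_add[OF W(1,3) that] by (simp add: distrib_left)
    show "?P W (\<lambda>p. c * f p) = (\<lambda>p. c * ?P W f p)" for c
      using W Sh_scale[OF W(1,3)] by (simp add: mult.left_commute)
    show "?P X (restr X f) = restr X (?P W f)" if X: "openin T X" "X \<subseteq> W" for X
      using W X Sh_restr[OF W(1) X W(3)] subset_trans[OF X(2) W(2)] by (simp add: restr_mult)
  qed auto
  moreover have "commutator T (Sh l) U ?P a = (\<lambda>W f p. 0)" if U: "openin T U" "U \<subseteq> V" "a \<in> Sh 0 U" for U a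
  proof (intro ext)
    fix W f p
    show "commutator T (Sh l) U ?P a W f p = 0"
    proof (cases "openin T W \<and> W \<subseteq> U \<and> f \<in> Sh l W")
      case True
      then have "(\<lambda>q. a q * f q) \<in> Sh l W" "W \<subseteq> V"
        using Sh_mult[OF U(1,3), of W f l] U(2) by auto
      then show ?thesis using True by (simp add: commutator_def)
    qed (auto simp: commutator_def)
  qed
  ultimately show ?thesis by simp
qed

lemma letter_hom_sheaf_homs:
  "letter_hom a l \<in> sheaf_homs T (Sh l) (Sh (l + wdeg w (letter_shift a))) (topspace T)"
proof (rule sheaf_homsI)
  fix W f assume W: "openin T W" "f \<in> Sh l W"
  show "letter_hom a l W f \<in> Sh (l + wdeg w (letter_shift a)) W"
    using letter_hom_mem[OF W(1)] .
  show "letter_hom a l W (\<lambda>p. f p + h p) = (\<lambda>p. letter_hom a l W f p + letter_hom a l W h p)"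
    if h: "h \<in> Sh l W" for h
  proof -
    have "letter_op a (\<lambda>p. f p + h p) Q = letter_op a f Q + letter_op a h Q" if "Q \<in> \<Union>W" for Q
      using has_pder_imp_pder[OF has_pder_add[OF Sh_has_pder(1)[OF W that] Sh_has_pder(1)[OF W(1) h that]]]
      by (cases a) (simp_all add: distrib_left)
    then show ?thesis
      using W h Sh_add[OF W h] by (auto simp: letter_hom_def restr_def)
  qed
  show "letter_hom a l W (\<lambda>p. c * f p) = (\<lambda>p. c * letter_hom a l W f p)" for c
  proof -
    have "letter_op a (\<lambda>p. c * f p) Q = c * letter_op a f Q" if "Q \<in> \<Union>W" for Q
      using has_pder_imp_pder[OF has_pder_scale[OF Sh_has_pder(1)[OF W that]]]
      by (cases a) simp_all
    then show ?thesis
      using W Sh_scale[OF W] by (auto simp: letter_hom_def restr_def)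
  qed
  show "letter_hom a l X (restr X f) = restr X (letter_hom a l W f)" if X: "openin T X" "X \<subseteq> W" for X
  proof -
    have "restr X (letter_op a (restr X f)) = restr X (letter_op a f)"
      using restr_pder_restr[OF X(1)] by (cases a) (auto simp: restr_def)
    then show ?thesis
      using W X Sh_restr[OF W(1) X W(2)] by (simp add: letter_hom_def restr_restr)
  qed
next
  fix W f assume "\<not> (openin T W \<and> W \<subseteq> topspace T \<and> f \<in> Sh l W)"
  then show "letter_hom a l W f = (\<lambda>p. 0)"
    using openin_subset[of T W] by (auto simp: letter_hom_def)
qed

text \<open>Index 2 is order at most 1: coordinates commute with functions, and by the Leibniz rule
  \<open>[\<partial>_j, b]\<close> is multiplication by \<open>\<partial>_j b\<close>.\<close>

lemma letter_hom_diff: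
  "letter_hom a l \<in> diff_homs T (Sh 0) (Sh l) (Sh (l + wdeg w (letter_shift a))) 2 (topspace T)"
proof -
  have "commutator T (Sh l) V (letter_hom a l) b
      \<in> diff_homs T (Sh 0) (Sh l) (Sh (l + wdeg w (letter_shift a))) (Suc 0) V"
    if V: "openin T V" "b \<in> Sh 0 V" for V b
  proof (cases a)
    case (Mul j)
    have "commutator T (Sh l) V (letter_hom a l) b = (\<lambda>W f p. 0)"
    proof (intro ext)
      fix W f p
      show "commutator T (Sh l) V (letter_hom a l) b W f p = 0"
      proof (cases "openin T W \<and> W \<subseteq> V \<and> f \<in> Sh l W")
        case True
        then have "(\<lambda>q. b q * f q) \<in> Sh l W"
          using Sh_mult[OF V, of W f l] by auto
        then show ?thesis using True by (simp add: commutator_def letter_hom_def Mul restr_def)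
      qed (auto simp: commutator_def)
    qed
    then show ?thesis
      using zero_diff_homs[OF module_sheaf_Sh, where k = "Suc 0"] by (simp only:)
  next
    case (Der j)
    have "commutator T (Sh l) V (letter_hom a l) b =
        (\<lambda>W f. if openin T W \<and> W \<subseteq> V \<and> f \<in> Sh l W then (\<lambda>Q. restr V (pder j b) Q * f Q) else (\<lambda>Q. 0))"
    proof (intro ext)
      fix W f Q
      show "commutator T (Sh l) V (letter_hom a l) b W f Q =
        (if openin T W \<and> W \<subseteq> V \<and> f \<in> Sh l W then (\<lambda>Q. restr V (pder j b) Q * f Q) else (\<lambda>Q. 0)) Q"
      proof (cases "openin T W \<and> W \<subseteq> V \<and> f \<in> Sh l W")
        case True
        then have bf: "(\<lambda>q. b q * f q) \<in> Sh l W"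
          using Sh_mult[OF V, of W f l] by auto
        show ?thesis
        proof (cases "Q \<in> \<Union>W")
          case Q: True
          then have "Q \<in> \<Union>V" using True by blast
          then have "pder j (\<lambda>q. b q * f q) Q = b Q * pder j f Q + pder j b Q * f Q"
            using Sh_has_pder(1)[OF V] Sh_has_pder(1)[of W f l Q] True Q
            by (intro has_pder_imp_pder has_pder_mult) auto
          then show ?thesis
            using True Q bf \<open>Q \<in> \<Union>V\<close> by (simp add: commutator_def letter_hom_def Der restr_def del: Union_iff)
        next
          case False
          then show ?thesis
            using True bf Sh_outside[of f l W Q]
            by (simp add: commutator_def letter_hom_def restr_def del: Union_iff)
        qed
      qed (auto simp: commutator_def)
    qed
    then show ?thesis
      using mult_hom_diff[OF V(1) Sh_pder[OF V], of l j] by (simp add: Der)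
  qed
  then show ?thesis
    using letter_hom_sheaf_homs by (simp add: numeral_2_eq_2 del: diff_homs.simps(2) add: diff_homs.simps(2)[of _ _ _ _ "Suc 0"])
qed

lemma id_hom_diff: "word_hom [] l \<in> diff_homs T (Sh 0) (Sh l) (Sh l) (Suc 0) (topspace T)"
proof -
  let ?one = "restr (topspace T) (\<lambda>Q. 1)"
  have one: "?one \<in> Sh 0 (topspace T)"
    by (rule Sh_hpoly[OF _ hpoly_const]) simp
  have "word_hom [] l = (\<lambda>W f. if openin T W \<and> W \<subseteq> topspace T \<and> f \<in> Sh l W
      then (\<lambda>Q. ?one Q * f Q) else (\<lambda>Q. 0))"
  proof (intro ext)
    fix W f Q
    have "?one Q * f Q = f Q" if W: "openin T W" "f \<in> Sh l W"
    proof (cases "Q \<in> \<Union>W")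
      case True
      then have "Q \<in> \<Union>(topspace T)" using openin_subset[OF W(1)] by blast
      then show ?thesis by (simp add: restr_def)
    qed (use Sh_outside[OF W(2)] in simp)
    then show "word_hom [] l W f Q = (if openin T W \<and> W \<subseteq> topspace T \<and> f \<in> Sh l W
        then (\<lambda>Q. ?one Q * f Q) else (\<lambda>Q. 0)) Q"
      using openin_subset[of T W] by auto
  qed
  then show ?thesis
    using mult_hom_diff[OF _ one, of l] by simp
qed

text \<open>Each letter contributes the index 2, the empty word the index 1 of the identity.\<close>

lemma word_hom_diff:
  "word_hom x l \<in> diff_homs T (Sh 0) (Sh l) (Sh (l + wdeg w (word_shift x))) (2 * length x + 1) (topspace T)"
proof (induction x)
  case Nil
  then show ?case using id_hom_diff by (simp add: wdeg_zero)
next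
  case (Cons a x)
  have "(\<lambda>W f. letter_hom a (l + wdeg w (word_shift x)) W (word_hom x l W f)) \<in>
      diff_homs T (Sh 0) (Sh l) (Sh (l + wdeg w (word_shift x) + wdeg w (letter_shift a)))
        (2 + (2 * length x + 1)) (topspace T)"
    by (rule diff_homs_comp[OF module_sheaf_Sh module_sheaf_Sh module_sheaf_Sh letter_hom_diff Cons])
  then show ?case
    by (simp add: wdeg_add algebra_simps del: diff_homs.simps)
qed

lemma word_hom_mem: "openin T W \<Longrightarrow> word_hom x l W f \<in> Sh (l + wdeg w (word_shift x)) W"
proof (cases x)
  case Nil
  assume "openin T W"
  then show ?thesis using Sh_zero by (simp add: Nil wdeg_zero)
next
  case (Cons a y)
  assume "openin T W"
  from letter_hom_mem[OF this, of a "l + wdeg w (word_shift y)"] show ?thesis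
    by (simp add: Cons wdeg_add algebra_simps)
qed

lemma word_hom_not_open: "\<not> openin T W \<Longrightarrow> word_hom x l W f = (\<lambda>Q. 0)"
  by (cases x) (auto simp: letter_hom_def)

lemma word_hom_append:
  "word_hom (x @ y) l W f = word_hom x (l + wdeg w (word_shift y)) W (word_hom y l W f)"
proof (induction x)
  case Nil
  then show ?case using word_hom_mem word_hom_not_open by auto
next
  case (Cons a x)
  then show ?case by (simp add: word_shift_append wdeg_add algebra_simps)
qed

section \<open>The action of words on torus monomials\<close>

definition torus :: "'n point set set" where
  "torus = nz (lmon (\<lambda>_. 1))"

lemma openin_torus: "openin T torus"
  unfolding torus_def by (rule openin_nz[OF hpoly_mon]) simp

lemma Union_torus: "\<Union>torus = chart_dom UNIV"
proof -
  have "\<Union>torus = {Q \<in> \<Union>(topspace T). lmon (\<lambda>_. 1) Q \<noteq> 0}"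
    unfolding torus_def by (rule Union_nz[OF hpoly_mon]) simp
  also have "\<dots> = chart_dom UNIV"
    using crd_nonzero_mem unfolding chart_dom_def mon_eq_0_iff by (auto simp del: Union_iff)
  finally show ?thesis .
qed

lemma torus_nonempty: "torus \<noteq> {}"
proof -
  have "pt (\<lambda>_. 1) \<in> \<Union>torus" by (simp only: Union_torus) (simp add: chart_dom_def)
  then show ?thesis by auto
qed

lemma torus_subset: "torus \<subseteq> topspace T"
  using openin_subset[OF openin_torus] .

abbreviation tmon :: "('n option \<Rightarrow> int) \<Rightarrow> 'n point \<Rightarrow> complex" where
  "tmon \<mu> \<equiv> restr torus (lmon \<mu>)"

lemma tmon_mem: "tmon \<mu> \<in> Sh (wdeg w \<mu>) torus"
  by (rule Sh_mon[OF openin_torus]) (simp only: Union_torus, simp add: chart_dom_def)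

lemma letter_op_tmon:
  "restr torus (letter_op a (tmon \<mu>)) = (\<lambda>Q. letter_coeff a \<mu> * tmon (\<lambda>j. \<mu> j + letter_shift a j) Q)"
proof
  fix Q
  show "restr torus (letter_op a (tmon \<mu>)) Q = letter_coeff a \<mu> * tmon (\<lambda>j. \<mu> j + letter_shift a j) Q"
  proof (cases "Q \<in> \<Union>torus")
    case True
    then have nz: "crd Q j \<noteq> 0" for j unfolding Union_torus by (simp add: chart_dom_def)
    show ?thesis
    proof (cases a)
      case (Mul j)
      have "lmon (\<lambda>k. \<mu> k + ((\<lambda>_. 0)(j := 1)) k) Q = lmon \<mu> Q * crd Q j"
        using nz by (subst mon_add) (simp_all only: mon_single, simp)
      then show ?thesis using True by (simp add: Mul restr_def del: Union_iff)
    next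
      case (Der j)
      have "pder j (tmon \<mu>) Q = pder j (lmon \<mu>) Q"
        by (rule pder_cong[OF openin_zariski[OF openin_torus] True]) (simp add: restr_def del: Union_iff)
      also have "\<dots> = of_int (\<mu> j) * lmon (\<mu>(j := \<mu> j - 1)) Q"
        using nz by (intro has_pder_imp_pder has_pder_mon) simp
      also have "\<mu>(j := \<mu> j - 1) = (\<lambda>k. \<mu> k + ((\<lambda>_. 0)(j := - 1)) k)"
        by auto
      finally show ?thesis using True by (simp add: Der restr_def del: Union_iff)
    qed
  next
    case False
    then show ?thesis by (simp only: restr_def if_False mult_zero_right)
  qed
qed

lemma word_hom_tmon:
  assumes "wdeg w \<mu> = l"
  shows "word_hom x l torus (tmon \<mu>) = (\<lambda>Q. word_coeff x \<mu> * tmon (\<lambda>j. \<mu> j + word_shift x j) Q)"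
proof (induction x)
  case Nil
  then show ?case using openin_torus tmon_mem[of \<mu>] assms by simp
next
  case (Cons a x)
  let ?\<mu> = "\<lambda>j. \<mu> j + word_shift x j"
  have mem: "tmon ?\<mu> \<in> Sh (l + wdeg w (word_shift x)) torus"
    using tmon_mem[of ?\<mu>] assms by (simp add: wdeg_add)
  have "word_hom (a # x) l torus (tmon \<mu>) =
      letter_hom a (l + wdeg w (word_shift x)) torus (\<lambda>Q. word_coeff x \<mu> * tmon ?\<mu> Q)"
    by (simp add: Cons)
  also have "\<dots> = (\<lambda>Q. word_coeff x \<mu> * letter_hom a (l + wdeg w (word_shift x)) torus (tmon ?\<mu>) Q)"
    by (rule sheaf_homsD(3)[OF letter_hom_sheaf_homs openin_torus torus_subset mem])
  also have "letter_hom a (l + wdeg w (word_shift x)) torus (tmon ?\<mu>) =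
      (\<lambda>Q. letter_coeff a ?\<mu> * tmon (\<lambda>j. ?\<mu> j + letter_shift a j) Q)"
    using mem openin_torus by (simp add: letter_hom_def letter_op_tmon)
  finally show ?case by (simp add: ac_simps)
qed

section \<open>Operators given by combinations of words\<close>

lemma comb_hom_diff:
  assumes "homog_comb cs"
  shows "\<exists>k. comb_hom l cs \<in> diff_homs T (Sh 0) (Sh l) (Sh l) k (topspace T)"
  using assms
proof (induction cs)
  case Nil
  have "comb_hom l [] = (\<lambda>W f p. 0)" by (simp add: comb_hom_def)
  then show ?case using zero_diff_homs[OF module_sheaf_Sh] by metis
next
  case (Cons a cs)
  obtain c x where a: "a = (c, x)" by (cases a)
  have "wdeg w (word_shift x) = 0" "homog_comb cs"
    using Cons.prems by (auto simp: homog_comb_def a)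
  then obtain k where k: "comb_hom l cs \<in> diff_homs T (Sh 0) (Sh l) (Sh l) k (topspace T)"
    and x: "word_hom x l \<in> diff_homs T (Sh 0) (Sh l) (Sh l) (2 * length x + 1) (topspace T)"
    using Cons.IH word_hom_diff[of x l] by auto
  let ?m = "max k (2 * length x + 1)"
  have "(\<lambda>W f p. c * word_hom x l W f p + comb_hom l cs W f p)
      \<in> diff_homs T (Sh 0) (Sh l) (Sh l) ?m (topspace T)"
    using k x by (intro diff_homs_add diff_homs_scale module_sheaf_Sh)
      (auto intro: diff_homs_mono[OF module_sheaf_Sh, rotated] simp del: diff_homs.simps)
  moreover have "comb_hom l (a # cs) = (\<lambda>W f p. c * word_hom x l W f p + comb_hom l cs W f p)"
    by (simp add: comb_hom_def a)
  ultimately show ?case by metis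
qed

lemma comb_hom_sheaf_homs:
  "homog_comb cs \<Longrightarrow> comb_hom l cs \<in> sheaf_homs T (Sh l) (Sh l) (topspace T)"
  using comb_hom_diff diff_homs_sheaf_homs[OF module_sheaf_Sh] by blast

lemma comb_hom_append: "comb_hom l (cs @ ds) W f Q = comb_hom l cs W f Q + comb_hom l ds W f Q"
  by (simp add: comb_hom_def)

lemma homog_comb_append: "homog_comb (cs @ ds) \<longleftrightarrow> homog_comb cs \<and> homog_comb ds"
  by (auto simp: homog_comb_def)

lemma homog_comb_mult: "homog_comb cs \<Longrightarrow> homog_comb ds \<Longrightarrow> homog_comb (comb_mult cs ds)"
  unfolding homog_comb_def by (fastforce dest: set_comb_mult simp: word_shift_append wdeg_add)

text \<open>Concatenation of words is composition of operators; weight 0 lets both factors work in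
  the same degree \<open>l\<close>.\<close>

lemma comb_hom_mult:
  assumes "homog_comb cs" "homog_comb ds"
  shows "comb_hom l (comb_mult cs ds) W f = comb_hom l cs W (comb_hom l ds W f)"
proof (cases "openin T W")
  case False
  then have "comb_hom l es W g = (\<lambda>Q. 0)" for es g
    by (simp add: comb_hom_def word_hom_not_open case_prod_unfold)
  then show ?thesis by simp
next
  case W: True
  have 1: "comb_hom l (map (\<lambda>(d, y). (c * d, x @ y)) ds) W f Q = c * word_hom x l W (comb_hom l ds W f) Q
      \<and> comb_hom l ds W f \<in> Sh l W"
    if x: "wdeg w (word_shift x) = 0" for c x Q
    using assms(2)
  proof (induction ds)
    case Nil
    have "word_hom x l W (\<lambda>Q. 0) = (\<lambda>Q. 0)"
      using sheaf_homs_zero_section[OF diff_homs_sheaf_homs[OF module_sheaf_Sh word_hom_diff] module_sheaf_Sh] .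
    then show ?case using Sh_zero[OF W] by (simp add: comb_hom_def)
  next
    case (Cons a ds)
    obtain d y where a: "a = (d, y)" by (cases a)
    have y: "wdeg w (word_shift y) = 0" and ds: "homog_comb ds"
      using Cons.prems by (auto simp: homog_comb_def a)
    have mem: "word_hom y l W f \<in> Sh l W" using word_hom_mem[OF W, of y l f] y by simp
    have ds_mem: "comb_hom l ds W f \<in> Sh l W" using Cons.IH[OF ds] by blast
    have e: "comb_hom l (a # ds) W f = (\<lambda>p. d * word_hom y l W f p + comb_hom l ds W f p)"
      by (simp add: comb_hom_def a)
    note h = diff_homs_sheaf_homs[OF module_sheaf_Sh word_hom_diff]
    have "word_hom x l W (\<lambda>p. d * word_hom y l W f p + comb_hom l ds W f p) Q =
        d * word_hom x l W (word_hom y l W f) Q + word_hom x l W (comb_hom l ds W f) Q"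
      using sheaf_homsD(2)[OF h W openin_subset[OF W] Sh_scale[OF W mem] ds_mem, of x d]
        sheaf_homsD(3)[OF h W openin_subset[OF W] mem, of x d] by simp
    moreover have "comb_hom l (map (\<lambda>(d, y). (c * d, x @ y)) (a # ds)) W f Q =
        c * d * word_hom x l W (word_hom y l W f) Q + comb_hom l (map (\<lambda>(d, y). (c * d, x @ y)) ds) W f Q"
      by (simp add: comb_hom_def a word_hom_append y)
    ultimately show ?case
      using Cons.IH[OF ds] Sh_add[OF W Sh_scale[OF W mem] ds_mem] unfolding e
      by (simp add: algebra_simps)
  qed
  show ?thesis
    using assms(1)
  proof (induction cs)
    case Nil
    then show ?case by (simp add: comb_mult_def comb_hom_def)
  next
    case (Cons a cs)
    obtain c x where a: "a = (c, x)" by (cases a)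
    have x: "wdeg w (word_shift x) = 0" and cs: "homog_comb cs"
      using Cons.prems by (auto simp: homog_comb_def a)
    have "comb_mult (a # cs) ds = map (\<lambda>(d, y). (c * d, x @ y)) ds @ comb_mult cs ds"
      by (simp add: comb_mult_def a)
    then have "comb_hom l (comb_mult (a # cs) ds) W f Q =
        c * word_hom x l W (comb_hom l ds W f) Q + comb_hom l cs W (comb_hom l ds W f) Q" for Q
      using 1[OF x, of c Q] Cons.IH[OF cs] by (simp add: comb_hom_append)
    then show ?case by (auto simp: comb_hom_def a)
  qed
qed

end

section \<open>Classification of the global differential operators\<close>

lemma restr_in: "Q \<in> \<Union>U \<Longrightarrow> restr U f Q = f Q"
  by (simp add: restr_def)

context cone_quotient
begin

text \<open>The matrix of \<open>P\<close> with respect to the Laurent monomials: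
  \<open>coeff_fun P \<mu> \<nu>\<close> is the entry from \<open>\<mu>\<close> to
  \<open>\<nu>\<close>.\<close>

definition coeff_fun :: "'n point sheaf_map \<Rightarrow> ('n option \<Rightarrow> int) \<Rightarrow> ('n option \<Rightarrow> int) \<Rightarrow> complex" where
  "coeff_fun P \<mu> = lc (P torus (tmon \<mu>))"

lemma Sh_laurent:
  assumes U: "openin T U" "\<Union>U = chart_dom E" and f: "f \<in> Sh l U"
  shows "laurent E f"
proof (cases "U = {}")
  case True
  then have "chart_dom E = {}" using U(2) by simp
  then show ?thesis by (intro laurent_cong[OF laurent_0]) (simp only: empty_iff)
next
  case False
  obtain d a b Q0 where "a \<in> hpoly w (l + d)" "b \<in> hpoly w d" "Q0 \<in> \<Union>U" "b Q0 \<noteq> 0"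
    "\<And>Q. Q \<in> \<Union>U \<Longrightarrow> f Q * b Q = a Q"
    using Sh_global[OF U(1) f False] by metis
  then show ?thesis
    using Sh_isCont[OF U(1) f] unfolding U(2)
    by (intro regular_on_chart_laurent[of a b Q0]) (auto intro: hpoly_polys)
qed

lemma ex_is_lc: "f \<in> Sh l torus \<Longrightarrow> \<exists>C. is_lc f C"
  using laurent_is_lc[OF Sh_laurent[OF openin_torus Union_torus]] by metis

lemma is_lc_lc': "f \<in> Sh l torus \<Longrightarrow> is_lc f (lc f)"
  using ex_is_lc is_lc_lc by metis

text \<open>The action of \<open>u = 2\<close> suffices: distinct degrees give distinct powers of 2,
  so comparing \<open>f (act w 2 Q)\<close> with \<open>2 powi l * f Q\<close> leaves only monomials
  of degree \<open>l\<close>.\<close>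

lemma lc_degree:
  assumes f: "f \<in> Sh l torus" and "lc f \<nu> \<noteq> 0"
  shows "wdeg w \<nu> = l"
proof -
  define S where "S = {\<nu>. lc f \<nu> \<noteq> 0}"
  have S: "finite S" "\<And>Q. Q \<in> chart_dom UNIV \<Longrightarrow> f Q = (\<Sum>\<nu>\<in>S. lc f \<nu> * lmon \<nu> Q)"
    unfolding S_def using is_lc_finite_support is_lc_eval is_lc_lc'[OF f] by blast+
  have "\<forall>\<nu>\<in>S. lc f \<nu> * (2 powi wdeg w \<nu> - 2 powi l) = 0"
  proof (rule lmon_independent[OF S(1)])
    fix Q :: "'n point" assume Q: "Q \<in> chart_dom UNIV"
    have Q': "act w 2 Q \<in> chart_dom UNIV"
      using act_mem[OF openin_torus _ , of Q 2] Q unfolding Union_torus by simp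
    have "(\<Sum>\<nu>\<in>S. lc f \<nu> * (2 powi wdeg w \<nu> - 2 powi l) * lmon \<nu> Q) =
        (\<Sum>\<nu>\<in>S. lc f \<nu> * lmon \<nu> (act w 2 Q)) - 2 powi l * (\<Sum>\<nu>\<in>S. lc f \<nu> * lmon \<nu> Q)"
      by (simp add: mon_act algebra_simps sum_subtractf sum_distrib_left)
    also have "\<dots> = f (act w 2 Q) - 2 powi l * f Q"
      using S(2)[OF Q] S(2)[OF Q'] by simp
    also have "\<dots> = 0"
      using Sh_act[OF openin_torus f, of Q 2] Q unfolding Union_torus by simp
    finally show "(\<Sum>\<nu>\<in>S. lc f \<nu> * (2 powi wdeg w \<nu> - 2 powi l) * lmon \<nu> Q) = 0" .
  qed
  then have "(2::complex) powi wdeg w \<nu> = 2 powi l"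
    using assms(2) by (auto simp: S_def)
  then show ?thesis by (simp only: powi_2_inject)
qed

lemma Sh_torus_eq:
  assumes "f \<in> Sh l torus" "g \<in> Sh l torus" "lc f = lc g"
  shows "f = g"
proof
  fix Q
  show "f Q = g Q"
  proof (cases "Q \<in> \<Union>torus")
    case True
    then show ?thesis
      using is_lc_eq[of f "lc f" g Q] is_lc_lc' assms unfolding Union_torus by metis
  qed (use Sh_outside assms(1,2) in metis)
qed

lemma sheaf_homs_tmon_mem:
  assumes "P \<in> sheaf_homs T (Sh l) (Sh l) U" "torus \<subseteq> U" "wdeg w \<mu> = l"
  shows "P torus (tmon \<mu>) \<in> Sh l torus"
  using sheaf_homsD(1)[OF assms(1) openin_torus assms(2)] tmon_mem[of \<mu>] assms(3) by simp

lemma is_lc_coeff_fun: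
  assumes "P \<in> sheaf_homs T (Sh l) (Sh l) U" "torus \<subseteq> U" "wdeg w \<mu> = l"
  shows "is_lc (P torus (tmon \<mu>)) (coeff_fun P \<mu>)"
  unfolding coeff_fun_def by (rule is_lc_lc'[OF sheaf_homs_tmon_mem[OF assms]])

lemma coeff_fun_degree:
  assumes "P \<in> sheaf_homs T (Sh l) (Sh l) U" "torus \<subseteq> U" "wdeg w \<mu> = l" "coeff_fun P \<mu> \<nu> \<noteq> 0"
  shows "wdeg w \<nu> = l"
  using lc_degree[OF sheaf_homs_tmon_mem[OF assms(1-3)]] assms(4) unfolding coeff_fun_def by simp

section \<open>From bounded order to vanishing differences\<close>

lemma commutator_restr_restr_op:
  assumes S: "S \<in> sheaf_homs T (Sh l) (Sh l) U" and N: "openin T N" "N \<subseteq> U"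
  shows "restr_op N (commutator T (Sh l) U S a) = commutator T (Sh l) N (restr_op N S) (restr N a)"
proof (intro ext)
  fix W f p
  show "restr_op N (commutator T (Sh l) U S a) W f p =
      commutator T (Sh l) N (restr_op N S) (restr N a) W f p"
  proof (cases "openin T W \<and> W \<subseteq> N \<and> f \<in> Sh l W")
    case True
    have 1: "restr N a q * g q = a q * g q" if "g \<in> Sh l W" for g q
    proof (cases "q \<in> \<Union>N")
      case False
      then have "q \<notin> \<Union>W" using True by blast
      then show ?thesis using Sh_outside[OF that] by simp
    qed (simp add: restr_def)
    have "S W f \<in> Sh l W" using sheaf_homsD(1)[OF S] True N by blast
    then have 2: "restr N a p * S W f p = a p * S W f p" by (rule 1)
    have 3: "(\<lambda>q. restr N a q * f q) = (\<lambda>q. a q * f q)"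
      using True by (intro ext 1) blast
    have "W \<subseteq> N" "W \<subseteq> U" using True N(2) by auto
    then show ?thesis
      using True 2 3 by (auto simp: restr_op_def commutator_def)
  qed (auto simp: restr_op_def commutator_def)
qed

text \<open>The commutator with an invariant monomial replaces the matrix entries in a fixed
  direction by their differences. The order is bounded only over \<open>N\<close>; after the last
  commutator, vanishing over \<open>N\<close> implies vanishing over the torus.\<close>

lemma coeff_fun_dvanish:
  assumes N: "openin T N" "N \<noteq> {}" "N \<subseteq> torus"
  shows "S \<in> sheaf_homs T (Sh l) (Sh l) torus \<Longrightarrow>
    restr_op N S \<in> diff_homs T (Sh 0) (Sh l) (Sh l) n N \<Longrightarrow>
    dvanish w l n (\<lambda>\<mu>. coeff_fun S \<mu> (\<lambda>j. \<mu> j + \<beta> j))"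
proof (induction n arbitrary: S \<beta>)
  case 0
  have "coeff_fun S \<mu> \<nu> = 0" if \<mu>: "wdeg w \<mu> = l" for \<mu> \<nu>
  proof -
    have mem: "S torus (tmon \<mu>) \<in> Sh l torus"
      using sheaf_homs_tmon_mem[OF 0(1) subset_refl \<mu>] .
    have "restr N (S torus (tmon \<mu>)) = S N (restr N (tmon \<mu>))"
      using sheaf_homsD(4)[OF 0(1) openin_torus subset_refl N(1,3)] tmon_mem[of \<mu>] \<mu> by simp
    also have "\<dots> = restr_op N S N (restr N (tmon \<mu>))"
      by (simp add: restr_op_def)
    also have "\<dots> = (\<lambda>p. 0)" using 0(2) by (simp add: fun_eq_iff)
    finally have "S torus (tmon \<mu>) Q = 0" if "Q \<in> \<Union>N" for Q
      using that unfolding restr_def fun_eq_iff by meson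
    then have "S torus (tmon \<mu>) = (\<lambda>Q. 0)"
      using Sh_zero_on_open[OF openin_torus mem N(1,2)] by blast
    then show ?thesis by (simp add: coeff_fun_def is_lc_lc[OF is_lc_zero])
  qed
  then show ?case by simp
next
  case (Suc n)
  show ?case
    unfolding dvanish.simps
  proof (intro allI impI)
    fix \<gamma> :: "'n option \<Rightarrow> int" assume \<gamma>: "wdeg w \<gamma> = 0"
    define S' where "S' = commutator T (Sh l) torus S (tmon \<gamma>)"
    have mem: "tmon \<gamma> \<in> Sh 0 torus" using tmon_mem[of \<gamma>] \<gamma> by simp
    have S': "S' \<in> sheaf_homs T (Sh l) (Sh l) torus"
      unfolding S'_def
      by (rule commutator_sheaf_homs[OF Suc.prems(1) module_sheaf_Sh module_sheaf_Sh openin_torus subset_refl mem])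
    moreover have "restr_op N S' \<in> diff_homs T (Sh 0) (Sh l) (Sh l) n N"
      unfolding S'_def commutator_restr_restr_op[OF Suc.prems(1) N(1,3)]
      using Suc.prems(2) N(1) Sh_restr[OF openin_torus N(1,3) mem] by simp
    \<comment> \<open>The monomial \<open>tmon \<gamma>\<close> adds \<open>\<gamma>\<close> to the
      direction, so the entries of \<open>S\<close> in direction \<open>\<beta>\<close> correspond
      to those of \<open>S'\<close> in direction \<open>\<beta> + \<gamma>\<close>.\<close>
    ultimately have *: "dvanish w l n (\<lambda>\<mu>. coeff_fun S' \<mu> (\<lambda>j. \<mu> j + (\<beta> j + \<gamma> j)))"
      using Suc.IH[of S' "\<lambda>j. \<beta> j + \<gamma> j"] by simp
    have "coeff_fun S' \<mu> (\<lambda>j. \<mu> j + (\<beta> j + \<gamma> j)) =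
        coeff_fun S (\<lambda>j. \<mu> j + \<gamma> j) (\<lambda>j. \<mu> j + \<gamma> j + \<beta> j) - coeff_fun S \<mu> (\<lambda>j. \<mu> j + \<beta> j)"
      if \<mu>: "wdeg w \<mu> = l" for \<mu>
    proof -
      have \<mu>\<gamma>: "wdeg w (\<lambda>j. \<mu> j + \<gamma> j) = l" by (simp add: wdeg_add \<mu> \<gamma>)
      have prod: "(\<lambda>q. tmon \<gamma> q * tmon \<mu> q) = tmon (\<lambda>j. \<mu> j + \<gamma> j)"
      proof
        fix q
        show "tmon \<gamma> q * tmon \<mu> q = tmon (\<lambda>j. \<mu> j + \<gamma> j) q"
        proof (cases "q \<in> \<Union>torus")
          case True
          then have "crd q j \<noteq> 0" for j unfolding Union_torus by (simp add: chart_dom_def)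
          then show ?thesis
            using True by (simp add: restr_def mon_add mult.commute del: Union_iff)
        qed (simp only: restr_def if_False mult_zero_left)
      qed
      have tm: "tmon \<mu> \<in> Sh l torus" using tmon_mem[of \<mu>] \<mu> by simp
      have e: "S' torus (tmon \<mu>) = (\<lambda>Q. S torus (tmon (\<lambda>j. \<mu> j + \<gamma> j)) Q - tmon \<gamma> Q * S torus (tmon \<mu>) Q)"
        using openin_torus tm by (simp add: S'_def commutator_def prod)
      have "is_lc (S' torus (tmon \<mu>)) (\<lambda>\<nu>. 1 * coeff_fun S (\<lambda>j. \<mu> j + \<gamma> j) \<nu> +
          (-1) * coeff_fun S \<mu> (\<lambda>j. \<nu> j - \<gamma> j))"
      proof (rule is_lc_cong[OF is_lc_lcomb[OF is_lc_coeff_fun[OF Suc.prems(1) subset_refl \<mu>\<gamma>]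
              is_lc_mon_mult[OF is_lc_coeff_fun[OF Suc.prems(1) subset_refl \<mu>], of \<gamma>]]])
        fix Q :: "'n point" assume "Q \<in> chart_dom UNIV"
        then have "Q \<in> \<Union>torus" by (simp only: Union_torus)
        then show "S' torus (tmon \<mu>) Q = 1 * S torus (tmon (\<lambda>j. \<mu> j + \<gamma> j)) Q +
            (-1) * (lmon \<gamma> Q * S torus (tmon \<mu>) Q)"
          unfolding e by (simp add: restr_in)
      qed
      from is_lc_lc[OF this] show ?thesis
        by (simp add: coeff_fun_def algebra_simps)
    qed
    then show "dvanish w l n (\<lambda>\<mu>. coeff_fun S (\<lambda>j. \<mu> j + \<gamma> j) (\<lambda>j. \<mu> j + \<gamma> j + \<beta> j) -
        coeff_fun S \<mu> (\<lambda>j. \<mu> j + \<beta> j))"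
      using * dvanish_cong[of w l "\<lambda>\<mu>. coeff_fun S' \<mu> (\<lambda>j. \<mu> j + (\<beta> j + \<gamma> j))"
          "\<lambda>\<mu>. coeff_fun S (\<lambda>j. \<mu> j + \<gamma> j) (\<lambda>j. \<mu> j + \<gamma> j + \<beta> j) - coeff_fun S \<mu> (\<lambda>j. \<mu> j + \<beta> j)" n]
      by simp
  qed
qed

text \<open>
  The torus sections determine a differential operator: a section \<open>f\<close> over \<open>N\<close> is a fraction \<open>g / h\<close>
  of torus sections, and \<open>h * S f - S (h * f)\<close> involves only the commutator of \<open>S\<close> with \<open>h\<close>.
\<close>

lemma diff_hom_zero_fraction:
  assumes N: "openin T N" "N \<subseteq> torus" and f: "f \<in> Sh l N" and g: "g \<in> Sh l torus"
    and h: "h \<in> Sh 0 torus" "\<And>Q. Q \<in> \<Union>N \<Longrightarrow> h Q \<noteq> 0"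
    and hf: "(\<lambda>Q. h Q * f Q) = restr N g"
  shows "S \<in> sheaf_homs T (Sh l) (Sh l) torus \<Longrightarrow>
    restr_op N S \<in> diff_homs T (Sh 0) (Sh l) (Sh l) n N \<Longrightarrow>
    (\<And>u. u \<in> Sh l torus \<Longrightarrow> S torus u = (\<lambda>Q. 0)) \<Longrightarrow> S N f = (\<lambda>Q. 0)"
proof (induction n arbitrary: S)
  case 0
  have "S N f = restr_op N S N f" by (simp add: restr_op_def)
  then show ?case using 0(2) by (simp add: fun_eq_iff)
next
  case (Suc n)
  define S' where "S' = commutator T (Sh l) torus S h"
  have "S' N f = (\<lambda>Q. 0)"
  proof (rule Suc.IH)
    show "S' \<in> sheaf_homs T (Sh l) (Sh l) torus"
      unfolding S'_def
      by (rule commutator_sheaf_homs[OF Suc.prems(1) module_sheaf_Sh module_sheaf_Sh openin_torus subset_refl h(1)])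
    show "restr_op N S' \<in> diff_homs T (Sh 0) (Sh l) (Sh l) n N"
      unfolding S'_def commutator_restr_restr_op[OF Suc.prems(1) N]
      using Suc.prems(2) N(1) Sh_restr[OF openin_torus N h(1)] by simp
    fix u assume u: "u \<in> Sh l torus"
    have "(\<lambda>q. h q * u q) \<in> Sh l torus"
      using Sh_mult[OF openin_torus h(1) openin_torus subset_refl u] by simp
    then show "S' torus u = (\<lambda>Q. 0)"
      using Suc.prems(3) u by (simp add: S'_def commutator_def)
  qed
  moreover have "S N (\<lambda>q. h q * f q) = (\<lambda>Q. 0)"
    unfolding hf using sheaf_homsD(4)[OF Suc.prems(1) openin_torus subset_refl N g] Suc.prems(3)[OF g]
    by (simp add: restr_zero)
  moreover have "S' N f Q = S N (\<lambda>q. h q * f q) Q - h Q * S N f Q" for Q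
    using N f by (simp add: S'_def commutator_def)
  ultimately have e: "h Q * S N f Q = 0" for Q by simp
  show ?case
  proof
    fix Q
    show "S N f Q = 0"
    proof (cases "Q \<in> \<Union>N")
      case True
      then show ?thesis using h(2)[OF True] e[of Q] by simp
    next
      case False
      then show ?thesis using Sh_outside[OF sheaf_homsD(1)[OF Suc.prems(1) N f]] by blast
    qed
  qed
qed

lemma sum_tmon_zero:
  assumes S: "S \<in> sheaf_homs T (Sh l) (Sh l) U" "torus \<subseteq> U"
    and z: "\<And>\<mu>. wdeg w \<mu> = l \<Longrightarrow> S torus (tmon \<mu>) = (\<lambda>Q. 0)" and u: "u \<in> Sh l torus"
  shows "S torus u = (\<lambda>Q. 0)"
proof -
  let ?I = "{\<nu>. lc u \<nu> \<noteq> 0}"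
  have fin: "finite ?I" using is_lc_finite_support[OF is_lc_lc'[OF u]] .
  have deg: "wdeg w \<nu> = l" if "\<nu> \<in> ?I" for \<nu>
    using lc_degree[OF u] that by simp
  have mem: "tmon \<nu> \<in> Sh l torus" if "\<nu> \<in> ?I" for \<nu>
    using tmon_mem[of \<nu>] deg[OF that] by simp
  note sum = sheaf_homs_sum[OF S(1) module_sheaf_Sh openin_torus S(2) fin, of tmon "lc u", OF mem]
  have "u = (\<lambda>p. \<Sum>\<nu>\<in>?I. lc u \<nu> * tmon \<nu> p)"
  proof (rule Sh_torus_eq[OF u])
    show "(\<lambda>p. \<Sum>\<nu>\<in>?I. lc u \<nu> * tmon \<nu> p) \<in> Sh l torus" using sum by blast
    have "is_lc (\<lambda>p. \<Sum>\<nu>\<in>?I. lc u \<nu> * tmon \<nu> p) (lc u)"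
    proof (rule is_lcI[OF fin])
      fix Q :: "'n point" assume "Q \<in> chart_dom UNIV"
      then have "Q \<in> \<Union>torus" by (simp only: Union_torus)
      then show "(\<Sum>\<nu>\<in>?I. lc u \<nu> * tmon \<nu> Q) = (\<Sum>\<nu>\<in>?I. lc u \<nu> * lmon \<nu> Q)"
        by (simp add: restr_def del: Union_iff)
    qed simp
    from is_lc_lc[OF this] show "lc u = lc (\<lambda>p. \<Sum>\<nu>\<in>?I. lc u \<nu> * tmon \<nu> p)" by (rule sym)
  qed
  then have "S torus u = (\<lambda>p. \<Sum>\<nu>\<in>?I. lc u \<nu> * S torus (tmon \<nu>) p)"
    using sum by metis
  also have "\<dots> = (\<lambda>Q. 0)" using z deg by simp
  finally show ?thesis .
qed

text \<open>Every section over \<open>W\<close> becomes a fraction of torus sections on a small open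
  set inside \<open>N\<close>, where the order is bounded. Once its image is zero there, it is zero
  over \<open>W\<close>.\<close>

lemma diff_hom_zero:
  assumes S: "S \<in> sheaf_homs T (Sh l) (Sh l) (topspace T)"
    and N: "openin T N" "N \<noteq> {}" "N \<subseteq> torus"
    and fin: "restr_op N S \<in> diff_homs T (Sh 0) (Sh l) (Sh l) n N"
    and z: "\<And>\<mu>. wdeg w \<mu> = l \<Longrightarrow> S torus (tmon \<mu>) = (\<lambda>Q. 0)"
  shows "S = (\<lambda>W f Q. 0)"
proof (intro ext)
  fix W f Q
  have z': "S torus u = (\<lambda>Q. 0)" if "u \<in> Sh l torus" for u
    using sum_tmon_zero[OF S torus_subset z that] .
  have "S W f = (\<lambda>Q. 0)" if W: "openin T W" "f \<in> Sh l W" "W \<noteq> {}"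
  proof -
    have WT: "W \<subseteq> topspace T" using openin_subset[OF W(1)] .
    obtain d a b Q0 where ab: "a \<in> hpoly w (l + d)" "b \<in> hpoly w d" "Q0 \<in> \<Union>W" "b Q0 \<noteq> 0"
      "\<And>Q. Q \<in> \<Union>W \<Longrightarrow> f Q * b Q = a Q"
      using Sh_global[OF W] by metis
    fix i :: 'n
    \<comment> \<open>A monomial of degree \<open>-d\<close> brings the denominator \<open>b\<close>
      to degree 0, so that it becomes a function with which commutators may be formed.\<close>
    define \<nu> where "\<nu> = (\<lambda>_. 0)(Some i := - d)"
    have \<nu>: "wdeg w \<nu> = - d" by (simp add: \<nu>_def)
    define N' where "N' = N \<inter> W \<inter> nz b"
    have bW: "openin T (nz b)" by (rule openin_nz[OF ab(2)])
    have "nz b \<noteq> {}"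
    proof -
      have "Q0 \<in> \<Union>(topspace T)" using ab(3) WT by blast
      then have "Q0 \<in> \<Union>(nz b)" unfolding Union_nz[OF ab(2)] using ab(4) by blast
      then show ?thesis by blast
    qed
    then have N': "openin T N'" "N' \<noteq> {}" "N' \<subseteq> torus" "N' \<subseteq> N" "N' \<subseteq> W"
      unfolding N'_def using N W bW open_Int_nonempty[of "N \<inter> W" "nz b"] open_Int_nonempty[of N W]
      by auto
    let ?h = "\<lambda>Q. restr torus b Q * tmon \<nu> Q" and ?g = "\<lambda>Q. restr torus a Q * tmon \<nu> Q"
    have h: "?h \<in> Sh 0 torus"
      using Sh_mult[OF openin_torus Sh_hpoly[OF openin_torus ab(2)] openin_torus subset_refl tmon_mem[of \<nu>]]
      by (simp add: \<nu>)
    have g: "?g \<in> Sh l torus"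
      using Sh_mult[OF openin_torus Sh_hpoly[OF openin_torus ab(1)] openin_torus subset_refl tmon_mem[of \<nu>]]
      by (simp add: \<nu>)
    have N't: "Q \<in> \<Union>torus" "Q \<in> \<Union>W" "b Q \<noteq> 0" if "Q \<in> \<Union>N'" for Q
    proof -
      show "Q \<in> \<Union>torus" "Q \<in> \<Union>W" using that N' by blast+
      have "Q \<in> \<Union>(nz b)" using that unfolding N'_def by blast
      then show "b Q \<noteq> 0" unfolding Union_nz[OF ab(2)] by blast
    qed
    have "restr_op torus S N' (restr N' f) = (\<lambda>Q. 0)"
    proof (rule diff_hom_zero_fraction[OF N'(1,3) Sh_restr[OF W(1) N'(1,5) W(2)] g h])
      fix Q assume Q: "Q \<in> \<Union>N'"
      have "lmon \<nu> Q \<noteq> 0"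
        using N't(1)[OF Q] unfolding Union_torus by (simp add: mon_eq_0_iff chart_dom_def)
      then show "?h Q \<noteq> 0" using N't[OF Q] by (simp add: restr_def del: Union_iff)
    next
      show "(\<lambda>Q. ?h Q * restr N' f Q) = restr N' ?g"
      proof
        fix Q
        show "?h Q * restr N' f Q = restr N' ?g Q"
        proof (cases "Q \<in> \<Union>N'")
          case True
          then show ?thesis
            using N't[OF True] ab(5)[of Q] by (simp add: restr_def mult.commute del: Union_iff)
        qed (simp only: restr_def if_False mult_zero_right)
      qed
    next
      show "restr_op torus S \<in> sheaf_homs T (Sh l) (Sh l) torus"
        by (rule sheaf_homs_restr_op[OF module_sheaf_Sh S torus_subset])
      have "restr_op N' (restr_op torus S) = restr_op N' (restr_op N S)"
        using N' by (force simp: restr_op_def fun_eq_iff)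
      then show "restr_op N' (restr_op torus S) \<in> diff_homs T (Sh 0) (Sh l) (Sh l) n N'"
        using diff_homs_restr_op[OF module_sheaf_Sh module_sheaf_Sh fin N'(4)] by simp
      fix u assume "u \<in> Sh l torus"
      then show "restr_op torus S torus u = (\<lambda>Q. 0)" using z' by (simp add: restr_op_def)
    qed
    then have "S N' (restr N' f) = (\<lambda>Q. 0)" using N'(3) by (simp add: restr_op_def)
    then have "restr N' (S W f) = (\<lambda>Q. 0)"
      using sheaf_homsD(4)[OF S W(1) WT N'(1,5) W(2)] by simp
    then have "S W f Q = 0" if "Q \<in> \<Union>N'" for Q
      using that unfolding restr_def fun_eq_iff by meson
    then show ?thesis
      using Sh_zero_on_open[OF W(1) sheaf_homsD(1)[OF S W(1) WT W(2)] N'(1,2)] by blast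
  qed
  moreover have "S W f = (\<lambda>Q. 0)" if "\<not> (openin T W \<and> W \<subseteq> topspace T \<and> f \<in> Sh l W)"
    using sheaf_homsD(5)[OF S that] .
  moreover have "S W f Q = 0" if W: "W = {}" "openin T W" "f \<in> Sh l W"
    using Sh_outside[OF sheaf_homsD(1)[OF S W(2) openin_subset[OF W(2)] W(3)], of Q] W(1) by simp
  ultimately show "S W f Q = 0"
    using openin_subset[of T W] by metis
qed

text \<open>The monomial is already a section over the chart \<open>Q_i \<noteq> 0\<close>, so its
  image is one too and has no pole along any other coordinate.\<close>

lemma coeff_fun_chart:
  assumes P: "P \<in> sheaf_homs T (Sh l) (Sh l) (topspace T)"
    and \<mu>: "wdeg w \<mu> = l" "\<And>k. k \<noteq> Some i \<Longrightarrow> 0 \<le> \<mu> k" and \<nu>: "j \<noteq> Some i" "\<nu> j < 0"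
  shows "coeff_fun P \<mu> \<nu> = 0"
proof -
  define U where "U = nz (\<lambda>Q. crd Q (Some i))"
  have U: "openin T U" unfolding U_def by (rule openin_nz[OF hpoly_crd])
  have UU: "\<Union>U = chart_dom {Some i}"
  proof -
    have "\<Union>U = {Q \<in> \<Union>(topspace T). crd Q (Some i) \<noteq> 0}"
      unfolding U_def by (rule Union_nz[OF hpoly_crd])
    then show ?thesis using crd_nonzero_mem unfolding chart_dom_def by blast
  qed
  have tU: "torus \<subseteq> U"
  proof
    fix z assume z: "z \<in> torus"
    obtain Q where Q: "Q \<in> z" using ex_in_orbit[OF openin_torus z] by blast
    then have "Q \<in> \<Union>torus" using z by blast
    then have "Q \<in> \<Union>U" unfolding Union_torus UU by (simp add: chart_dom_def)
    then have "orbit w Q \<in> U" using mem_Union_iff[OF U] by blast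
    then show "z \<in> U" using orbit_mem[OF openin_torus z Q] by simp
  qed
  have m: "restr U (lmon \<mu>) \<in> Sh l U"
  proof -
    have "restr U (lmon \<mu>) \<in> Sh (wdeg w \<mu>) U"
    proof (rule Sh_mon[OF U])
      fix Q k assume "Q \<in> \<Union>U" "\<mu> k < 0"
      then show "crd Q k \<noteq> 0"
        using \<mu>(2)[of k] unfolding UU by (cases "k = Some i") (auto simp: chart_dom_def)
    qed
    then show ?thesis by (simp add: \<mu>)
  qed
  have UT: "U \<subseteq> topspace T" using openin_subset[OF U] .
  have "laurent {Some i} (P U (restr U (lmon \<mu>)))"
    by (rule Sh_laurent[OF U UU sheaf_homsD(1)[OF P U UT m]])
  then obtain C where C: "is_lc (P U (restr U (lmon \<mu>))) C"
    "\<And>\<nu> j. C \<nu> \<noteq> 0 \<Longrightarrow> j \<notin> {Some i} \<Longrightarrow> 0 \<le> \<nu> j"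
    using laurent_is_lc by blast
  have "P torus (tmon \<mu>) = restr torus (P U (restr U (lmon \<mu>)))"
    using sheaf_homsD(4)[OF P U UT openin_torus tU m] restr_restr[OF tU, of "lmon \<mu>"] by simp
  then have "is_lc (P torus (tmon \<mu>)) C"
    by (intro is_lc_cong[OF C(1)]) (simp only: Union_torus[symmetric] restr_def if_True)
  then have "coeff_fun P \<mu> = C" unfolding coeff_fun_def by (rule is_lc_lc)
  then show ?thesis using C(2)[of \<nu> j] \<nu> by force
qed

text \<open>Words of equal shift contribute to the same matrix entry, hence the grouping by
  \<open>comb_part\<close>.\<close>

lemma comb_hom_coeff:
  assumes cs: "homog_comb cs" and \<mu>: "wdeg w \<mu> = l"
  shows "coeff_fun (comb_hom l cs) \<mu> (\<lambda>j. \<mu> j + \<beta> j) = comb_coeff (comb_part \<beta> cs) \<mu>"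
proof -
  have "is_lc (comb_hom l cs torus (tmon \<mu>)) (\<lambda>\<nu>. comb_coeff (comb_part (\<lambda>j. \<nu> j - \<mu> j) cs) \<mu>)"
  proof (induction cs)
    case Nil
    then show ?case
      using is_lc_zero by (simp add: comb_hom_def comb_coeff_def comb_part_def)
  next
    case (Cons a cs)
    obtain c x where a: "a = (c, x)" by (cases a)
    have "is_lc (lmon (\<lambda>j. \<mu> j + word_shift x j)) (\<lambda>\<nu>. if \<nu> = (\<lambda>j. \<mu> j + word_shift x j) then 1 else 0)"
      by (rule is_lc_mon)
    from is_lc_lcomb[OF this Cons, of "c * word_coeff x \<mu>" 1]
    have "is_lc (comb_hom l (a # cs) torus (tmon \<mu>))
        (\<lambda>\<nu>. c * word_coeff x \<mu> * (if \<nu> = (\<lambda>j. \<mu> j + word_shift x j) then 1 else 0) +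
          1 * comb_coeff (comb_part (\<lambda>j. \<nu> j - \<mu> j) cs) \<mu>)"
    proof (rule is_lc_cong)
      fix Q :: "'n point" assume "Q \<in> chart_dom UNIV"
      then have "Q \<in> \<Union>torus" by (simp only: Union_torus)
      then show "comb_hom l (a # cs) torus (tmon \<mu>) Q =
          c * word_coeff x \<mu> * lmon (\<lambda>j. \<mu> j + word_shift x j) Q + 1 * comb_hom l cs torus (tmon \<mu>) Q"
        by (simp add: comb_hom_def a word_hom_tmon[OF \<mu>] restr_in)
    qed
    also have "(\<lambda>\<nu>. c * word_coeff x \<mu> * (if \<nu> = (\<lambda>j. \<mu> j + word_shift x j) then 1 else 0) +
          1 * comb_coeff (comb_part (\<lambda>j. \<nu> j - \<mu> j) cs) \<mu>) =
        (\<lambda>\<nu>. comb_coeff (comb_part (\<lambda>j. \<nu> j - \<mu> j) (a # cs)) \<mu>)"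
    proof
      fix \<nu> :: "'n option \<Rightarrow> int"
      have "\<nu> = (\<lambda>j. \<mu> j + word_shift x j) \<longleftrightarrow> word_shift x = (\<lambda>j. \<nu> j - \<mu> j)"
        by (auto simp: fun_eq_iff)
      then show "c * word_coeff x \<mu> * (if \<nu> = (\<lambda>j. \<mu> j + word_shift x j) then 1 else 0) +
          1 * comb_coeff (comb_part (\<lambda>j. \<nu> j - \<mu> j) cs) \<mu> =
          comb_coeff (comb_part (\<lambda>j. \<nu> j - \<mu> j) (a # cs)) \<mu>"
        by (simp add: comb_part_def comb_coeff_def a)
    qed
    finally show ?case .
  qed
  then show ?thesis by (simp add: coeff_fun_def is_lc_lc)
qed

text \<open>Vanishing of an operator becomes a system of polynomial identities on the hyperplane,
  one for each direction; in this form the two varieties can be compared.\<close>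

lemma comb_hom_eq_0_iff:
  assumes cs: "homog_comb cs"
  shows "comb_hom l cs = (\<lambda>W f Q. 0) \<longleftrightarrow>
    (\<forall>\<beta> \<mu>. wdeg w \<mu> = l \<longrightarrow> comb_coeff (comb_part \<beta> cs) \<mu> = 0)" (is "?L \<longleftrightarrow> ?R")
proof
  assume L: ?L
  show ?R
  proof (intro allI impI)
    fix \<beta> \<mu> :: "'n option \<Rightarrow> int" assume \<mu>: "wdeg w \<mu> = l"
    show "comb_coeff (comb_part \<beta> cs) \<mu> = 0"
      unfolding comb_hom_coeff[OF cs \<mu>, symmetric] L coeff_fun_def is_lc_lc[OF is_lc_zero] ..
  qed
next
  assume R: ?R
  obtain k where k: "comb_hom l cs \<in> diff_homs T (Sh 0) (Sh l) (Sh l) k (topspace T)"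
    using comb_hom_diff[OF cs] by blast
  note h = comb_hom_sheaf_homs[OF cs, of l]
  show ?L
  proof (rule diff_hom_zero[OF h openin_torus torus_nonempty subset_refl])
    show "restr_op torus (comb_hom l cs) \<in> diff_homs T (Sh 0) (Sh l) (Sh l) k torus"
      by (rule diff_homs_restr_op[OF module_sheaf_Sh module_sheaf_Sh k torus_subset])
    fix \<mu> :: "'n option \<Rightarrow> int" assume \<mu>: "wdeg w \<mu> = l"
    have "coeff_fun (comb_hom l cs) \<mu> \<nu> = 0" for \<nu>
      using comb_hom_coeff[OF cs \<mu>, of "\<lambda>j. \<nu> j - \<mu> j"] R \<mu> by simp
    then have "lc (comb_hom l cs torus (tmon \<mu>)) = lc (\<lambda>Q. 0)"
      unfolding coeff_fun_def is_lc_lc[OF is_lc_zero] by blast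
    then show "comb_hom l cs torus (tmon \<mu>) = (\<lambda>Q. 0)"
      by (rule Sh_torus_eq[OF sheaf_homs_tmon_mem[OF h torus_subset \<mu>] Sh_zero[OF openin_torus]])
  qed
qed

lemma comb_hom_carrier:
  assumes "homog_comb cs"
  shows "comb_hom l cs \<in> diff_op_sheaf T (Sh 0) (Sh l) (topspace T)"
proof -
  obtain k where k: "comb_hom l cs \<in> diff_homs T (Sh 0) (Sh l) (Sh l) k (topspace T)"
    using comb_hom_diff[OF assms] by blast
  note h = comb_hom_sheaf_homs[OF assms, of l]
  have "restr_op (topspace T) (comb_hom l cs) \<in> diff_ops T (Sh 0) (Sh l) k (topspace T)"
    unfolding diff_ops_eq restr_op_id[OF h] by (rule diff_homs_mono[OF module_sheaf_Sh _ k]) simp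
  then show ?thesis
    unfolding diff_op_sheaf_def sheaf_endos_eq using h openin_topspace by blast
qed

text \<open>A bound on the order near one point of the torus makes the entries in each direction
  polynomial, the charts make them realizable by words, and interpolation leaves finitely many
  directions. The resulting combination agrees with \<open>P\<close> on torus monomials, which
  determines \<open>P\<close>.\<close>

theorem diff_op_is_comb_hom:
  assumes n: "CARD('n) \<ge> 2" and w: "w \<noteq> 0"
    and P: "P \<in> diff_op_sheaf T (Sh 0) (Sh l) (topspace T)"
  shows "\<exists>cs. homog_comb cs \<and> P = comb_hom l cs"
proof -
  have Ph: "P \<in> sheaf_homs T (Sh l) (Sh l) (topspace T)"
    using P by (simp add: diff_op_sheaf_def sheaf_endos_eq)
  obtain z where z: "z \<in> torus" using torus_nonempty by blast
  then obtain V k where V: "openin T V" "z \<in> V" "restr_op V P \<in> diff_ops T (Sh 0) (Sh l) k V"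
    using P torus_subset unfolding diff_op_sheaf_def by blast
  define N where "N = V \<inter> torus"
  have N: "openin T N" "N \<noteq> {}" "N \<subseteq> torus" "N \<subseteq> V"
    using V z openin_torus by (auto simp: N_def)
  have "restr_op N (restr_op V P) \<in> diff_homs T (Sh 0) (Sh l) (Sh l) (Suc k) N"
    using V(3) unfolding diff_ops_eq by (rule diff_homs_restr_op[OF module_sheaf_Sh module_sheaf_Sh _ N(4)])
  moreover have "restr_op N (restr_op V P) = restr_op N P"
    using N(4) by (force simp: restr_op_def fun_eq_iff)
  ultimately have PN: "restr_op N P \<in> diff_homs T (Sh 0) (Sh l) (Sh l) (Suc k) N" by metis
  have dv: "dvanish w l (Suc k) (\<lambda>\<mu>. coeff_fun P \<mu> (\<lambda>j. \<mu> j + \<beta> j))" for \<beta>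
  proof -
    have "restr_op N (restr_op torus P) = restr_op N P"
      using N(3) by (force simp: restr_op_def fun_eq_iff)
    then have "restr_op N (restr_op torus P) \<in> diff_homs T (Sh 0) (Sh l) (Sh l) (Suc k) N"
      using PN by (simp only:)
    then have "dvanish w l (Suc k) (\<lambda>\<mu>. coeff_fun (restr_op torus P) \<mu> (\<lambda>j. \<mu> j + \<beta> j))"
      by (rule coeff_fun_dvanish[OF N(1-3) sheaf_homs_restr_op[OF module_sheaf_Sh Ph torus_subset]])
    moreover have "coeff_fun (restr_op torus P) = coeff_fun P"
      by (auto simp: coeff_fun_def restr_op_def fun_eq_iff)
    ultimately show ?thesis by simp
  qed
  obtain I :: "int list set" and H :: "int list \<Rightarrow> ('n option \<Rightarrow> int) \<Rightarrow> complex" and e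
    where I: "finite I" "\<And>x. x \<in> I \<Longrightarrow> wdeg w (e x) = l"
    "\<And>f \<mu>. dvanish w l (Suc k) f \<Longrightarrow> wdeg w \<mu> = l \<Longrightarrow> f \<mu> = (\<Sum>x\<in>I. H x \<mu> * f (e x))"
    using dvanish_interpolation[where w = w and l = l and n = "Suc k" and 'n = 'n] by metis
  \<comment> \<open>A direction whose entries vanish at all nodes \<open>e x\<close> vanishes
    altogether. There are finitely many nodes, and the image of each monomial has finite support, so
    \<open>B\<close> is finite.\<close>
  define B where "B = (\<Union>x\<in>I. (\<lambda>\<nu> j. \<nu> j - e x j) ` {\<nu>. coeff_fun P (e x) \<nu> \<noteq> 0})"
  have "finite B"
    unfolding B_def using I(1) is_lc_finite_support[OF is_lc_coeff_fun[OF Ph torus_subset I(2)]] by blast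
  have B: "coeff_fun P \<mu> (\<lambda>j. \<mu> j + \<beta> j) = 0" if \<mu>: "wdeg w \<mu> = l" and \<beta>: "\<beta> \<notin> B" for \<mu> \<beta>
  proof -
    have "coeff_fun P (e x) (\<lambda>j. e x j + \<beta> j) = 0" if x: "x \<in> I" for x
    proof (rule ccontr)
      assume nz: "coeff_fun P (e x) (\<lambda>j. e x j + \<beta> j) \<noteq> 0"
      have "\<beta> \<in> B"
        unfolding B_def
        by (rule UN_I[OF x], rule image_eqI[where x = "\<lambda>j. e x j + \<beta> j"]) (use nz in simp_all)
      then show False using \<beta> by simp
    qed
    then show ?thesis using I(3)[OF dv \<mu>, of \<beta>] by simp
  qed
  \<comment> \<open>An operator preserves the degree \<open>l\<close>, so entries in directions of
    nonzero weight are zero.\<close>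
  define B0 where "B0 = {\<beta> \<in> B. wdeg w \<beta> = 0}"
  obtain bs where bs: "set bs = B0" "distinct bs"
    using finite_distinct_list[of B0] \<open>finite B\<close> unfolding B0_def by auto
  have "\<exists>cs. (\<forall>(c, x)\<in>set cs. word_shift x = \<beta>) \<and>
      (\<forall>\<mu>. wdeg w \<mu> = l \<longrightarrow> coeff_fun P \<mu> (\<lambda>j. \<mu> j + \<beta> j) = comb_coeff cs \<mu>)" if "\<beta> \<in> B0" for \<beta>
  proof (rule dvanish_comb[OF n w dv])
    show "wdeg w \<beta> = 0" using that by (simp add: B0_def)
  qed (rule coeff_fun_chart[OF Ph], auto)
  then have "\<forall>\<beta>\<in>B0. \<exists>cs. (\<forall>(c, x)\<in>set cs. word_shift x = \<beta>) \<and>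
      (\<forall>\<mu>. wdeg w \<mu> = l \<longrightarrow> coeff_fun P \<mu> (\<lambda>j. \<mu> j + \<beta> j) = comb_coeff cs \<mu>)"
    by (intro ballI)
  from bchoice[OF this] obtain g where g0: "\<forall>\<beta>\<in>B0. (\<forall>(c, x)\<in>set (g \<beta>). word_shift x = \<beta>) \<and>
      (\<forall>\<mu>. wdeg w \<mu> = l \<longrightarrow> coeff_fun P \<mu> (\<lambda>j. \<mu> j + \<beta> j) = comb_coeff (g \<beta>) \<mu>)" ..
  have g: "word_shift x = \<beta>" if "\<beta> \<in> B0" "(c, x) \<in> set (g \<beta>)" for \<beta> c x
    using g0 that by fastforce
  have g': "coeff_fun P \<mu> (\<lambda>j. \<mu> j + \<beta> j) = comb_coeff (g \<beta>) \<mu>"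
    if "\<beta> \<in> B0" "wdeg w \<mu> = l" for \<beta> \<mu>
    using g0 that by simp
  define cs where "cs = concat (map g bs)"
  have cs: "homog_comb cs"
    unfolding homog_comb_def cs_def using g bs(1) by (fastforce simp: B0_def)
  have part: "comb_part \<beta> cs = (if \<beta> \<in> B0 then g \<beta> else [])" for \<beta>
    unfolding cs_def bs(1)[symmetric] by (rule comb_part_concat[OF bs(2)]) (use g bs(1) in blast)
  obtain m where m: "comb_hom l cs \<in> diff_homs T (Sh 0) (Sh l) (Sh l) m (topspace T)"
    using comb_hom_diff[OF cs] by blast
  note ch = comb_hom_sheaf_homs[OF cs, of l]
  define S where "S = (\<lambda>W f p. P W f p + (-1) * comb_hom l cs W f p)"
  have "S = (\<lambda>W f Q. 0)"
  proof (rule diff_hom_zero[OF _ N(1-3)])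
    show "S \<in> sheaf_homs T (Sh l) (Sh l) (topspace T)"
      unfolding S_def
      by (rule sheaf_homs_add[OF module_sheaf_Sh Ph sheaf_homs_scale[OF module_sheaf_Sh ch]])
    have NT: "N \<subseteq> topspace T" using N(3) torus_subset by blast
    have "restr_op N (comb_hom l cs) \<in> diff_homs T (Sh 0) (Sh l) (Sh l) m N"
      by (rule diff_homs_restr_op[OF module_sheaf_Sh module_sheaf_Sh m NT])
    then have "(\<lambda>W f p. restr_op N P W f p + (-1) * restr_op N (comb_hom l cs) W f p)
        \<in> diff_homs T (Sh 0) (Sh l) (Sh l) (max (Suc k) m) N"
      using PN by (intro diff_homs_add diff_homs_scale module_sheaf_Sh)
        (auto intro: diff_homs_mono[OF module_sheaf_Sh, rotated] simp del: diff_homs.simps)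
    moreover have "(\<lambda>W f p. restr_op N P W f p + (-1) * restr_op N (comb_hom l cs) W f p) = restr_op N S"
      by (auto simp: restr_op_def S_def fun_eq_iff)
    ultimately show "restr_op N S \<in> diff_homs T (Sh 0) (Sh l) (Sh l) (max (Suc k) m) N" by metis
    fix \<mu> :: "'n option \<Rightarrow> int" assume \<mu>: "wdeg w \<mu> = l"
    have "coeff_fun P \<mu> \<nu> = coeff_fun (comb_hom l cs) \<mu> \<nu>" for \<nu>
    proof -
      define \<beta> where "\<beta> j = \<nu> j - \<mu> j" for j
      have \<nu>: "\<nu> = (\<lambda>j. \<mu> j + \<beta> j)" by (simp add: \<beta>_def)
      show ?thesis
      proof (cases "\<beta> \<in> B0")
        case True
        then show ?thesis
          unfolding \<nu> comb_hom_coeff[OF cs \<mu>] part using g'[OF True \<mu>] by simp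
      next
        case False
        have "coeff_fun P \<mu> \<nu> = 0"
        proof (cases "\<beta> \<in> B")
          case True
          then have "wdeg w \<nu> \<noteq> l" using False \<mu> by (simp add: B0_def \<nu> wdeg_add)
          then show ?thesis using coeff_fun_degree[OF Ph torus_subset \<mu>] by blast
        qed (use B \<mu> \<nu> in simp)
        then show ?thesis
          unfolding \<nu> comb_hom_coeff[OF cs \<mu>] part using False by (simp add: comb_coeff_def)
      qed
    qed
    then have "lc (P torus (tmon \<mu>)) = lc (comb_hom l cs torus (tmon \<mu>))"
      unfolding coeff_fun_def by blast
    then have "P torus (tmon \<mu>) = comb_hom l cs torus (tmon \<mu>)"
      by (rule Sh_torus_eq[OF sheaf_homs_tmon_mem[OF Ph torus_subset \<mu>] sheaf_homs_tmon_mem[OF ch torus_subset \<mu>]])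
    then show "S torus (tmon \<mu>) = (\<lambda>Q. 0)" by (simp add: S_def)
  qed
  then have "P W f p + (-1) * comb_hom l cs W f p = 0" for W f p
    unfolding S_def by meson
  then have "P = comb_hom l cs" by (simp add: fun_eq_iff)
  then show ?thesis using cs by blast
qed

end

section \<open>The Fourier transform in the last coordinate\<close>

text \<open>With the sign of \<open>letter_sgn\<close> this is the substitution of
  \<open>\<partial>\<close> for \<open>Q\<close> and \<open>-Q\<close> for
  \<open>\<partial>\<close>, which respects \<open>[\<partial>, Q] = 1\<close>. Keeping the sign
  apart makes the map on letters an involution.\<close>

fun swap_letter :: "'n letter \<Rightarrow> 'n letter" where
  "swap_letter (Mul None) = Der None"
| "swap_letter (Der None) = Mul None"
| "swap_letter a = a"

fun letter_sgn :: "'n letter \<Rightarrow> complex" where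
  "letter_sgn (Der None) = -1"
| "letter_sgn a = 1"

definition word_sgn :: "'n letter list \<Rightarrow> complex" where
  "word_sgn x = prod_list (map letter_sgn x)"

definition swap_comb :: "(complex \<times> 'n letter list) list \<Rightarrow> (complex \<times> 'n letter list) list" where
  "swap_comb cs = map (\<lambda>(c, x). (c * word_sgn x, map swap_letter x)) cs"

definition neg_comb :: "(complex \<times> 'n letter list) list \<Rightarrow> (complex \<times> 'n letter list) list" where
  "neg_comb cs = map (\<lambda>(c, x). (- c, x)) cs"

lemma swap_swap [simp]: "swap_letter (swap_letter a) = a"
  by (cases a rule: swap_letter.cases) auto

lemma letter_sgn_square: "letter_sgn a * letter_sgn a = 1"
  by (cases a rule: letter_sgn.cases) auto

lemma word_sgn_square: "word_sgn x * word_sgn x = 1"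
proof (induction x)
  case (Cons a x)
  have "word_sgn (a # x) * word_sgn (a # x) = (letter_sgn a * letter_sgn a) * (word_sgn x * word_sgn x)"
    by (simp add: word_sgn_def)
  then show ?case by (simp add: Cons letter_sgn_square)
qed (simp add: word_sgn_def)

definition flip_shift :: "('n option \<Rightarrow> int) \<Rightarrow> 'n option \<Rightarrow> int" where
  "flip_shift \<beta> = \<beta>(None := - \<beta> None)"

text \<open>\<open>Q \<partial>\<close> has eigenvalue \<open>k\<close> on the exponent
  \<open>k\<close>, and its transform \<open>- \<partial> Q\<close> has eigenvalue
  \<open>-(k' + 1)\<close> on the exponent \<open>k'\<close>; equating them gives
  \<open>k' = -1 - k\<close>.\<close>

definition flip_exp :: "('n option \<Rightarrow> int) \<Rightarrow> 'n option \<Rightarrow> int" where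
  "flip_exp \<mu> = \<mu>(None := - 1 - \<mu> None)"

lemma flip_shift_flip [simp]: "flip_shift (flip_shift \<beta>) = \<beta>"
  and flip_exp_flip [simp]: "flip_exp (flip_exp \<mu>) = \<mu>"
  by (auto simp: flip_shift_def flip_exp_def)

lemma flip_add: "(\<lambda>j. flip_exp \<mu> j + flip_shift \<beta> j) = flip_exp (\<lambda>j. \<mu> j + \<beta> j)"
  by (auto simp: flip_shift_def flip_exp_def)

lemma wdeg_minus: "wdeg (- w) \<mu> = wdeg w (flip_shift \<mu>)"
  by (simp add: wdeg_def sum_option flip_shift_def wt_def)

lemma wdeg_flip_shift: "wdeg (- w) (flip_shift \<beta>) = wdeg w \<beta>"
  by (simp add: wdeg_minus)

text \<open>The origin of the change of degree: the term \<open>w k\<close> of the last coordinate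
  becomes \<open>(-w) (-1 - k) = w k + w\<close>.\<close>

lemma wdeg_flip_exp: "wdeg (- w) (flip_exp \<mu>) = wdeg w \<mu> + w"
  by (simp add: wdeg_def sum_option flip_exp_def wt_def algebra_simps)

lemma swap_word_shift: "word_shift (map swap_letter x) = flip_shift (word_shift x)"
proof (induction x)
  case (Cons a x)
  have "letter_shift (swap_letter a) = flip_shift (letter_shift a)"
    by (cases a rule: swap_letter.cases) (auto simp: flip_shift_def)
  then show ?case using Cons by (auto simp: flip_shift_def)
qed (auto simp: flip_shift_def)

text \<open>Solves the recursion of \<open>signed_fact_Suc\<close>: multiplication by
  \<open>Q\<close> has coefficient 1, while its transform \<open>\<partial>\<close> has coefficient
  \<open>-(k + 1)\<close> on the exponent \<open>-1 - k\<close>. Negative arguments get the harmless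
  value 1.\<close>

definition signed_fact :: "int \<Rightarrow> complex" where
  "signed_fact k = (-1) ^ nat k * fact (nat k)"

lemma signed_fact_nonzero: "signed_fact k \<noteq> 0"
  by (simp add: signed_fact_def)

lemma signed_fact_Suc: "0 \<le> k \<Longrightarrow> signed_fact (k + 1) = - of_int (k + 1) * signed_fact k"
  by (simp add: signed_fact_def nat_add_distrib) (simp add: algebra_simps of_nat_nat)

text \<open>
  The Fourier transform is conjugation by the diagonal operator with eigenvalue \<open>signed_fact k\<close>
  on monomials of degree \<open>k\<close> in the last variable, as long as all exponents stay nonnegative.
\<close>

lemma swap_word_coeff:
  assumes "int (length x) \<le> \<mu> None"
  shows "signed_fact (\<mu> None) * (word_sgn x * word_coeff (map swap_letter x) (flip_exp \<mu>)) =
    signed_fact (\<mu> None + word_shift x None) * word_coeff x \<mu>"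
    and "int (length x) \<le> \<mu> None \<Longrightarrow> \<mu> None - int (length x) \<le> \<mu> None + word_shift x None"
  using assms
proof (induction x)
  case Nil
  { case 1 show ?case by (simp add: word_sgn_def) }
  { case 2 show ?case by simp }
next
  case (Cons a x)
  define \<rho> where "\<rho> = (\<lambda>j. \<mu> j + word_shift x j)"
  have len: "int (length x) + 1 \<le> \<mu> None" if "int (length (a # x)) \<le> \<mu> None"
    using that by simp
  { case 1
    \<comment> \<open>The letter \<open>a\<close> acts last, on the exponent \<open>\<rho>\<close>.
      Having at least 1 there, even a derivative does not leave the nonnegative range.\<close>
    have \<rho>: "1 \<le> \<rho> None"
      using Cons.IH(2) len[OF 1(1)] by (simp add: \<rho>_def)
    have fl: "(\<lambda>j. flip_exp \<mu> j + word_shift (map swap_letter x) j) = flip_exp \<rho>"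
      by (simp add: swap_word_shift flip_add \<rho>_def)
    have l: "signed_fact (\<rho> None) * (letter_sgn a * letter_coeff (swap_letter a) (flip_exp \<rho>)) =
        signed_fact (\<rho> None + letter_shift a None) * letter_coeff a \<rho>"
    proof (cases a rule: swap_letter.cases)
      case 1
      then show ?thesis
        using signed_fact_Suc[of "\<rho> None"] \<rho> by (simp add: flip_exp_def algebra_simps)
    next
      case 2
      then show ?thesis
        using signed_fact_Suc[of "\<rho> None - 1"] \<rho> by (simp add: algebra_simps)
    qed (auto simp: flip_exp_def)
    have "signed_fact (\<mu> None) * (word_sgn (a # x) * word_coeff (map swap_letter (a # x)) (flip_exp \<mu>)) =
        (letter_sgn a * letter_coeff (swap_letter a) (flip_exp \<rho>)) *
        (signed_fact (\<mu> None) * (word_sgn x * word_coeff (map swap_letter x) (flip_exp \<mu>)))"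
      by (simp add: fl word_sgn_def)
    also have "\<dots> = (signed_fact (\<rho> None) * (letter_sgn a * letter_coeff (swap_letter a) (flip_exp \<rho>))) *
        word_coeff x \<mu>"
      using Cons.IH(1) len[OF 1(1)] by (simp add: \<rho>_def)
    also have "\<dots> = signed_fact (\<mu> None + word_shift (a # x) None) * word_coeff (a # x) \<mu>"
      unfolding l by (simp add: \<rho>_def add_ac)
    finally show ?case . }
  { case 2
    have "-1 \<le> letter_shift a None" by (cases a) auto
    then show ?case using Cons.IH(2) len[OF 2(1)] by simp }
qed

section \<open>The transform on combinations of words\<close>

lemma swap_comb_coeff:
  assumes "\<And>c x. (c, x) \<in> set cs \<Longrightarrow> word_shift x = \<beta> \<and> int (length x) \<le> \<mu> None"
  shows "signed_fact (\<mu> None) * comb_coeff (swap_comb cs) (flip_exp \<mu>) =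
    signed_fact (\<mu> None + \<beta> None) * comb_coeff cs \<mu>"
  using assms
proof (induction cs)
  case (Cons a cs)
  obtain c x where a: "a = (c, x)" by (cases a)
  have x: "word_shift x = \<beta>" "int (length x) \<le> \<mu> None"
    using Cons.prems[of c x] by (simp_all add: a)
  have IH: "signed_fact (\<mu> None) * comb_coeff (swap_comb cs) (flip_exp \<mu>) =
      signed_fact (\<mu> None + \<beta> None) * comb_coeff cs \<mu>"
  proof (rule Cons.IH)
    fix d y assume "(d, y) \<in> set cs"
    then show "word_shift y = \<beta> \<and> int (length y) \<le> \<mu> None"
      by (intro Cons.prems[of d]) simp
  qed
  have "signed_fact (\<mu> None) * comb_coeff (swap_comb (a # cs)) (flip_exp \<mu>) =
      c * (signed_fact (\<mu> None) * (word_sgn x * word_coeff (map swap_letter x) (flip_exp \<mu>))) +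
      signed_fact (\<mu> None) * comb_coeff (swap_comb cs) (flip_exp \<mu>)"
    by (simp add: swap_comb_def comb_coeff_def a algebra_simps)
  then show ?case
    unfolding swap_word_coeff(1)[where x = x and \<mu> = \<mu>, OF x(2)] IH x(1) by (simp add: comb_coeff_def a algebra_simps)
qed (simp add: swap_comb_def comb_coeff_def)

lemma comb_coeff_ipoly:
  fixes cs :: "(complex \<times> 'n letter list) list"
  shows "comb_coeff cs \<in> ipoly"
proof (induction cs)
  case Nil
  have "comb_coeff ([] :: (complex \<times> 'n letter list) list) = (\<lambda>\<mu>. 0)" by (rule ext) (simp add: comb_coeff_def)
  then show ?case by (metis ipoly.const)
next
  case (Cons a cs)
  obtain c x where a: "a = (c, x)" by (cases a)
  have "comb_coeff (a # cs) = (\<lambda>\<mu>. c * word_coeff x \<mu> + comb_coeff cs \<mu>)"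
    by (rule ext) (simp add: comb_coeff_def a)
  moreover have "(\<lambda>\<mu>. c * word_coeff x \<mu> + comb_coeff cs \<mu>) \<in> ipoly"
    by (intro ipoly.intros word_coeff_ipoly Cons)
  ultimately show ?case by metis
qed

lemma comb_part_swap: "comb_part (flip_shift \<beta>) (swap_comb cs) = swap_comb (comb_part \<beta> cs)"
proof (induction cs)
  case (Cons a cs)
  obtain c x where a: "a = (c, x)" by (cases a)
  have "flip_shift (word_shift x) = flip_shift \<beta> \<longleftrightarrow> word_shift x = \<beta>"
    by (metis flip_shift_flip)
  then show ?case
    using Cons by (simp add: a comb_part_def swap_comb_def swap_word_shift)
qed (simp add: comb_part_def swap_comb_def)

text \<open>On a ray of weight 0 along which the last exponent grows, the two coefficients
  eventually differ by nonzero factors only. Both are polynomial, so vanishing spreads back to the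
  start of the ray. The threshold \<open>L\<close> bounds the word lengths, hence how far an
  exponent can fall.\<close>

lemma swap_part_zero_iff:
  fixes cs :: "(complex \<times> 'n::finite letter list) list"
  shows "(\<forall>\<mu>. wdeg w \<mu> = l \<longrightarrow> comb_coeff (comb_part \<beta> cs) \<mu> = 0) \<longleftrightarrow>
    (\<forall>\<mu>. wdeg (- w) \<mu> = l + w \<longrightarrow> comb_coeff (comb_part (flip_shift \<beta>) (swap_comb cs)) \<mu> = 0)"
proof -
  fix i :: 'n
  define ds where "ds = comb_part \<beta> cs"
  define L where "L = Max (insert 0 ((\<lambda>(c, x). int (length x)) ` set ds))"
  have L: "int (length x) \<le> L" if "(c, x) \<in> set ds" for c x
    unfolding L_def using that by (intro Max_ge) (auto intro: rev_image_eqI)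
  have shift: "word_shift x = \<beta>" if "(c, x) \<in> set ds" for c x
    using that by (auto simp: ds_def comb_part_def)
  \<comment> \<open>The entry \<open>-w\<close> in a coordinate of weight 1 compensates the growth
    of the last exponent.\<close>
  define v where "v = ((\<lambda>_. 0)(None := 1))(Some i := - w)"
  have v: "wdeg w v = 0" by (simp add: v_def wdeg_upd wdeg_zero) (simp add: wt_def)
  \<comment> \<open>The flipped ray: growing \<open>k\<close> means falling \<open>-1 - k\<close>,
    so on the other side the ray runs towards ever deeper poles.\<close>
  define v' where "v' = v(None := - 1)"
  have ray: "flip_exp (\<lambda>j. \<mu> j + t * v j) = (\<lambda>j. flip_exp \<mu> j + t * v' j)" for \<mu> t
    by (auto simp: flip_exp_def v_def v'_def)
  have key: "comb_coeff (swap_comb ds) (flip_exp (\<lambda>j. \<mu> j + t * v j)) = 0 \<longleftrightarrow>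
      comb_coeff ds (\<lambda>j. \<mu> j + t * v j) = 0" if "L - \<mu> None \<le> t" for \<mu> t
  proof -
    have "(\<lambda>j. \<mu> j + t * v j) None \<ge> L" using that by (simp add: v_def)
    then have "word_shift x = \<beta> \<and> int (length x) \<le> (\<lambda>j. \<mu> j + t * v j) None" if "(c, x) \<in> set ds" for c x
      using L[OF that] shift[OF that] by linarith
    from swap_comb_coeff[where cs = ds and \<beta> = \<beta> and \<mu> = "\<lambda>j. \<mu> j + t * v j", OF this]
    have e: "signed_fact (\<mu> None + t * v None) * comb_coeff (swap_comb ds) (flip_exp (\<lambda>j. \<mu> j + t * v j)) =
        signed_fact (\<mu> None + t * v None + \<beta> None) * comb_coeff ds (\<lambda>j. \<mu> j + t * v j)" .
    have "comb_coeff (swap_comb ds) (flip_exp (\<lambda>j. \<mu> j + t * v j)) = 0 \<longleftrightarrow>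
        signed_fact (\<mu> None + t * v None) * comb_coeff (swap_comb ds) (flip_exp (\<lambda>j. \<mu> j + t * v j)) = 0"
      by (simp add: signed_fact_nonzero)
    also have "\<dots> \<longleftrightarrow> comb_coeff ds (\<lambda>j. \<mu> j + t * v j) = 0"
      unfolding e by (simp add: signed_fact_nonzero)
    finally show ?thesis .
  qed
  have "(\<forall>\<mu>. wdeg w \<mu> = l \<longrightarrow> comb_coeff ds \<mu> = 0) \<longleftrightarrow>
      (\<forall>\<mu>. wdeg (- w) \<mu> = l + w \<longrightarrow> comb_coeff (swap_comb ds) \<mu> = 0)"
  proof (intro iffI allI impI)
    fix \<mu>' :: "'n option \<Rightarrow> int"
    assume z: "\<forall>\<mu>. wdeg w \<mu> = l \<longrightarrow> comb_coeff ds \<mu> = 0" and \<mu>': "wdeg (- w) \<mu>' = l + w"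
    define \<mu> where "\<mu> = flip_exp \<mu>'"
    have \<mu>: "\<mu>' = flip_exp \<mu>" "wdeg w \<mu> = l"
      using wdeg_flip_exp[of w \<mu>] \<mu>' by (simp_all add: \<mu>_def)
    have "comb_coeff (swap_comb ds) (\<lambda>j. flip_exp \<mu> j + t * v' j) = 0" if "L - \<mu> None \<le> t" for t
      using key[of \<mu> t, OF that] z \<mu>(2) v unfolding ray by (simp add: wdeg_add wdeg_scale)
    then show "comb_coeff (swap_comb ds) \<mu>' = 0"
      unfolding \<mu>(1) by (rule ipoly_zero_ray[OF comb_coeff_ipoly])
  next
    fix \<mu> :: "'n option \<Rightarrow> int"
    assume z: "\<forall>\<mu>. wdeg (- w) \<mu> = l + w \<longrightarrow> comb_coeff (swap_comb ds) \<mu> = 0" and \<mu>: "wdeg w \<mu> = l"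
    have "comb_coeff ds (\<lambda>j. \<mu> j + t * v j) = 0" if "L - \<mu> None \<le> t" for t
      using key[of \<mu> t, OF that] z \<mu> v by (simp add: wdeg_flip_exp wdeg_add wdeg_scale)
    then show "comb_coeff ds \<mu> = 0"
      by (rule ipoly_zero_ray[OF comb_coeff_ipoly])
  qed
  then show ?thesis by (simp add: ds_def comb_part_swap)
qed

lemma swap_comb_append: "swap_comb (cs @ ds) = swap_comb cs @ swap_comb ds"
  by (simp add: swap_comb_def)

lemma swap_comb_neg: "swap_comb (neg_comb cs) = neg_comb (swap_comb cs)"
  by (simp add: swap_comb_def neg_comb_def case_prod_unfold)

lemma swap_comb_mult: "swap_comb (comb_mult cs ds) = comb_mult (swap_comb cs) (swap_comb ds)"
  by (simp add: swap_comb_def comb_mult_def map_concat case_prod_unfold comp_def word_sgn_def ac_simps)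

text \<open>Swapping again restores the words, and the sign put in beforehand cancels the one that
  \<open>swap_comb\<close> introduces.\<close>

lemma swap_comb_surj: "\<exists>cs. swap_comb cs = ds"
proof
  show "swap_comb (map (\<lambda>(c, x). (c * word_sgn (map swap_letter x), map swap_letter x)) ds) = ds"
    by (simp add: swap_comb_def case_prod_unfold comp_def mult.assoc word_sgn_square)
qed

section \<open>The transform on operators\<close>

locale dual_cone_quotients = X: cone_quotient w T + Y: cone_quotient "- w" T'
  for w :: int and T T' :: "'n::finite point set topology" +
  assumes card: "CARD('n) \<ge> 2" and w: "w \<noteq> 0"
begin

lemma homog_swap: "Y.homog_comb (swap_comb cs) \<longleftrightarrow> X.homog_comb cs"
  by (auto simp: X.homog_comb_def Y.homog_comb_def swap_comb_def swap_word_shift wdeg_flip_shift)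

lemma swap_eq_0_iff:
  assumes "X.homog_comb cs"
  shows "Y.comb_hom (l + w) (swap_comb cs) = (\<lambda>W f Q. 0) \<longleftrightarrow> X.comb_hom l cs = (\<lambda>W f Q. 0)"
proof -
  have "Y.comb_hom (l + w) (swap_comb cs) = (\<lambda>W f Q. 0) \<longleftrightarrow>
    (\<forall>\<beta> \<mu>. wdeg (- w) \<mu> = l + w \<longrightarrow> comb_coeff (comb_part \<beta> (swap_comb cs)) \<mu> = 0)"
    using assms by (intro Y.comb_hom_eq_0_iff) (simp add: homog_swap)
  also have "\<dots> \<longleftrightarrow> (\<forall>\<beta> \<mu>. wdeg (- w) \<mu> = l + w \<longrightarrow>
      comb_coeff (comb_part (flip_shift \<beta>) (swap_comb cs)) \<mu> = 0)"
    by (metis flip_shift_flip)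
  also have "\<dots> \<longleftrightarrow> X.comb_hom l cs = (\<lambda>W f Q. 0)"
    unfolding X.comb_hom_eq_0_iff[OF assms] using swap_part_zero_iff by blast
  finally show ?thesis .
qed

lemma comb_hom_neg:
  "X.comb_hom l (neg_comb cs) W f Q = - X.comb_hom l cs W f Q"
  "Y.comb_hom l (neg_comb cs) W f Q = - Y.comb_hom l cs W f Q"
  by (induction cs) (auto simp: X.comb_hom_def Y.comb_hom_def neg_comb_def)

lemma swap_eq_iff:
  assumes cs: "X.homog_comb cs" and ds: "X.homog_comb ds"
  shows "Y.comb_hom (l + w) (swap_comb cs) = Y.comb_hom (l + w) (swap_comb ds) \<longleftrightarrow>
    X.comb_hom l cs = X.comb_hom l ds"
proof -
  have h: "X.homog_comb (cs @ neg_comb ds)"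
    using cs ds by (auto simp: X.homog_comb_def neg_comb_def)
  show ?thesis
    using swap_eq_0_iff[OF h, of l]
    by (simp add: fun_eq_iff swap_comb_append swap_comb_neg X.comb_hom_append Y.comb_hom_append
        comb_hom_neg del: split_paired_All)
qed

text \<open>An arbitrary representing combination is chosen. One direction of
  \<open>swap_eq_iff\<close> makes the result independent of it, the other gives
  injectivity.\<close>

definition fourier :: "int \<Rightarrow> 'n point sheaf_map \<Rightarrow> 'n point sheaf_map" where
  "fourier l P = Y.comb_hom (l + w) (swap_comb (SOME cs. X.homog_comb cs \<and> P = X.comb_hom l cs))"

lemma fourier_comb:
  assumes "X.homog_comb cs"
  shows "fourier l (X.comb_hom l cs) = Y.comb_hom (l + w) (swap_comb cs)"
proof -
  have "\<exists>ds. X.homog_comb ds \<and> X.comb_hom l cs = X.comb_hom l ds" using assms by blast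
  from someI_ex[OF this] show ?thesis
    unfolding fourier_def using assms by (subst swap_eq_iff) simp_all
qed

theorem diff_op_ring_iso:
  "diff_op_ring T (gsh w T 0) (gsh w T l) \<simeq> diff_op_ring T' (gsh (- w) T' 0) (gsh (- w) T' (l + w))"
    (is "?R \<simeq> ?S")
proof -
  have R: "P \<in> carrier ?R \<longleftrightarrow> (\<exists>cs. X.homog_comb cs \<and> P = X.comb_hom l cs)" for P
    using X.diff_op_is_comb_hom[OF card w] X.comb_hom_carrier
    unfolding diff_op_ring_def by (auto simp del: split_paired_All split_paired_Ex)
  have S: "P \<in> carrier ?S \<longleftrightarrow> (\<exists>cs. Y.homog_comb cs \<and> P = Y.comb_hom (l + w) cs)" for P
    using Y.diff_op_is_comb_hom[OF card] w Y.comb_hom_carrier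
    unfolding diff_op_ring_def by (auto simp del: split_paired_All split_paired_Ex)
  have "fourier l \<in> ring_hom ?R ?S"
  proof (rule ring_hom_memI)
    fix P assume "P \<in> carrier ?R"
    then obtain cs where cs: "X.homog_comb cs" "P = X.comb_hom l cs" using R by blast
    then show "fourier l P \<in> carrier ?S"
      using S fourier_comb homog_swap by blast
    fix Q assume "Q \<in> carrier ?R"
    then obtain ds where ds: "X.homog_comb ds" "Q = X.comb_hom l ds" using R by blast
    have "P \<otimes>\<^bsub>?R\<^esub> Q = (\<lambda>V f. P V (Q V f))"
      by (simp add: diff_op_ring_def)
    also have "\<dots> = X.comb_hom l (comb_mult cs ds)"
      unfolding cs(2) ds(2) by (intro ext) (simp only: X.comb_hom_mult[OF cs(1) ds(1)])
    finally have "P \<otimes>\<^bsub>?R\<^esub> Q = X.comb_hom l (comb_mult cs ds)" .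
    moreover have "Y.comb_hom (l + w) (swap_comb cs) \<otimes>\<^bsub>?S\<^esub> Y.comb_hom (l + w) (swap_comb ds) =
        Y.comb_hom (l + w) (comb_mult (swap_comb cs) (swap_comb ds))"
      using Y.comb_hom_mult homog_swap cs(1) ds(1) by (simp add: diff_op_ring_def fun_eq_iff)
    ultimately show "fourier l (P \<otimes>\<^bsub>?R\<^esub> Q) = fourier l P \<otimes>\<^bsub>?S\<^esub> fourier l Q"
      using fourier_comb X.homog_comb_mult cs ds by (simp add: swap_comb_mult)
    have "P \<oplus>\<^bsub>?R\<^esub> Q = X.comb_hom l (cs @ ds)"
      using cs(2) ds(2) by (simp add: diff_op_ring_def X.comb_hom_append fun_eq_iff)
    moreover have "Y.comb_hom (l + w) (swap_comb cs) \<oplus>\<^bsub>?S\<^esub> Y.comb_hom (l + w) (swap_comb ds) =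
        Y.comb_hom (l + w) (swap_comb cs @ swap_comb ds)"
      by (simp add: diff_op_ring_def Y.comb_hom_append fun_eq_iff)
    ultimately show "fourier l (P \<oplus>\<^bsub>?R\<^esub> Q) = fourier l P \<oplus>\<^bsub>?S\<^esub> fourier l Q"
      using fourier_comb X.homog_comb_append cs ds by (simp add: swap_comb_append)
  next
    have "\<one>\<^bsub>?R\<^esub> = X.comb_hom l [(1, [])]" "\<one>\<^bsub>?S\<^esub> = Y.comb_hom (l + w) [(1, [])]"
      by (simp_all add: diff_op_ring_def X.comb_hom_def Y.comb_hom_def fun_eq_iff)
    moreover have "swap_comb [(1, [])] = [(1, [])]"
      by (simp add: swap_comb_def word_sgn_def)
    moreover have "X.homog_comb [(1, [])]"
      by (simp add: X.homog_comb_def wdeg_zero)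
    ultimately show "fourier l \<one>\<^bsub>?R\<^esub> = \<one>\<^bsub>?S\<^esub>"
      using fourier_comb by metis
  qed
  moreover have "inj_on (fourier l) (carrier ?R)"
  proof (rule inj_onI)
    fix P Q assume "P \<in> carrier ?R" "Q \<in> carrier ?R" "fourier l P = fourier l Q"
    then obtain cs ds where "X.homog_comb cs" "P = X.comb_hom l cs" "X.homog_comb ds" "Q = X.comb_hom l ds"
      "fourier l P = fourier l Q" using R by blast
    then show "P = Q" using fourier_comb swap_eq_iff by simp
  qed
  moreover have "carrier ?S \<subseteq> fourier l ` carrier ?R"
  proof
    fix Q assume "Q \<in> carrier ?S"
    then obtain ds where ds: "Y.homog_comb ds" "Q = Y.comb_hom (l + w) ds" using S by blast
    obtain cs where cs: "swap_comb cs = ds" using swap_comb_surj by blast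
    then have "X.homog_comb cs" using ds(1) homog_swap by blast
    then show "Q \<in> fourier l ` carrier ?R"
      using fourier_comb[of cs l] ds(2) cs R by (intro image_eqI[of _ _ "X.comb_hom l cs"]) auto
  qed
  ultimately have "fourier l \<in> ring_iso ?R ?S"
    unfolding ring_iso_def bij_betw_def using ring_hom_closed by fastforce
  then show ?thesis unfolding is_ring_iso_def by blast
qed

end

section \<open>The two varieties\<close>

lemma crd_act_0_iff: "u \<noteq> 0 \<Longrightarrow> crd (act w u Q) j = 0 \<longleftrightarrow> crd Q j = 0"
  by (simp add: crd_act)

lemma fst_eq_0_iff: "fst Q = 0 \<longleftrightarrow> (\<forall>i. crd Q (Some i) = 0)"
  by (simp add: crd_def vec_eq_iff)

lemma point_eq_0_iff: "Q = 0 \<longleftrightarrow> (\<forall>j. crd Q j = 0)"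
proof -
  have "Q = 0 \<longleftrightarrow> fst Q = 0 \<and> snd Q = 0" by (simp add: prod_eq_iff)
  also have "\<dots> \<longleftrightarrow> (\<forall>j. crd Q j = 0)"
    unfolding fst_eq_0_iff split_option_all by (auto simp: crd_def)
  finally show ?thesis .
qed

lemma openin_zariski_crd: "openin zariski {Q. \<exists>j\<in>J. crd Q j \<noteq> 0}"
proof -
  have "{Q. \<exists>j\<in>J. crd Q j \<noteq> 0} = \<Union>((\<lambda>j. {Q. crd Q j \<noteq> 0}) ` J)" by auto
  then show ?thesis
    using openin_zariski_nonzero[OF hpoly_polys[OF hpoly_crd]] by (auto intro!: openin_Union)
qed

text \<open>\<open>J\<close> lists the coordinates that must not all vanish:
  \<open>range Some\<close> for the total space, \<open>UNIV\<close> for the weighted projective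
  space.\<close>

lemma Union_orbits:
  assumes h: "h \<in> hpoly w d"
  shows "\<Union>{z \<in> {orbit w Q | Q. \<exists>j\<in>J. crd Q j \<noteq> 0}. \<forall>Q\<in>z. h Q \<noteq> 0} =
    {Q. \<exists>j\<in>J. crd Q j \<noteq> 0} \<inter> {Q. h Q \<noteq> 0}" (is "\<Union>?A = ?B")
proof
  show "\<Union>?A \<subseteq> ?B"
  proof
    fix R assume "R \<in> \<Union>?A"
    then obtain Q j where "R \<in> orbit w Q" "j \<in> J" "crd Q j \<noteq> 0" "h R \<noteq> 0" by blast
    then show "R \<in> ?B" by (auto simp: orbit_def crd_act_0_iff simp del: split_paired_Ex)
  qed
  show "?B \<subseteq> \<Union>?A"
  proof
    fix Q assume Q: "Q \<in> ?B"
    have "h R \<noteq> 0" if R: "R \<in> orbit w Q" for R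
    proof -
      obtain u where "u \<noteq> 0" "R = act w u Q" using R by (auto simp: orbit_def)
      then show ?thesis using Q hpoly_act[OF h] by simp
    qed
    then have "orbit w Q \<in> ?A" using Q by blast
    moreover have "Q \<in> orbit w Q" by (force simp: orbit_def act_def intro: exI[of _ 1])
    ultimately show "Q \<in> \<Union>?A" by blast
  qed
qed

lemma Union_orbits_open:
  assumes "h \<in> hpoly w d"
  shows "openin zariski (\<Union>{z \<in> {orbit w Q | Q. \<exists>j\<in>J. crd Q j \<noteq> 0}. \<forall>Q\<in>z. h Q \<noteq> 0})"
  unfolding Union_orbits[OF assms]
  using openin_zariski_crd openin_zariski_nonzero[OF hpoly_polys[OF assms]] by (intro openin_Int)

lemma Xt_points_eq: "Xt_points = {orbit (-2) Q | Q. \<exists>j\<in>range Some. crd Q j \<noteq> 0}"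
  unfolding Xt_points_def fst_eq_0_iff by auto

lemma Y_points_eq: "Y_points = {orbit 2 Q | Q. \<exists>j\<in>UNIV. crd Q j \<noteq> 0}"
  unfolding Y_points_def point_eq_0_iff by auto

section \<open>Both varieties as quotients of cones\<close>

lemma openin_Xt_nonzero:
  assumes "h \<in> hpoly (-2) d"
  shows "openin Xt_top {z \<in> Xt_points. \<forall>Q\<in>z. h Q \<noteq> 0}"
  unfolding openin_Xt Xt_points_eq by (intro conjI Union_orbits_open[OF assms]) blast

lemma topspace_Xt: "topspace Xt_top = Xt_points"
proof (rule subset_antisym)
  show "topspace Xt_top \<subseteq> Xt_points"
    using openin_topspace[of Xt_top] unfolding openin_Xt by blast
  have "openin Xt_top {z \<in> Xt_points. \<forall>Q\<in>z. (1::complex) \<noteq> 0}"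
    by (rule openin_Xt_nonzero[OF hpoly_const])
  then show "Xt_points \<subseteq> topspace Xt_top" using openin_subset by fastforce
qed

interpretation Xt: cone_quotient "-2" Xt_top
proof
  show "topspace Xt_top \<subseteq> range (orbit (-2))"
    unfolding topspace_Xt Xt_points_def by blast
  show "fst Q \<noteq> 0 \<Longrightarrow> orbit (-2) Q \<in> topspace Xt_top" for Q :: "'a point"
    unfolding topspace_Xt Xt_points_def by blast
  show "openin Xt_top U \<Longrightarrow> openin zariski (\<Union>U)" for U :: "'a point set set"
    unfolding openin_Xt by blast
  show "h \<in> hpoly (-2) d \<Longrightarrow> openin Xt_top {z \<in> topspace Xt_top. \<forall>Q\<in>z. h Q \<noteq> 0}"
    for h :: "'a point \<Rightarrow> complex" and d
    unfolding topspace_Xt by (rule openin_Xt_nonzero)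
qed

lemma openin_Y_nonzero: "h \<in> hpoly 2 d \<Longrightarrow> openin Y_top {z \<in> Y_points. \<forall>Q\<in>z. h Q \<noteq> 0}"
  unfolding Y_top_def S_deg_eq by (intro topology_generated_by_Basis) blast

lemma topspace_Y: "topspace Y_top = Y_points"
proof (rule subset_antisym)
  show "topspace Y_top \<subseteq> Y_points"
    unfolding Y_top_def topology_generated_by_topspace by blast
  have "openin Y_top {z \<in> Y_points. \<forall>Q\<in>z. (1::complex) \<noteq> 0}"
    by (rule openin_Y_nonzero[OF hpoly_const])
  then show "Y_points \<subseteq> topspace Y_top" using openin_subset by fastforce
qed

lemma openin_Y_zariski:
  assumes "openin Y_top U"
  shows "openin zariski (\<Union>U)"
proof -
  have "generate_topology_on {{z \<in> Y_points. \<forall>Q\<in>z. h Q \<noteq> 0} | h d. h \<in> hpoly 2 d} U"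
    using assms by (simp add: Y_top_def S_deg_eq openin_topology_generated_by_iff)
  then have "U \<subseteq> Y_points \<and> openin zariski (\<Union>U)"
  proof (induction rule: generate_topology_on.induct)
    case (Int a b)
    have "Y_points \<subseteq> range (orbit 2)" unfolding Y_points_def by blast
    then have "\<Union>(a \<inter> b) = \<Union>a \<inter> \<Union>b"
      using Int by (intro Union_Int_orbits[where w = 2]) auto
    then show ?case using Int by (auto intro: openin_Int)
  next
    case (UN K)
    have "\<Union>(\<Union>K) = \<Union>(Union ` K)" by blast
    moreover have "openin zariski (\<Union>(Union ` K))" using UN by (intro openin_Union) auto
    moreover have "\<Union>K \<subseteq> Y_points" using UN.IH by blast
    ultimately show ?case by simp
  next
    case (Basis s)
    then show ?case using Union_orbits_open unfolding Y_points_eq by blast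
  qed simp
  then show ?thesis by blast
qed

interpretation Y: cone_quotient 2 Y_top
proof
  show "topspace Y_top \<subseteq> range (orbit 2)"
    unfolding topspace_Y Y_points_def by blast
  show "orbit 2 Q \<in> topspace Y_top" if "fst Q \<noteq> 0" for Q :: "'a point"
  proof -
    have "Q \<noteq> 0" using that by auto
    then show ?thesis unfolding topspace_Y Y_points_def by blast
  qed
  show "openin Y_top U \<Longrightarrow> openin zariski (\<Union>U)" for U :: "'a point set set"
    by (rule openin_Y_zariski)
  show "h \<in> hpoly 2 d \<Longrightarrow> openin Y_top {z \<in> topspace Y_top. \<forall>Q\<in>z. h Q \<noteq> 0}"
    for h :: "'a point \<Rightarrow> complex" and d
    unfolding topspace_Y by (rule openin_Y_nonzero)
qed

section \<open>Agreement of the descriptions of the sheaves\<close>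

lemma Y_sheaf_eq: "Y_sheaf m U = gsh 2 Y_top m U"
  unfolding Y_sheaf_def gsh_def S_deg_eq ..

text \<open>Components are given for all integers, as 0 outside a finite set, so those of two
  polynomials can be compared degree by degree.\<close>

lemma polys_components:
  assumes "f \<in> polys"
  shows "\<exists>A S. finite S \<and> (\<forall>d. A d \<in> hpoly w d) \<and> (\<forall>d. d \<notin> S \<longrightarrow> A d = (\<lambda>Q. 0)) \<and>
    (\<forall>Q. f Q = (\<Sum>d\<in>S. A d Q))"
  using assms
proof (induction rule: poly_span_induct)
  case zero
  show ?case by (rule exI[of _ "\<lambda>d Q. 0"], rule exI[of _ "{}"]) (simp add: hpoly_0)
next
  case (add c m f)
  then obtain A S where A: "finite S" "\<And>d. A d \<in> hpoly w d" "\<And>d. d \<notin> S \<Longrightarrow> A d = (\<lambda>Q. 0)"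
    "\<And>Q. f Q = (\<Sum>d\<in>S. A d Q)" by blast
  define e where "e = wdeg w (exps m)"
  define B where "B = A(e := (\<lambda>Q. c * lmon (exps m) Q + A e Q))"
  have m: "lmon (exps m) \<in> hpoly w e" unfolding e_def by (rule hpoly_mon) simp
  have f: "f Q = (\<Sum>d\<in>insert e S. A d Q)" for Q
    unfolding A(4) using A(1,3) by (intro sum.mono_neutral_left) auto
  have "c * lmon (exps m) Q + f Q = (\<Sum>d\<in>insert e S. B d Q)" for Q
  proof -
    have "(\<Sum>d\<in>insert e S. B d Q) = B e Q + (\<Sum>d\<in>insert e S - {e}. B d Q)"
      using A(1) by (intro sum.remove) auto
    also have "(\<Sum>d\<in>insert e S - {e}. B d Q) = (\<Sum>d\<in>insert e S - {e}. A d Q)"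
      by (intro sum.cong) (auto simp: B_def)
    also have "B e Q + \<dots> = c * lmon (exps m) Q + (A e Q + (\<Sum>d\<in>insert e S - {e}. A d Q))"
      by (simp add: B_def)
    also have "A e Q + (\<Sum>d\<in>insert e S - {e}. A d Q) = f Q"
      unfolding f using A(1) by (intro sum.remove[symmetric]) auto
    finally show ?thesis by simp
  qed
  moreover have "B d \<in> hpoly w d" for d
    using A(2) m by (auto simp: B_def intro!: hpoly_add hpoly_scale)
  moreover have "B d = (\<lambda>Q. 0)" if "d \<notin> insert e S" for d
    using that A(3) by (simp add: B_def)
  ultimately show ?case using A(1) by (intro exI[of _ B] exI[of _ "insert e S"]) (auto simp del: split_paired_All)
qed

lemma powi_independent:
  assumes "finite S" and "\<And>u::complex. u \<noteq> 0 \<Longrightarrow> (\<Sum>d\<in>S. c d * u powi d) = 0"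
  shows "\<forall>d\<in>S. c d = 0"
proof (rule dedekind_independence[where G = "{u. u \<noteq> 0}" and ch = "\<lambda>d u. u powi d" and m = "(*)" and e = 1])
  fix d e :: int assume "d \<noteq> e"
  then show "\<exists>u\<in>{u::complex. u \<noteq> 0}. u powi d \<noteq> u powi e"
    by (intro bexI[of _ 2]) (auto simp: powi_2_inject)
qed (use assms in \<open>auto simp: power_int_mult_distrib\<close>)

text \<open>A regular function is locally a fraction of polynomials that need not be homogeneous.
  The equation \<open>f * b = a\<close> holds on the whole preimage, and equivariance splits it into
  components: \<open>f\<close> times the component of \<open>b\<close> in degree \<open>d\<close> is
  the component of \<open>a\<close> in degree \<open>l + d\<close>. Near \<open>Q\<close> a
  component of \<open>b\<close> that is nonzero at \<open>Q\<close> serves as denominator.\<close>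

lemma Xt_sheaf_eq:
  fixes U :: "'n::finite point set set"
  assumes U: "openin Xt_top U"
  shows "Xt_sheaf l U = gsh (-2) Xt_top l U"
proof (intro subset_antisym subsetI)
  fix f assume f: "f \<in> gsh (-2) Xt_top l U"
  have "f \<in> regular_funs (\<Union>U)"
    unfolding regular_funs_def mem_Collect_eq
  proof (intro conjI allI impI ballI)
    show "f Q = 0" if "Q \<notin> \<Union>U" for Q using Xt.Sh_outside[OF f that] .
    fix Q assume "Q \<in> \<Union>U"
    from Xt.Sh_local_frac[OF U f this] obtain V where
      V: "openin Xt_top V" "Q \<in> \<Union>V" "V \<subseteq> U" "frac_on (-2) l f V" .
    from frac_onE[OF V(4)] obtain d a b where
      ab: "a \<in> hpoly (-2) (l + d)" "b \<in> hpoly (-2) d" "\<forall>R\<in>\<Union>V. b R \<noteq> 0 \<and> f R = a R / b R"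
      by metis
    show "\<exists>N a b. openin zariski N \<and> Q \<in> N \<and> N \<subseteq> \<Union>U \<and> a \<in> polys \<and> b \<in> polys \<and>
        (\<forall>R\<in>N. b R \<noteq> 0 \<and> f R = a R / b R)"
      by (rule exI[of _ "\<Union>V"], rule exI[of _ a], rule exI[of _ b], intro conjI)
        (rule Xt.openin_zariski[OF V(1)] V(2) Union_mono[OF V(3)] hpoly_polys[OF ab(1)]
          hpoly_polys[OF ab(2)] ab(3))+
  qed
  then show "f \<in> Xt_sheaf l U"
    unfolding Xt_sheaf_def using Xt.Sh_act[OF U f] by blast
next
  fix f assume "f \<in> Xt_sheaf l U"
  then have reg: "f \<in> regular_funs (\<Union>U)"
    and act: "\<And>u Q. u \<noteq> 0 \<Longrightarrow> Q \<in> \<Union>U \<Longrightarrow> f (act (-2) u Q) = u powi l * f Q"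
    unfolding Xt_sheaf_def by blast+
  have loc: "\<exists>N a b. openin zariski N \<and> Q \<in> N \<and> N \<subseteq> \<Union>U \<and> a \<in> polys \<and> b \<in> polys \<and>
        (\<forall>R\<in>N. b R \<noteq> 0 \<and> f R = a R / b R)" if "Q \<in> \<Union>U" for Q
    using reg that unfolding regular_funs_def by blast
  show "f \<in> gsh (-2) Xt_top l U"
  proof (rule Xt.ShI[OF U])
    show "f Q = 0" if "Q \<notin> \<Union>U" for Q
      using reg that unfolding regular_funs_def by blast
    fix Q assume Q: "Q \<in> \<Union>U"
    obtain N a b where N: "openin zariski N" "Q \<in> N" "N \<subseteq> \<Union>U" "a \<in> polys" "b \<in> polys"
      "\<forall>R\<in>N. b R \<noteq> 0 \<and> f R = a R / b R" using loc[OF Q] by metis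
    have fb: "f R * b R = a R" if R: "R \<in> \<Union>U" for R
    proof -
      obtain N' a' b' where N': "openin zariski N'" "R \<in> N'" "N' \<subseteq> \<Union>U" "a' \<in> polys" "b' \<in> polys"
        "\<forall>R\<in>N'. b' R \<noteq> 0 \<and> f R = a' R / b' R" using loc[OF R] by metis
      have o: "openin zariski (N \<inter> N')" "N \<inter> N' \<noteq> {}"
        using zariski_Int_nonempty[of N N'] N(1,2) N'(1,2) by auto
      have p: "(\<lambda>S. a' S * b S - a S * b' S) \<in> polys"
        using N N' by (intro polys_diff polys_mult)
      have "a' S * b S - a S * b' S = 0" if "S \<in> N \<inter> N'" for S
        using N(6)[rule_format, of S] N'(6)[rule_format, of S] that by (simp add: field_simps)
      then have "a' R * b R - a R * b' R = 0"
        using polys_zero_on_open[OF p o] by blast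
      then show ?thesis using N'(6)[rule_format, OF N'(2)] by (simp add: field_simps)
    qed
    obtain A S where A: "finite S" "\<And>d. A d \<in> hpoly (-2) d" "\<And>d. d \<notin> S \<Longrightarrow> A d = (\<lambda>Q. 0)"
      "\<And>Q. a Q = (\<Sum>d\<in>S. A d Q)" using polys_components[OF N(4), of "-2"] by blast
    obtain B R where B: "finite R" "\<And>d. B d \<in> hpoly (-2) d" "\<And>d. d \<notin> R \<Longrightarrow> B d = (\<lambda>Q. 0)"
      "\<And>Q. b Q = (\<Sum>d\<in>R. B d Q)" using polys_components[OF N(5), of "-2"] by blast
    have comp: "f X * B d X = A (l + d) X" if X: "X \<in> \<Union>U" for X d
    proof -
      \<comment> \<open>\<open>f * B d\<close> and \<open>A (l + d)\<close> belong to the same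
        character \<open>u powi (l + d)\<close>, hence the shift of the degrees of \<open>b\<close>
        by \<open>l\<close>.\<close>
      define D where "D = S \<union> (+) l ` R"
      have D: "finite D" using A(1) B(1) by (simp add: D_def)
      have "\<forall>e\<in>D. f X * B (e - l) X - A e X = 0"
      proof (rule powi_independent[OF D])
        fix u :: complex assume u: "u \<noteq> 0"
        have "a (act (-2) u X) = (\<Sum>e\<in>S. u powi e * A e X)"
          unfolding A(4) by (intro sum.cong refl hpoly_act[OF A(2) u])
        also have "\<dots> = (\<Sum>e\<in>D. u powi e * A e X)"
          unfolding D_def using A(1,3) B(1) by (intro sum.mono_neutral_left) auto
        finally have a: "a (act (-2) u X) = (\<Sum>e\<in>D. u powi e * A e X)" .
        have "u powi l * b (act (-2) u X) = (\<Sum>e\<in>R. u powi (l + e) * B e X)"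
          unfolding B(4) sum_distrib_left
          by (intro sum.cong refl) (simp add: hpoly_act[OF B(2) u] power_int_add u)
        also have "\<dots> = (\<Sum>e\<in>(+) l ` R. u powi e * B (e - l) X)"
          by (subst sum.reindex) (auto simp: inj_on_def)
        also have "\<dots> = (\<Sum>e\<in>D. u powi e * B (e - l) X)"
        proof -
          have "B (e - l) X = 0" if "e \<notin> (+) l ` R" for e
          proof -
            have "e - l \<notin> R" using that by force
            then show ?thesis using B(3) by simp
          qed
          then show ?thesis unfolding D_def using A(1) B(1) by (intro sum.mono_neutral_left) auto
        qed
        finally have b: "u powi l * b (act (-2) u X) = (\<Sum>e\<in>D. u powi e * B (e - l) X)" .
        have "(\<Sum>e\<in>D. (f X * B (e - l) X - A e X) * u powi e) =
            f X * (\<Sum>e\<in>D. u powi e * B (e - l) X) - (\<Sum>e\<in>D. u powi e * A e X)"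
          by (simp add: sum_distrib_left sum_subtractf algebra_simps)
        also have "\<dots> = u powi l * f X * b (act (-2) u X) - a (act (-2) u X)"
          unfolding a b[symmetric] by simp
        also have "\<dots> = 0"
          using fb[OF Xt.act_mem[OF U X u]] act[OF u X] by simp
        finally show "(\<Sum>e\<in>D. (f X * B (e - l) X - A e X) * u powi e) = 0" .
      qed
      then have "f X * B (l + d - l) X - A (l + d) X = 0"
      proof (cases "l + d \<in> D")
        case False
        then have "l + d \<notin> S" "d \<notin> R" by (auto simp: D_def)
        then show ?thesis using A(3) B(3) by simp
      qed blast
      then show ?thesis by simp
    qed
    have "b Q \<noteq> 0" using N(2,6) by blast
    then obtain d where d: "B d Q \<noteq> 0" unfolding B(4) by (meson sum.neutral)
    define V where "V = U \<inter> Xt.nz (B d)"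
    have nz: "openin Xt_top (Xt.nz (B d))" by (rule Xt.openin_nz[OF B(2)])
    have V: "openin Xt_top V" unfolding V_def using U nz by (rule openin_Int)
    have VU: "\<Union>V = \<Union>U \<inter> {R \<in> \<Union>(topspace Xt_top). B d R \<noteq> 0}"
      unfolding V_def Xt.Union_Int[OF U nz] Xt.Union_nz[OF B(2)] ..
    have "Q \<in> \<Union>(topspace Xt_top)" using Q openin_subset[OF U] by blast
    then have "Q \<in> \<Union>V" unfolding VU using Q d by blast
    moreover have "frac_on (-2) l f V"
    proof (rule frac_onI[OF A(2) B(2)])
      fix R assume R: "R \<in> \<Union>V"
      show "B d R \<noteq> 0" using R unfolding VU by blast
      moreover have "R \<in> \<Union>U" using R unfolding VU by blast
      ultimately show "f R = A (l + d) R / B d R" using comp[of R d] by (simp add: field_simps)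
    qed
    ultimately show "\<exists>V. openin Xt_top V \<and> Q \<in> \<Union>V \<and> V \<subseteq> U \<and> frac_on (-2) l f V"
      using V unfolding V_def by blast
  qed
qed

theorem theorem1p2:
  fixes l :: int
  assumes "CARD('n::finite) \<ge> 2" and "even l"
  shows "diff_op_ring (Xt_top :: 'n point set topology) (Xt_sheaf 0) (Xt_sheaf l)
       \<simeq> diff_op_ring (Y_top :: 'n point set topology) (Y_sheaf 0) (Y_sheaf (l - 2))"
proof -
  \<comment> \<open>With \<open>w = -2\<close> the dual weight \<open>- w\<close> is 2 and the
    degree \<open>l + w\<close> is \<open>l - 2\<close>.\<close>
  interpret dual_cone_quotients "-2" "Xt_top :: 'n point set topology" "Y_top :: 'n point set topology"
    using assms(1) Y.cone_quotient_axioms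
    by (intro dual_cone_quotients.intro Xt.cone_quotient_axioms dual_cone_quotients_axioms.intro) simp_all
  have "diff_op_ring (Xt_top :: 'n point set topology) (Xt_sheaf 0) (Xt_sheaf l) =
      diff_op_ring Xt_top (gsh (-2) Xt_top 0) (gsh (-2) Xt_top l)"
    by (intro diff_op_ring_cong Xt_sheaf_eq)
  moreover have "diff_op_ring (Y_top :: 'n point set topology) (Y_sheaf 0) (Y_sheaf (l - 2)) =
      diff_op_ring Y_top (gsh (- (-2)) Y_top 0) (gsh (- (-2)) Y_top (l + (-2)))"
    by (intro diff_op_ring_cong) (simp_all add: Y_sheaf_eq)
  ultimately show ?thesis using diff_op_ring_iso[of l] by simp
qed

end
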